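(* Let $K$ be a finite oriented $n$-dimensional simplicial complex embedded in $\mathbb{R}^N$, let $G$ be a finite group acting on $K$ by simplicial isomorphisms that are isometries of $\mathbb{R}^N$, and let $d_k$ and $\star_k$ be the discrete exterior derivatives and (circumcentric) discrete Hodge stars. Suppose each participating Hodge star $\star_j$ is invertible. Then: (i) Any linear operator $P:\Omega_d^k(K)\to\Omega_d^\ell(K)$ that can be expressed through compositions and/or linear combinations (with scalar multiplication) of the operators $d_j,\star_j,\star_j^{-1}$ is $G$-equivariant: $P\circ\rho^k(g)=\rho^\ell(g)\circ P$ for all $g\in G$. (ii) Let $\phi_1,\dots,\phi_r$ be the distinct irreducible representations of $G$ (up to equivalence), with $\deg\phi_i=n_i$ and characters $\chi_i$, and let $$\Pi_i^k=\frac{n_i}{|G|}\sum_{g\in G}\chi_i(g^{-1})\,\rho^k(g).$$ Then $\Omega_d^k(K)$ decomposes uniquely into isotypic components, $$\Omega_d^k(K)=\bigoplus_{i=1}^r V_i^k,\qquad V_i^k=\Pi_i^k\,\Omega_d^k(K),$$ where $V_i^k$ is the isotypic component of type $\phi_i$. (iii) For any operator $P$ as in (i), when $\Omega_d^k(K)$ and $\Omega_d^\ell(K)$ are both expressed in symmetry-adapted bases constructed via transfer operators and ordered by irreducible representation, the matrix of $P$ is block-diagonal, $$[P]_{\mathrm{sym}}=\bigoplus_{i=1}^r[P]_i,$$ where $[P]_i$ is the (possibly rectangular) block corresponding to the $i$-th irreducible representation, i.e. to $V_i^k\to V_i^\ell$.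
   Context: Primal side. $C_k(K)$ is the real vector space of oriented $k$-chains, in which reversing the orientation of $\sigma$ gives $-\sigma$, with simplicial boundary $\partial_k$. $\Omega_d^k(K):=\mathrm{Hom}(C_k(K),\mathbb{R})$, pairing $\langle\alpha,\sigma\rangle:=\alpha(\sigma)$. $G$ acts on chains by $g[v_0,\dots,v_k]=[gv_0,\dots,gv_k]$, and $\langle\rho^k(g)\alpha,\sigma\rangle:=\langle\alpha,g^{-1}\sigma\rangle$. The exterior derivative $d_k:\Omega_d^k(K)\to\Omega_d^{k+1}(K)$ is $\langle d_k\alpha,\sigma\rangle:=\langle\alpha,\partial_{k+1}\sigma\rangle$. Dual cells. The circumcenter $c_\sigma$ of a simplex $\sigma$ is the unique point of the affine span of $\sigma$ equidistant from its vertices. For a $k$-simplex $\sigma$, the circumcentric dual $(n-k)$-cell $\star\sigma$ is the formal signed sum, over all flags $\sigma=\sigma^k\subset\sigma^{k+1}\subset\dots\subset\sigma^n$ of simplices of $K$ ($\dim\sigma^j=j$), of the (possibly degenerate) elementary simplices with vertices $(c_{\sigma^k},\dots,c_{\sigma^n})$; the sign of a flag is the product over $j=k,\dots,n-1$ of $+1$ if $c_{\sigma^{j+1}}$ lies, inside the affine span of $\sigma^{j+1}$, on the same side of the affine span of $\sigma^j$ as the vertex of $\sigma^{j+1}$ not in $\sigma^j$ (or on it), and $-1$ otherwise. $|\star\sigma|$ is the corresponding signed sum of $(n-k)$-dimensional Euclidean volumes, and $|\sigma|$ is the $k$-dimensional Euclidean volume of $\sigma$ (the volume of a point is $1$). Dual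 cochains. $C_{n-k}(\star K)$ is the real vector space generated by the symbols $\star\sigma$, $\sigma$ an oriented $k$-simplex, with $\star(-\sigma)=-\star\sigma$; $\Omega_d^{n-k}(\star K):=\mathrm{Hom}(C_{n-k}(\star K),\mathbb{R})$. $G$ acts on oriented dual cells by $\star\sigma\mapsto\star(g\sigma)$, and on dual cochains by $\langle\rho^{n-k}(g)\beta,\star\sigma\rangle:=\langle\beta,g^{-1}(\star\sigma)\rangle$. The dual exterior derivative, also written $d_{n-k}:\Omega_d^{n-k}(\star K)\to\Omega_d^{n-k+1}(\star K)$, is dual to the boundary $\partial(\star\eta)=\varepsilon_k\sum_\sigma[\sigma:\eta]\,\star\sigma$, where $\eta$ is an oriented $(k-1)$-simplex, the sum is over the $k$-simplices $\sigma$ containing $\eta$, $[\sigma:\eta]=\pm1$ is the coefficient of $\eta$ in $\partial_k\sigma$, and $\varepsilon_k\in\{\pm1\}$ is a fixed sign depending only on $n,k$ (the dual orientation convention). The operators $d_j$ in (i) may be primal or dual derivatives, as needed for the compositions to make sense. Discrete Hodge star. $\star_k:\Omega_d^k(K)\to\Omega_d^{n-k}(\star K)$, $\langle\star_k\alpha,\star\sigma\rangle:=\frac{|\star\sigma|}{|\sigma|}\langle\alpha,\sigma\rangle$. Representation theory. In (ii) and (iii), irreducible representations and characters are over $\mathbb{C}$ and cochain spaces are understood with complex coefficients (real coefficients suffice when all irreducible representations of $G$ are realizable over $\mathbb{R}$). The isotypic component of type $\phi_i$ is the sum of all subrepresentations equivalent to $\phi_i$. Transfer operators: fix matrix forms $(d^i_{pq}(g))_{1\le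 p,q\le n_i}$ of the $\phi_i$ (the same ones for domain and codomain) and for a representation $\rho$ set $P^i_{pq}=\frac{n_i}{|G|}\sum_{g\in G}d^i_{pq}(g^{-1})\rho(g)$. A symmetry-adapted basis is obtained as follows: for each $i$ choose a basis $v_1^1,\dots,v_1^{c_i}$ of the image of $P^i_{11}$ ($c_i$ is the multiplicity of $\phi_i$), put $v_m^s=P^i_{1m}v_1^s$ for $m=2,\dots,n_i$, order as $\beta_i=\{v_1^1,\dots,v_1^{c_i},v_2^1,\dots,v_2^{c_i},\dots,v_{n_i}^1,\dots,v_{n_i}^{c_i}\}$, and concatenate $\beta_1,\dots,\beta_r$. *)

theory Defs
  imports
    "HOL-Analysis.Analysis"
    "HOL-Library.Function_Algebras"
    "HOL-Combinatorics.Combinatorics"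
    "HOL-Algebra.Group_Action"
    "Jordan_Normal_Form.Matrix"
begin

text \<open>
  All chain, cochain and representation spaces below are sets of functions, with the pointwise
  operations of \<^theory>\<open>HOL-Library.Function_Algebras\<close> and the following scalar multiplication.
\<close>

definition pscale :: "'f::times \<Rightarrow> ('x \<Rightarrow> 'f) \<Rightarrow> 'x \<Rightarrow> 'f"
  where "pscale z f = (\<lambda>x. z * f x)"


section \<open>Geometry of simplices\<close>

text \<open>As in the library, a simplex is a convex hull, so its vertices are its extreme points.\<close>

definition vertices_of :: "'a::euclidean_space set \<Rightarrow> 'a set"
  where "vertices_of S = {x. x extreme_point_of S}"

definition orderings :: "'a::euclidean_space set \<Rightarrow> 'a list set"
  where "orderings S = {vs. distinct vs \<and> set vs = vertices_of S}"

text \<open>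
  The library's \<^const>\<open>simplicial_complex\<close> contains the empty simplex (of dimension -1); it is
  excluded wherever simplices of a dimension \<open>k :: nat\<close> are taken. An orientation of the complex
  is a choice of a vertex ordering for each simplex.
\<close>

definition oriented_complex ::
    "'a::euclidean_space set set \<Rightarrow> nat \<Rightarrow> ('a set \<Rightarrow> 'a list) \<Rightarrow> bool"
  where "oriented_complex K n ori \<longleftrightarrow>
    simplicial_complex K \<and>
    (\<exists>S\<in>K. int n simplex S) \<and> (\<forall>S\<in>K. aff_dim S \<le> int n) \<and>
    (\<forall>S\<in>K. ori S \<in> orderings S)"

definition circumcenter :: "'a::euclidean_space set \<Rightarrow> 'a"
  where "circumcenter S =
    (THE c. c \<in> affine hull S \<and> (\<exists>r. \<forall>v\<in>vertices_of S. dist c v = r))"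

text \<open>
  The \<open>k\<close>-dimensional Euclidean volume of a simplex \<open>X\<close> (possibly degenerate) in a space of
  dimension at least \<open>k\<close>: the Lebesgue measure of the set of coordinate vectors of \<open>X\<close> in an
  orthonormal frame \<open>(x0; b 0, \<dots>, b (k - 1))\<close> of a \<open>k\<close>-plane containing \<open>X\<close>. It does not depend
  on the frame. For \<open>k = 0\<close> the measure is the point mass on the empty tuple.
\<close>

definition volume :: "nat \<Rightarrow> 'a::euclidean_space set \<Rightarrow> real"
  where "volume k X = (THE v. \<exists>x0 b.
    (\<forall>i<k. \<forall>j<k. inner (b i) (b j) = (if i = j then 1 else 0)) \<and>
    (\<forall>x\<in>X. \<exists>y. x = x0 + (\<Sum>i<k. y i *\<^sub>R b i)) \<and>
    v = measure (Pi\<^sub>M {..<k} (\<lambda>_. lborel))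
          ((\<lambda>x. restrict (\<lambda>i. inner (x - x0) (b i)) {..<k}) ` X))"

definition flags :: "'a::euclidean_space set set \<Rightarrow> nat \<Rightarrow> nat \<Rightarrow> 'a set \<Rightarrow> 'a set list set"
  where "flags K n k S = {Ss. length Ss = Suc (n - k) \<and> Ss ! 0 = S \<and>
    (\<forall>i\<le>n - k. Ss ! i \<in> K \<and> int (k + i) simplex (Ss ! i)) \<and>
    (\<forall>i<n - k. Ss ! i \<subseteq> Ss ! Suc i)}"

text \<open>
  For a facet \<open>S\<close> of \<open>T\<close>, \<open>affine hull S\<close> is a hyperplane of \<open>affine hull T\<close>; two points of the
  latter off the hyperplane lie on the same side iff the segment between them misses it. There is
  exactly one \<open>v\<close> in \<open>vertices_of T - vertices_of S\<close>.
\<close>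

definition side_sign :: "'a::euclidean_space set \<Rightarrow> 'a set \<Rightarrow> real"
  where "side_sign S T =
    (if circumcenter T \<in> affine hull S \<or>
        (\<exists>v\<in>vertices_of T - vertices_of S.
           closed_segment (circumcenter T) v \<inter> affine hull S = {})
     then 1 else - 1)"

definition dual_volume :: "'a::euclidean_space set set \<Rightarrow> nat \<Rightarrow> nat \<Rightarrow> 'a set \<Rightarrow> real"
  where "dual_volume K n k S = (\<Sum>Ss\<in>flags K n k S.
    (\<Prod>i<n - k. side_sign (Ss ! i) (Ss ! Suc i)) *
    volume (n - k) (convex hull (circumcenter ` set Ss)))"


section \<open>Chains and cochains\<close>

text \<open>
  Generators of the chain spaces: \<open>Simp vs\<close> is the oriented simplex \<open>[v0, \<dots>, vk]\<close> and \<open>Star vs\<close>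
  the formal symbol for its oriented dual cell. A chain is an alternating real function on them,
  so that reordering the vertices by a permutation \<open>p\<close> multiplies a generator by \<open>sign p\<close>.
\<close>

datatype 'a cell = Simp "'a list" | Star "'a list"

text \<open>\<open>Primal k\<close> is the space in degree \<open>k\<close> over \<open>K\<close>, \<open>Dual m\<close> the one in degree \<open>m\<close> over the dual.\<close>

datatype side_degree = Primal nat | Dual nat

fun cell_of :: "side_degree \<Rightarrow> 'a list \<Rightarrow> 'a cell" where
  "cell_of (Primal k) = Simp"
| "cell_of (Dual m) = Star"

text \<open>Cells of \<open>Dual m\<close> come from the simplices of dimension \<open>n - m\<close>; there are none if \<open>m > n\<close>.\<close>

fun base_simplices :: "'a::euclidean_space set set \<Rightarrow> nat \<Rightarrow> side_degree \<Rightarrow> 'a set set" where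
  "base_simplices K n (Primal k) = {S \<in> K. int k simplex S}"
| "base_simplices K n (Dual m) = {S \<in> K. \<exists>k. k + m = n \<and> int k simplex S}"

definition chains :: "'a::euclidean_space set set \<Rightarrow> nat \<Rightarrow> side_degree \<Rightarrow> ('a cell \<Rightarrow> real) set"
  where "chains K n sd = {x.
    (\<forall>c. x c \<noteq> 0 \<longrightarrow> (\<exists>S\<in>base_simplices K n sd. \<exists>vs\<in>orderings S. c = cell_of sd vs)) \<and>
    (\<forall>S\<in>base_simplices K n sd. \<forall>vs\<in>orderings S. \<forall>p. p permutes {..<length vs} \<longrightarrow>
       x (cell_of sd (permute_list p vs)) = of_int (sign p) * x (cell_of sd vs))}"

text \<open>The oriented cell \<open>C vs\<close> as a chain, for \<open>C\<close> one of \<^const>\<open>Simp\<close>, \<^const>\<open>Star\<close>.\<close>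

definition elem_chain :: "('a list \<Rightarrow> 'a cell) \<Rightarrow> 'a list \<Rightarrow> 'a cell \<Rightarrow> real"
  where "elem_chain C vs =
    (\<lambda>c. \<Sum>p | p permutes {..<length vs} \<and> c = C (permute_list p vs). of_int (sign p))"

text \<open>
  The space \<open>Hom(C, 'f)\<close> of linear functionals on the chain space, extended by 0 to non-chains.
  It is used for \<open>'f = real\<close> and, for complex coefficients, \<open>'f = complex\<close>.
\<close>

definition cochains ::
    "'a::euclidean_space set set \<Rightarrow> nat \<Rightarrow> side_degree \<Rightarrow> (('a cell \<Rightarrow> real) \<Rightarrow> 'f::real_field) set"
  where "cochains K n sd = {\<alpha>.
    (\<forall>x\<in>chains K n sd. \<forall>y\<in>chains K n sd. \<alpha> (x + y) = \<alpha> x + \<alpha> y) \<and>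
    (\<forall>r. \<forall>x\<in>chains K n sd. \<alpha> (pscale r x) = r *\<^sub>R \<alpha> x) \<and>
    (\<forall>x. x \<notin> chains K n sd \<longrightarrow> \<alpha> x = 0)}"

text \<open>
  The cochain with value \<open>f vs\<close> on the oriented cell of \<open>vs\<close>: the chain space has the cells of the
  chosen orderings \<open>ori S\<close> as a basis. The functions \<open>f\<close> used below are alternating, so the result
  does not depend on \<open>ori\<close> and has value \<open>f vs\<close> for every ordering \<open>vs\<close>.
\<close>

definition cochain_of ::
    "'a::euclidean_space set set \<Rightarrow> nat \<Rightarrow> ('a set \<Rightarrow> 'a list) \<Rightarrow> side_degree \<Rightarrow>
     ('a list \<Rightarrow> 'f::real_field) \<Rightarrow> ('a cell \<Rightarrow> real) \<Rightarrow> 'f"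
  where "cochain_of K n ori sd f = (\<lambda>x.
    if x \<in> chains K n sd
    then \<Sum>S\<in>base_simplices K n sd. x (cell_of sd (ori S)) *\<^sub>R f (ori S)
    else 0)"


section \<open>The operators of discrete exterior calculus\<close>

definition bdry :: "'a list \<Rightarrow> 'a cell \<Rightarrow> real"
  where "bdry vs =
    (\<Sum>i<length vs. pscale ((- 1) ^ i) (elem_chain Simp (take i vs @ drop (Suc i) vs)))"

text \<open>\<open>incidence vs ws\<close> is the coefficient \<open>[\<sigma>:\<eta>]\<close> for \<open>\<sigma>\<close>, \<open>\<eta>\<close> oriented by \<open>vs\<close>, \<open>ws\<close>.\<close>

definition incidence :: "'a list \<Rightarrow> 'a list \<Rightarrow> real"
  where "incidence vs ws = bdry vs (Simp ws)"

text \<open>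
  Boundary of the dual cell of the \<open>(k - 1)\<close>-simplex \<open>\<eta>\<close> oriented by \<open>ws\<close>, so \<open>k = length ws\<close>. The
  summand does not change with the orientation of \<open>\<sigma>\<close>.
\<close>

definition dual_bdry ::
    "'a::euclidean_space set set \<Rightarrow> ('a set \<Rightarrow> 'a list) \<Rightarrow> (nat \<Rightarrow> real) \<Rightarrow> 'a list \<Rightarrow> 'a cell \<Rightarrow> real"
  where "dual_bdry K ori eps ws = pscale (eps (length ws))
    (\<Sum>S\<in>{S \<in> K. int (length ws) simplex S \<and> convex hull (set ws) \<subseteq> S}.
       pscale (incidence (ori S) ws) (elem_chain Star (ori S)))"

definition ext_deriv ::
    "'a::euclidean_space set set \<Rightarrow> nat \<Rightarrow> ('a set \<Rightarrow> 'a list) \<Rightarrow> nat \<Rightarrow>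
     (('a cell \<Rightarrow> real) \<Rightarrow> 'f::real_field) \<Rightarrow> ('a cell \<Rightarrow> real) \<Rightarrow> 'f"
  where "ext_deriv K n ori k \<alpha> = cochain_of K n ori (Primal (Suc k)) (\<lambda>vs. \<alpha> (bdry vs))"

definition dual_deriv ::
    "'a::euclidean_space set set \<Rightarrow> nat \<Rightarrow> ('a set \<Rightarrow> 'a list) \<Rightarrow> (nat \<Rightarrow> real) \<Rightarrow> nat \<Rightarrow>
     (('a cell \<Rightarrow> real) \<Rightarrow> 'f::real_field) \<Rightarrow> ('a cell \<Rightarrow> real) \<Rightarrow> 'f"
  where "dual_deriv K n ori eps m \<beta> =
    cochain_of K n ori (Dual (Suc m)) (\<lambda>ws. \<beta> (dual_bdry K ori eps ws))"

definition hodge ::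
    "'a::euclidean_space set set \<Rightarrow> nat \<Rightarrow> ('a set \<Rightarrow> 'a list) \<Rightarrow> nat \<Rightarrow>
     (('a cell \<Rightarrow> real) \<Rightarrow> 'f::real_field) \<Rightarrow> ('a cell \<Rightarrow> real) \<Rightarrow> 'f"
  where "hodge K n ori k \<alpha> = cochain_of K n ori (Dual (n - k)) (\<lambda>vs.
    (dual_volume K n k (convex hull (set vs)) / volume k (convex hull (set vs))) *\<^sub>R
    \<alpha> (elem_chain Simp vs))"

text \<open>
  Operators between cochain spaces expressible by compositions and linear combinations of the
  derivatives, the Hodge stars in the degrees \<open>J\<close> and their inverses. The scalars are in \<open>'f\<close>. A HOL
  function represents an operator through its values on the domain only, hence the last rule.
\<close>

inductive dec_operator ::
    "'a::euclidean_space set set \<Rightarrow> nat \<Rightarrow> ('a set \<Rightarrow> 'a list) \<Rightarrow> (nat \<Rightarrow> real) \<Rightarrow> nat set \<Rightarrow>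
     side_degree \<Rightarrow> side_degree \<Rightarrow>
     ((('a cell \<Rightarrow> real) \<Rightarrow> 'f::real_field) \<Rightarrow> ('a cell \<Rightarrow> real) \<Rightarrow> 'f) \<Rightarrow> bool"
  for K :: "'a set set" and n :: nat and ori :: "'a set \<Rightarrow> 'a list" and eps :: "nat \<Rightarrow> real"
    and J :: "nat set"
  where
    primal_d: "dec_operator K n ori eps J (Primal k) (Primal (Suc k)) (ext_deriv K n ori k)"
  | dual_d: "dec_operator K n ori eps J (Dual m) (Dual (Suc m)) (dual_deriv K n ori eps m)"
  | star: "j \<in> J \<Longrightarrow> j \<le> n \<Longrightarrow>
      dec_operator K n ori eps J (Primal j) (Dual (n - j)) (hodge K n ori j)"
  | star_inverse: "j \<in> J \<Longrightarrow> j \<le> n \<Longrightarrow>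
      dec_operator K n ori eps J (Dual (n - j)) (Primal j)
        (inv_into (cochains K n (Primal j)) (hodge K n ori j))"
  | comp: "dec_operator K n ori eps J s t P \<Longrightarrow> dec_operator K n ori eps J t u Q \<Longrightarrow>
      dec_operator K n ori eps J s u (Q \<circ> P)"
  | add: "dec_operator K n ori eps J s t P \<Longrightarrow> dec_operator K n ori eps J s t Q \<Longrightarrow>
      dec_operator K n ori eps J s t (\<lambda>\<alpha>. P \<alpha> + Q \<alpha>)"
  | scale: "dec_operator K n ori eps J s t P \<Longrightarrow>
      dec_operator K n ori eps J s t (\<lambda>\<alpha>. pscale z (P \<alpha>))"
  | same_values: "dec_operator K n ori eps J s t P \<Longrightarrow> (\<forall>\<alpha>\<in>cochains K n s. Q \<alpha> = P \<alpha>) \<Longrightarrow>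
      dec_operator K n ori eps J s t Q"


section \<open>The group action\<close>

text \<open>
  An isometry is affine, so mapping simplices of \<open>K\<close> to simplices of \<open>K\<close> bijectively makes it a
  simplicial isomorphism.
\<close>

definition simplicial_isometry_action ::
    "('g, 'm) monoid_scheme \<Rightarrow> 'a::euclidean_space set set \<Rightarrow> ('g \<Rightarrow> 'a \<Rightarrow> 'a) \<Rightarrow> bool"
  where "simplicial_isometry_action G K act \<longleftrightarrow>
    group_action G UNIV act \<and>
    (\<forall>g\<in>carrier G. (\<forall>x y. dist (act g x) (act g y) = dist x y) \<and>
                   bij_betw (\<lambda>S. act g ` S) K K)"

definition cochain_rep ::
    "('g, 'm) monoid_scheme \<Rightarrow> 'a::euclidean_space set set \<Rightarrow> nat \<Rightarrow> ('a set \<Rightarrow> 'a list) \<Rightarrow>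
     ('g \<Rightarrow> 'a \<Rightarrow> 'a) \<Rightarrow> side_degree \<Rightarrow> 'g \<Rightarrow>
     (('a cell \<Rightarrow> real) \<Rightarrow> 'f::real_field) \<Rightarrow> ('a cell \<Rightarrow> real) \<Rightarrow> 'f"
  where "cochain_rep G K n ori act sd g \<alpha> = cochain_of K n ori sd
    (\<lambda>vs. \<alpha> (elem_chain (cell_of sd) (map (act (inv\<^bsub>G\<^esub> g)) vs)))"


section \<open>Representations of a finite group over the complex numbers\<close>

text \<open>
  Irreducible representations are taken in matrix form; matrix and vector indices start at 0.
\<close>

definition matrix_rep :: "('g, 'm) monoid_scheme \<Rightarrow> nat \<Rightarrow> ('g \<Rightarrow> complex mat) \<Rightarrow> bool"
  where "matrix_rep G d \<phi> \<longleftrightarrow>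
    (\<forall>g\<in>carrier G. \<phi> g \<in> carrier_mat d d) \<and> \<phi> \<one>\<^bsub>G\<^esub> = 1\<^sub>m d \<and>
    (\<forall>g\<in>carrier G. \<forall>h\<in>carrier G. \<phi> (g \<otimes>\<^bsub>G\<^esub> h) = \<phi> g * \<phi> h)"

definition irreducible_rep :: "('g, 'm) monoid_scheme \<Rightarrow> nat \<Rightarrow> ('g \<Rightarrow> complex mat) \<Rightarrow> bool"
  where "irreducible_rep G d \<phi> \<longleftrightarrow> matrix_rep G d \<phi> \<and> d > 0 \<and>
    (\<forall>W\<subseteq>carrier_vec d.
       0\<^sub>v d \<in> W \<and> (\<forall>x\<in>W. \<forall>y\<in>W. x + y \<in> W) \<and> (\<forall>z. \<forall>x\<in>W. z \<cdot>\<^sub>v x \<in> W) \<and>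
       (\<forall>g\<in>carrier G. \<forall>x\<in>W. \<phi> g *\<^sub>v x \<in> W)
       \<longrightarrow> W = {0\<^sub>v d} \<or> W = carrier_vec d)"

definition equivalent_reps ::
    "('g, 'm) monoid_scheme \<Rightarrow> nat \<Rightarrow> ('g \<Rightarrow> complex mat) \<Rightarrow> nat \<Rightarrow> ('g \<Rightarrow> complex mat) \<Rightarrow> bool"
  where "equivalent_reps G d \<phi> e \<psi> \<longleftrightarrow> d = e \<and>
    (\<exists>T\<in>carrier_mat d d. invertible_mat T \<and> (\<forall>g\<in>carrier G. T * \<phi> g = \<psi> g * T))"

definition distinct_irreducibles ::
    "('g, 'm) monoid_scheme \<Rightarrow> nat \<Rightarrow> (nat \<Rightarrow> nat) \<Rightarrow> (nat \<Rightarrow> 'g \<Rightarrow> complex mat) \<Rightarrow> bool"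
  where "distinct_irreducibles G r deg \<phi> \<longleftrightarrow>
    (\<forall>i<r. irreducible_rep G (deg i) (\<phi> i)) \<and>
    (\<forall>i<r. \<forall>j<r. i \<noteq> j \<longrightarrow> \<not> equivalent_reps G (deg i) (\<phi> i) (deg j) (\<phi> j)) \<and>
    (\<forall>d \<psi>. irreducible_rep G d \<psi> \<longrightarrow> (\<exists>i<r. equivalent_reps G (deg i) (\<phi> i) d \<psi>))"

definition character :: "nat \<Rightarrow> ('g \<Rightarrow> complex mat) \<Rightarrow> 'g \<Rightarrow> complex"
  where "character d \<phi> g = (\<Sum>p<d. \<phi> g $$ (p, p))"

text \<open>
  In the sequel a representation \<open>\<rho>\<close> acts on a subspace \<open>W\<close> of a space of complex-valued functions.
  For coefficient functions \<open>f\<close> on the group, \<open>weighted_sum G d f \<rho>\<close> is the operator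
  \<open>d/|G| \<Sum>\<^sub>g f(g\<^sup>-\<^sup>1) \<rho>(g)\<close>.
\<close>

definition weighted_sum ::
    "('g, 'm) monoid_scheme \<Rightarrow> nat \<Rightarrow> ('g \<Rightarrow> complex) \<Rightarrow>
     ('g \<Rightarrow> ('x \<Rightarrow> complex) \<Rightarrow> 'x \<Rightarrow> complex) \<Rightarrow> ('x \<Rightarrow> complex) \<Rightarrow> 'x \<Rightarrow> complex"
  where "weighted_sum G d f \<rho> v =
    pscale (of_nat d / of_nat (order G)) (\<Sum>g\<in>carrier G. pscale (f (inv\<^bsub>G\<^esub> g)) (\<rho> g v))"

definition isotypic_projection ::
    "('g, 'm) monoid_scheme \<Rightarrow> nat \<Rightarrow> ('g \<Rightarrow> complex mat) \<Rightarrow>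
     ('g \<Rightarrow> ('x \<Rightarrow> complex) \<Rightarrow> 'x \<Rightarrow> complex) \<Rightarrow> ('x \<Rightarrow> complex) \<Rightarrow> 'x \<Rightarrow> complex"
  where "isotypic_projection G d \<phi> \<rho> = weighted_sum G d (character d \<phi>) \<rho>"

definition transfer_operator ::
    "('g, 'm) monoid_scheme \<Rightarrow> nat \<Rightarrow> ('g \<Rightarrow> complex mat) \<Rightarrow> nat \<Rightarrow> nat \<Rightarrow>
     ('g \<Rightarrow> ('x \<Rightarrow> complex) \<Rightarrow> 'x \<Rightarrow> complex) \<Rightarrow> ('x \<Rightarrow> complex) \<Rightarrow> 'x \<Rightarrow> complex"
  where "transfer_operator G d \<phi> p q \<rho> = weighted_sum G d (\<lambda>g. \<phi> g $$ (p, q)) \<rho>"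

text \<open>\<open>W\<close> is an invariant subspace on which \<open>\<rho>\<close> is equivalent to the matrix representation \<open>\<phi>\<close>.\<close>

definition equivalent_to ::
    "('g, 'm) monoid_scheme \<Rightarrow> ('g \<Rightarrow> ('x \<Rightarrow> complex) \<Rightarrow> 'x \<Rightarrow> complex) \<Rightarrow> ('x \<Rightarrow> complex) set \<Rightarrow>
     nat \<Rightarrow> ('g \<Rightarrow> complex mat) \<Rightarrow> bool"
  where "equivalent_to G \<rho> W d \<phi> \<longleftrightarrow> (\<exists>f. bij_betw f (carrier_vec d) W \<and>
    (\<forall>x\<in>carrier_vec d. \<forall>y\<in>carrier_vec d. f (x + y) = f x + f y) \<and>
    (\<forall>z. \<forall>x\<in>carrier_vec d. f (z \<cdot>\<^sub>v x) = pscale z (f x)) \<and>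
    (\<forall>g\<in>carrier G. \<forall>x\<in>carrier_vec d. f (\<phi> g *\<^sub>v x) = \<rho> g (f x)))"

definition isotypic_component ::
    "('g, 'm) monoid_scheme \<Rightarrow> ('g \<Rightarrow> ('x \<Rightarrow> complex) \<Rightarrow> 'x \<Rightarrow> complex) \<Rightarrow> ('x \<Rightarrow> complex) set \<Rightarrow>
     nat \<Rightarrow> ('g \<Rightarrow> complex mat) \<Rightarrow> ('x \<Rightarrow> complex) set"
  where "isotypic_component G \<rho> W d \<phi> =
    Modules.module.span pscale (\<Union>{U. U \<subseteq> W \<and> equivalent_to G \<rho> U d \<phi>})"

definition direct_sum :: "('x \<Rightarrow> complex) set \<Rightarrow> nat \<Rightarrow> (nat \<Rightarrow> ('x \<Rightarrow> complex) set) \<Rightarrow> bool"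
  where "direct_sum W r V \<longleftrightarrow>
    (\<forall>i<r. Modules.module.subspace pscale (V i) \<and> V i \<subseteq> W) \<and>
    (\<forall>x\<in>W. \<exists>!v. v \<in> Pi\<^sub>E {..<r} V \<and> x = (\<Sum>i<r. v i))"

definition ordered_basis :: "('x \<Rightarrow> complex) set \<Rightarrow> ('x \<Rightarrow> complex) list \<Rightarrow> bool"
  where "ordered_basis W vs \<longleftrightarrow> distinct vs \<and>
    \<not> Modules.module.dependent pscale (set vs) \<and> Modules.module.span pscale (set vs) = W"

definition matrix_of ::
    "('x \<Rightarrow> complex) list \<Rightarrow> ('y \<Rightarrow> complex) list \<Rightarrow> (('x \<Rightarrow> complex) \<Rightarrow> 'y \<Rightarrow> complex) \<Rightarrow> complex mat"
  where "matrix_of vs ws P = Matrix.mat (length ws) (length vs)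
    (\<lambda>(a, b). Modules.module.representation pscale (set ws) (P (vs ! b)) (ws ! a))"

text \<open>
  The part \<open>v\<^sub>1\<^sup>1, \<dots>, v\<^sub>1\<^sup>c, v\<^sub>2\<^sup>1, \<dots>, v\<^sub>d\<^sup>c\<close> of a symmetry-adapted basis that belongs to \<open>\<phi>\<close>, obtained
  from a list \<open>v1\<close> of the first \<open>c\<close> vectors.
\<close>

definition adapted_part ::
    "('g, 'm) monoid_scheme \<Rightarrow> ('g \<Rightarrow> ('x \<Rightarrow> complex) \<Rightarrow> 'x \<Rightarrow> complex) \<Rightarrow> nat \<Rightarrow>
     ('g \<Rightarrow> complex mat) \<Rightarrow> ('x \<Rightarrow> complex) list \<Rightarrow> ('x \<Rightarrow> complex) list"
  where "adapted_part G \<rho> d \<phi> v1 =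
    v1 @ concat (map (\<lambda>m. map (transfer_operator G d \<phi> 0 m \<rho>) v1) [1..<d])"

end

theory Submission
  imports Defs "Jordan_Normal_Form.Char_Poly" "HOL-Computational_Algebra.Fundamental_Theorem_Algebra"
begin

text \<open>
  Part (i) is naturality. A cochain is determined by its values on the oriented cells, and an
  isometry \<open>h\<close> that permutes the simplices acts on cochains by precomposition
  (\<open>cochain_pullback\<close>). This action commutes with each generator. The primal derivative is defined
  from the faces of a simplex, which \<open>h\<close> maps to faces; since the orientations \<open>ori\<close> are not chosen
  invariantly under \<open>h\<close>, one also needs that the boundary is alternating in the vertices
  (\<open>bdry_permute\<close>). The dual derivative sums over the cofaces of a simplex, which \<open>h\<close> permutes,
  with incidence numbers that depend on the vertex orderings only up to the same signs as the
  dual cells. The Hodge star is multiplication by a ratio of volumes: \<open>h\<close> maps circumcenters to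
  circumcenters, hence flags and their signs to flags and signs, so the ratio is the same at \<open>\<sigma>\<close>
  and \<open>h \<sigma>\<close>. Linearity and commutation with \<open>h\<close> pass to compositions, linear combinations and
  inverses (\<open>dec_operator_equivariant\<close>). Invertibility of the Hodge stars is given over the reals;
  it holds over the complex numbers because the star acts separately on real and imaginary parts.

  Parts (ii) and (iii) concern a finite group acting on a subspace \<open>W\<close> of a space of functions. They
  rest on one computation: Schur orthogonality of matrix entries gives the multiplication table
  \<open>P\<^sup>i\<^sub>p\<^sub>q P\<^sup>j\<^sub>a\<^sub>b = \<delta>\<^sub>i\<^sub>j \<delta>\<^sub>p\<^sub>b P\<^sup>i\<^sub>a\<^sub>q\<close> of the transfer operators (\<open>T_T\<close>). Hence the isotypic
  projections, which are the sums of the \<open>P\<^sup>i\<^sub>p\<^sub>p\<close>, are orthogonal idempotents. They add up to the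
  identity (\<open>sum_E\<close>): the vectors killed by all transfer operators form an invariant subspace; if
  it contained a nonzero vector, the span of the orbit of that vector would contain an irreducible
  subspace, equivalent to some \<open>\<phi> i\<close>, on which the \<open>i\<close>-th projection is the identity and not zero.
  The image of the \<open>i\<close>-th projection is the isotypic component because \<open>v \<mapsto> (P\<^sup>i\<^sub>p\<^sub>t v)\<^sub>t\<close> produces
  copies of \<open>\<phi> i\<close> (\<open>T_copy\<close>) and the projection fixes every copy (\<open>E_fixes_copy\<close>).

  By the same table, the \<open>P\<^sup>i\<^sub>p\<^sub>p\<close> split the \<open>i\<close>-th component into summands that \<open>P\<^sup>i\<^sub>0\<^sub>m\<close> maps
  isomorphically onto each other, so a symmetry-adapted basis is a concatenation of bases of direct
  summands (\<open>ordered_basis_concat\<close>). An equivariant operator commutes with the projections, so it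
  maps the \<open>i\<close>-th component to the \<open>i\<close>-th component, and its matrix is block-diagonal.
\<close>

section \<open>Linear maps and bases in function spaces\<close>

interpretation fs: vector_space "pscale :: 'f::field \<Rightarrow> ('x \<Rightarrow> 'f) \<Rightarrow> 'x \<Rightarrow> 'f"
  by unfold_locales (auto simp: pscale_def fun_eq_iff algebra_simps)

text \<open>
  Linearity on a subspace of the type only: the operators considered here, and their inverses, are
  specified by their values on spaces of cochains.
\<close>

definition linear_on :: "('x \<Rightarrow> 'f::field) set \<Rightarrow> (('x \<Rightarrow> 'f) \<Rightarrow> 'y \<Rightarrow> 'f) \<Rightarrow> bool"
  where "linear_on W f \<longleftrightarrow> (\<forall>x\<in>W. \<forall>y\<in>W. f (x + y) = f x + f y) \<and>
    (\<forall>z. \<forall>x\<in>W. f (pscale z x) = pscale z (f x))"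

lemma pscale_0 [simp]: "pscale (0::'f::field) f = 0"
  by (simp add: pscale_def fun_eq_iff)

lemma linear_on_0:
  assumes "linear_on W f" "fs.subspace W" shows "f 0 = 0"
proof -
  have "0 \<in> W" using assms(2) by (rule fs.subspace_0)
  then have "f (pscale 0 0) = pscale 0 (f 0)" using assms(1) unfolding linear_on_def by blast
  then show ?thesis by simp
qed

lemma linear_on_sum_scale:
  assumes f: "linear_on W f" and W: "fs.subspace W" and v: "\<And>i. i \<in> I \<Longrightarrow> v i \<in> W"
  shows "f (\<Sum>i\<in>I. pscale (c i) (v i)) = (\<Sum>i\<in>I. pscale (c i) (f (v i)))"
proof (cases "finite I")
  case True
  then show ?thesis using v
  proof (induction I)
    case empty
    then show ?case using linear_on_0[OF f W] by (simp only: sum.empty)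
  next
    case (insert i I)
    have "(\<Sum>i\<in>I. pscale (c i) (v i)) \<in> W"
      by (rule fs.subspace_sum[OF W]) (use insert W in \<open>auto intro: fs.subspace_scale\<close>)
    moreover have "v i \<in> W" "pscale (c i) (v i) \<in> W"
      using insert.prems W by (auto intro: fs.subspace_scale)
    ultimately have "f (pscale (c i) (v i) + (\<Sum>i\<in>I. pscale (c i) (v i))) =
        pscale (c i) (f (v i)) + f (\<Sum>i\<in>I. pscale (c i) (v i))"
      using f unfolding linear_on_def by metis
    then show ?case using insert by (simp only: sum.insert insert_iff simp_thms)
  qed
next
  case False
  then show ?thesis using linear_on_0[OF f W] by simp
qed

lemma linear_on_sum:
  assumes f: "linear_on W f" and W: "fs.subspace W" and v: "\<And>i. i \<in> I \<Longrightarrow> v i \<in> W"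
  shows "f (\<Sum>i\<in>I. v i) = (\<Sum>i\<in>I. f (v i))"
  using linear_on_sum_scale[OF assms, where c = "\<lambda>_. 1"] by simp

lemma linear_on_diff:
  assumes f: "linear_on W f" and W: "fs.subspace W" and "x \<in> W" "y \<in> W"
  shows "f (x - y) = f x - f y"
proof -
  have "f (x + pscale (-1) y) = f x + pscale (-1) (f y)"
    using assms fs.subspace_scale[OF W] unfolding linear_on_def by metis
  then show ?thesis by simp
qed

lemma linear_on_subset: "linear_on W f \<Longrightarrow> V \<subseteq> W \<Longrightarrow> linear_on V f"
  unfolding linear_on_def by blast

lemma linear_on_compose:
  "linear_on W f \<Longrightarrow> linear_on V g \<Longrightarrow> f ` W \<subseteq> V \<Longrightarrow> linear_on W (\<lambda>x. g (f x))"
  unfolding linear_on_def image_subset_iff by simp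

lemma subspace_linear_image:
  assumes f: "linear_on W f" and W: "fs.subspace W"
  shows "fs.subspace (f ` W)"
proof (rule fs.subspaceI)
  show "0 \<in> f ` W"
    using linear_on_0[OF f W] fs.subspace_0[OF W] by (metis image_eqI)
  show "x + y \<in> f ` W" if "x \<in> f ` W" "y \<in> f ` W" for x y
    using that f fs.subspace_add[OF W] unfolding linear_on_def by (smt (verit) image_iff)
  show "pscale c x \<in> f ` W" if "x \<in> f ` W" for c x
    using that f fs.subspace_scale[OF W] unfolding linear_on_def by (smt (verit) image_iff)
qed

lemma independent_finite_iff:
  fixes B :: "('x \<Rightarrow> 'f::field) set"
  assumes "finite B"
  shows "fs.independent B \<longleftrightarrow>
    (\<forall>u. (\<Sum>v\<in>B. pscale (u v) v) = 0 \<longrightarrow> (\<forall>v\<in>B. u v = 0))"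
  using fs.dependent_finite[OF assms] by blast

lemma ordered_basis_subspace: "ordered_basis W vs \<Longrightarrow> fs.subspace W"
  unfolding ordered_basis_def using fs.subspace_span by blast

lemma ordered_basis_subset: "ordered_basis W vs \<Longrightarrow> set vs \<subseteq> W"
  unfolding ordered_basis_def using fs.span_superset[of "set vs"] by simp

lemma ordered_basis_map:
  assumes vs: "ordered_basis W vs" and f: "linear_on W f" and inj: "inj_on f W"
  shows "ordered_basis (f ` W) (map f vs)"
proof -
  have W: "fs.subspace W" and sub: "set vs \<subseteq> W"
    and ind: "fs.independent (set vs)" and span: "fs.span (set vs) = W"
    using ordered_basis_subspace[OF vs] ordered_basis_subset[OF vs] vs by (simp_all add: ordered_basis_def)
  have injvs: "inj_on f (set vs)" using inj sub by (rule inj_on_subset)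
  have "fs.independent (f ` set vs)"
    unfolding independent_finite_iff[OF finite_imageI[OF finite_set]]
  proof (intro allI impI ballI)
    fix u v assume u: "(\<Sum>v\<in>f ` set vs. pscale (u v) v) = 0" and v: "v \<in> f ` set vs"
    have "f (\<Sum>v\<in>set vs. pscale (u (f v)) v) = (\<Sum>v\<in>set vs. pscale (u (f v)) (f v))"
      using sub by (intro linear_on_sum_scale[OF f W]) auto
    also have "\<dots> = f 0" using u linear_on_0[OF f W] by (simp add: sum.reindex[OF injvs])
    finally have "(\<Sum>v\<in>set vs. pscale (u (f v)) v) = 0"
      using sub W by (intro inj_onD[OF inj])
        (auto intro!: fs.subspace_sum fs.subspace_scale fs.subspace_0)
    then have "\<forall>w\<in>set vs. u (f w) = 0"
      by (rule ind[unfolded independent_finite_iff[OF finite_set], rule_format, of "\<lambda>v. u (f v)", THEN ballI])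
    then show "u v = 0" using v by blast
  qed
  moreover have "fs.span (f ` set vs) = f ` W"
  proof
    show "fs.span (f ` set vs) \<subseteq> f ` W"
      using sub by (intro fs.span_minimal subspace_linear_image[OF f W]) auto
    show "f ` W \<subseteq> fs.span (f ` set vs)"
    proof clarify
      fix x assume "x \<in> W"
      then obtain u where x: "x = (\<Sum>v\<in>set vs. pscale (u v) v)"
        unfolding span[symmetric] fs.span_finite[OF finite_set] by (rule rangeE)
      have "f x = (\<Sum>v\<in>set vs. pscale (u v) (f v))"
        unfolding x using sub by (intro linear_on_sum_scale[OF f W]) auto
      then show "f x \<in> fs.span (f ` set vs)"
        by (simp only:) (intro fs.span_sum fs.span_scale fs.span_base imageI)
    qed
  qed
  ultimately show ?thesis using vs injvs by (auto simp: ordered_basis_def distinct_map)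
qed

text \<open>
  The operators \<open>E j\<close> are the projections of a direct sum decomposition of \<open>W\<close>. Applying \<open>E i\<close> to a
  vanishing linear combination of all the basis vectors leaves the part that belongs to the
  \<open>i\<close>-th summand.
\<close>

lemma ordered_basis_concat:
  fixes E :: "nat \<Rightarrow> ('x \<Rightarrow> complex) \<Rightarrow> 'x \<Rightarrow> complex"
  assumes W: "fs.subspace W"
    and lin: "\<And>j. j < k \<Longrightarrow> linear_on W (E j)"
    and maps: "\<And>j v. j < k \<Longrightarrow> v \<in> W \<Longrightarrow> E j v \<in> W"
    and orth: "\<And>j l v. j < k \<Longrightarrow> l < k \<Longrightarrow> v \<in> W \<Longrightarrow> E j (E l v) = (if j = l then E l v else 0)"
    and total: "\<And>v. v \<in> W \<Longrightarrow> (\<Sum>j<k. E j v) = v"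
    and basis: "\<And>j. j < k \<Longrightarrow> ordered_basis (E j ` W) (bs j)"
  shows "ordered_basis W (concat (map bs [0..<k]))"
proof -
  let ?B = "\<lambda>j. set (bs j)"
  have B: "\<And>j. j < k \<Longrightarrow> ?B j \<subseteq> E j ` W" using basis ordered_basis_subset by blast
  have BW: "v \<in> W" if "j < k" "v \<in> ?B j" for j v using B[OF that(1)] maps that by auto
  have EB: "E i v = (if i = j then v else 0)" if "i < k" "j < k" "v \<in> ?B j" for i j v
    using B[OF that(2)] that orth by fastforce
  have n0: "0 \<notin> ?B j" if "j < k" for j
    using basis[OF that] fs.dependent_zero unfolding ordered_basis_def by blast
  have disj: "?B i \<inter> ?B j = {}" if "i < k" "j < k" "i \<noteq> j" for i j
    using EB[of i i] EB[of i j] n0[of j] n0[of i] that by (smt (verit) disjoint_iff)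
  have set: "set (concat (map bs [0..<k])) = (\<Union>j<k. ?B j)" by (auto simp: atLeast0LessThan)
  have dist: "distinct (concat (map bs [0..<m]))" if "m \<le> k" for m
    using that
  proof (induction m)
    case (Suc m)
    have "set (bs m) \<inter> (\<Union>j<m. ?B j) = {}" using disj[of m] Suc.prems by (auto simp: disjoint_iff)
    then show ?case using Suc basis[of m] by (auto simp: ordered_basis_def atLeast0LessThan)
  qed simp
  have "fs.independent (\<Union>j<k. ?B j)"
    unfolding independent_finite_iff[OF finite_UN_I[OF finite_lessThan finite_set]]
  proof (intro allI impI ballI)
    fix u v assume 0: "(\<Sum>v\<in>(\<Union>j<k. ?B j). pscale (u v) v) = 0" and v: "v \<in> (\<Union>j<k. ?B j)"
    from v obtain i where i: "i < k" "v \<in> ?B i" by blast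
    have sumW: "(\<Sum>v\<in>?B j. pscale (u v) v) \<in> W" if "j < k" for j
      using W BW[OF that] by (auto intro!: fs.subspace_sum fs.subspace_scale)
    have "0 = E i (\<Sum>j<k. \<Sum>v\<in>?B j. pscale (u v) v)"
      using 0 disj linear_on_0[OF lin[OF i(1)] W] by (subst (asm) sum.UNION_disjoint) auto
    also have "\<dots> = (\<Sum>j<k. E i (\<Sum>v\<in>?B j. pscale (u v) v))"
      using sumW by (intro linear_on_sum[OF lin[OF i(1)] W]) auto
    also have "\<dots> = (\<Sum>j<k. \<Sum>v\<in>?B j. pscale (u v) (E i v))"
      using BW by (intro sum.cong refl linear_on_sum_scale[OF lin[OF i(1)] W]) auto
    also have "\<dots> = (\<Sum>j<k. if j = i then \<Sum>v\<in>?B i. pscale (u v) v else 0)"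
      using i by (intro sum.cong) (auto simp: EB fs.scale_zero_right)
    also have "\<dots> = (\<Sum>v\<in>?B i. pscale (u v) v)" using i by simp
    finally have "(\<Sum>v\<in>?B i. pscale (u v) v) = 0" by simp
    then show "u v = 0" using basis[OF i(1)] i(2) unfolding ordered_basis_def
      independent_finite_iff[OF finite_set] by blast
  qed
  moreover have "fs.span (\<Union>j<k. ?B j) = W"
  proof
    show "fs.span (\<Union>j<k. ?B j) \<subseteq> W"
      using BW by (intro fs.span_minimal W) auto
    show "W \<subseteq> fs.span (\<Union>j<k. ?B j)"
    proof
      fix x assume x: "x \<in> W"
      have "E j x \<in> fs.span (\<Union>j<k. ?B j)" if "j < k" for j
      proof -
        have "E j x \<in> fs.span (?B j)" using basis[OF that] x unfolding ordered_basis_def by blast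
        then show ?thesis using fs.span_mono[of "?B j" "\<Union>j<k. ?B j"] that by blast
      qed
      then have "(\<Sum>j<k. E j x) \<in> fs.span (\<Union>j<k. ?B j)"
        by (intro fs.span_sum) auto
      then show "x \<in> fs.span (\<Union>j<k. ?B j)" using total[OF x] by simp
    qed
  qed
  ultimately show ?thesis using dist[of k] set by (simp add: ordered_basis_def)
qed

text \<open>
  A matrix whose entries are \<open>F\<close> of the labels of its column and row is block-diagonal when the labels
  are grouped so that \<open>F\<close> vanishes across different groups. Rows are labelled by \<open>yss\<close>, and the
  blocks may be rectangular.
\<close>

lemma mat_concat_diag_block:
  assumes "length xss = length yss"
    and "\<And>i j x y. i < length xss \<Longrightarrow> j < length yss \<Longrightarrow> i \<noteq> j \<Longrightarrow> x \<in> set (xss ! i) \<Longrightarrow>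
      y \<in> set (yss ! j) \<Longrightarrow> F x y = (0::complex)"
  shows "Matrix.mat (length (concat yss)) (length (concat xss))
      (\<lambda>(a, b). F (concat xss ! b) (concat yss ! a)) =
    diag_block_mat (map2 (\<lambda>xs ys. Matrix.mat (length ys) (length xs) (\<lambda>(a, b). F (xs ! b) (ys ! a))) xss yss)"
  using assms
proof (induction xss yss rule: list_induct2)
  case Nil
  then show ?case by (intro eq_matI) simp_all
next
  case (Cons xs xss ys yss)
  have F1: "F x y = 0" if "x \<in> set xs" "y \<in> set (concat yss)" for x y
  proof -
    obtain j where "j < length yss" "y \<in> set (yss ! j)" using \<open>y \<in> set (concat yss)\<close>
      by (metis concat_eq_concat_iff in_set_conv_nth set_concat UN_iff)
    then show ?thesis using Cons.prems[of 0 "Suc j" x y] that by simp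
  qed
  have F2: "F x y = 0" if "y \<in> set ys" "x \<in> set (concat xss)" for x y
  proof -
    obtain j where "j < length xss" "x \<in> set (xss ! j)" using \<open>x \<in> set (concat xss)\<close>
      by (metis in_set_conv_nth set_concat UN_iff)
    then show ?thesis using Cons.prems[of "Suc j" 0 x y] that by simp
  qed
  have IH: "Matrix.mat (length (concat yss)) (length (concat xss))
      (\<lambda>(a, b). F (concat xss ! b) (concat yss ! a)) =
    diag_block_mat (map2 (\<lambda>xs ys. Matrix.mat (length ys) (length xs) (\<lambda>(a, b). F (xs ! b) (ys ! a))) xss yss)"
    by (rule Cons.IH) (use Cons.prems[of "Suc _" "Suc _"] in auto)
  show ?case
    unfolding zip_Cons_Cons list.map prod.case diag_block_mat.simps Let_def IH[symmetric]
    by (rule eq_matI) (auto simp: nth_append F1 F2 simp del: set_concat)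
qed

text \<open>
  Coordinates with respect to the whole basis agree with coordinates with respect to one part
  of it, for vectors in the span of that part.
\<close>

lemma matrix_of_block_diagonal:
  assumes basis: "ordered_basis W (concat (map ws [0..<r]))"
    and P: "\<And>i x. i < r \<Longrightarrow> x \<in> set (vs i) \<Longrightarrow> P x \<in> fs.span (set (ws i))"
  shows "matrix_of (concat (map vs [0..<r])) (concat (map ws [0..<r])) P =
    diag_block_mat (map (\<lambda>i. matrix_of (vs i) (ws i) P) [0..<r])"
proof -
  let ?B = "set (concat (map ws [0..<r]))"
  have ind: "fs.independent ?B" and dist: "distinct (concat (map ws [0..<r]))"
    using basis unfolding ordered_basis_def by auto
  have sub: "set (ws i) \<subseteq> ?B" if "i < r" for i using that by auto
  have rep: "fs.representation ?B (P x) = fs.representation (set (ws i)) (P x)"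
    if "i < r" "x \<in> set (vs i)" for i x
    using fs.representation_extend[OF ind P[OF that] sub[OF that(1)]] .
  have off: "fs.representation ?B (P x) y = 0"
    if "i < r" "j < r" "i \<noteq> j" "x \<in> set (vs i)" "y \<in> set (ws j)" for i j x y
  proof -
    have "set (ws i) \<inter> set (ws j) = {}"
    proof -
      have *: "set (ws a) \<inter> set (ws b) = {}" if "a < b" "b < r" for a b
      proof -
        have "[0..<r] = [0..<b] @ [b..<r]" using that upt_add_eq_append[of 0 b "r - b"] by simp
        then have "distinct (concat (map ws [0..<b]) @ concat (map ws [b..<r]))" using dist by simp
        moreover have "set (ws a) \<subseteq> set (concat (map ws [0..<b]))"
          "set (ws b) \<subseteq> set (concat (map ws [b..<r]))" using that by auto
        ultimately show ?thesis unfolding distinct_append by blast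
      qed
      from that show ?thesis using *[of i j] *[of j i] by (cases "i < j") auto
    qed
    then have "y \<notin> set (ws i)" using that by blast
    then show ?thesis unfolding rep[OF that(1,4)] using fs.representation_ne_zero by blast
  qed
  have "matrix_of (concat (map vs [0..<r])) (concat (map ws [0..<r])) P =
    diag_block_mat (map2 (\<lambda>xs ys. Matrix.mat (length ys) (length xs)
      (\<lambda>(a, b). fs.representation ?B (P (xs ! b)) (ys ! a))) (map vs [0..<r]) (map ws [0..<r]))"
    unfolding matrix_of_def by (rule mat_concat_diag_block) (use off in auto)
  also have "map2 (\<lambda>xs ys. Matrix.mat (length ys) (length xs)
      (\<lambda>(a, b). fs.representation ?B (P (xs ! b)) (ys ! a))) (map vs [0..<r]) (map ws [0..<r]) =
    map (\<lambda>i. matrix_of (vs i) (ws i) P) [0..<r]"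
  proof (rule nth_equalityI, simp, goal_cases)
    case (1 i)
    then have i: "i < r" by simp
    have "Matrix.mat (length (ws i)) (length (vs i))
      (\<lambda>(a, b). fs.representation ?B (P (vs i ! b)) (ws i ! a)) = matrix_of (vs i) (ws i) P"
      unfolding matrix_of_def by (rule eq_matI) (simp_all only: dim_row_mat dim_col_mat index_mat prod.case rep[OF i] nth_mem)
    then show ?case using i by simp
  qed
  finally show ?thesis .
qed

section \<open>Schur's lemma and Schur orthogonality\<close>

lemma matrix_repD:
  assumes "matrix_rep G d \<phi>"
  shows "g \<in> carrier G \<Longrightarrow> \<phi> g \<in> carrier_mat d d" "\<phi> \<one>\<^bsub>G\<^esub> = 1\<^sub>m d"
    "g \<in> carrier G \<Longrightarrow> h \<in> carrier G \<Longrightarrow> \<phi> (g \<otimes>\<^bsub>G\<^esub> h) = \<phi> g * \<phi> h"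
  using assms unfolding matrix_rep_def by auto

lemma irreducible_repD:
  assumes "irreducible_rep G d \<phi>"
  shows "matrix_rep G d \<phi>" "0 < d"
    "\<lbrakk>W \<subseteq> carrier_vec d; 0\<^sub>v d \<in> W; \<And>x y. x \<in> W \<Longrightarrow> y \<in> W \<Longrightarrow> x + y \<in> W;
      \<And>z x. x \<in> W \<Longrightarrow> z \<cdot>\<^sub>v x \<in> W; \<And>g x. g \<in> carrier G \<Longrightarrow> x \<in> W \<Longrightarrow> \<phi> g *\<^sub>v x \<in> W\<rbrakk>
     \<Longrightarrow> W = {0\<^sub>v d} \<or> W = carrier_vec d"
  using assms unfolding irreducible_rep_def by auto

lemma mult_mat_entry:
  assumes "A \<in> carrier_mat n m" "B \<in> carrier_mat m k" "i < n" "j < k"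
  shows "(A * B) $$ (i, j) = (\<Sum>a<m. A $$ (i, a) * B $$ (a, j))"
  using assms by (auto simp: scalar_prod_def atLeast0LessThan)

lemma mult_mat_vec_unit:
  fixes A :: "complex mat"
  assumes "A \<in> carrier_mat n m" "i < n" "j < m"
  shows "vec_index (A *\<^sub>v unit_vec m j) i = A $$ (i, j)"
  using assms by (simp add: scalar_prod_def if_distrib[of "\<lambda>x. _ * x"] cong: if_cong)

text \<open>
  Schur's lemma: kernel and image of an intertwiner are invariant subspaces, so a nonzero one has
  kernel zero and full image. The right inverse is assembled from preimages of the unit vectors.
\<close>

lemma schur_inverse:
  assumes \<phi>: "irreducible_rep G d \<phi>" and \<psi>: "irreducible_rep G e \<psi>"
    and T: "T \<in> carrier_mat d e"
    and comm: "\<And>g. g \<in> carrier G \<Longrightarrow> \<phi> g * T = T * \<psi> g"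
    and nz: "T \<noteq> 0\<^sub>m d e"
  obtains X where "X \<in> carrier_mat e d" "T * X = 1\<^sub>m d" "X * T = 1\<^sub>m e"
proof -
  note \<phi>D = irreducible_repD[OF \<phi>] and \<psi>D = irreducible_repD[OF \<psi>]
  note \<phi>c = matrix_repD(1)[OF \<phi>D(1)] and \<psi>c = matrix_repD(1)[OF \<psi>D(1)]
  have equiv: "T *\<^sub>v (\<psi> g *\<^sub>v x) = \<phi> g *\<^sub>v (T *\<^sub>v x)" if "g \<in> carrier G" "x \<in> carrier_vec e" for g x
    using assoc_mult_mat_vec[OF T \<psi>c that(2)] assoc_mult_mat_vec[OF \<phi>c T that(2)] comm that by metis
  obtain i j where ij: "i < d" "j < e" "T $$ (i, j) \<noteq> 0" using nz T by (metis eq_matI carrier_matD index_zero_mat)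
  have not0: "T *\<^sub>v unit_vec e j \<noteq> 0\<^sub>v d" using mult_mat_vec_unit[OF T ij(1,2)] ij by auto
  let ?N = "{x \<in> carrier_vec e. T *\<^sub>v x = 0\<^sub>v d}"
  have N: "?N = {0\<^sub>v e} \<or> ?N = carrier_vec e"
  proof (rule \<psi>D(3))
    show "?N \<subseteq> carrier_vec e" by blast
    show "0\<^sub>v e \<in> ?N" using T by (auto intro!: eq_vecI)
    show "x + y \<in> ?N" if "x \<in> ?N" "y \<in> ?N" for x y
      using that T by (simp add: mult_add_distrib_mat_vec[OF T])
    show "z \<cdot>\<^sub>v x \<in> ?N" if "x \<in> ?N" for z x
      using that T by (auto simp: mult_mat_vec[OF T] intro!: eq_vecI)
    show "\<psi> g *\<^sub>v x \<in> ?N" if "g \<in> carrier G" "x \<in> ?N" for g x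
      using that \<psi>c[OF that(1)] \<phi>c[OF that(1)] equiv[OF that(1)] by (auto intro!: eq_vecI)
  qed
  have "unit_vec e j \<in> carrier_vec e" "unit_vec e j \<notin> ?N" using not0 by simp_all
  with N have "?N = {0\<^sub>v e}" by metis
  then have ker: "x = 0\<^sub>v e" if "x \<in> carrier_vec e" "T *\<^sub>v x = 0\<^sub>v d" for x
    using that by blast
  let ?I = "(\<lambda>x. T *\<^sub>v x) ` carrier_vec e"
  have "?I = {0\<^sub>v d} \<or> ?I = carrier_vec d"
  proof (rule \<phi>D(3))
    show "?I \<subseteq> carrier_vec d" using T by auto
    show "0\<^sub>v d \<in> ?I" using T by (intro image_eqI[of _ _ "0\<^sub>v e"]) (auto intro!: eq_vecI)
    show "x + y \<in> ?I" if xy: "x \<in> ?I" "y \<in> ?I" for x y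
    proof -
      from xy obtain x' y' where "x' \<in> carrier_vec e" "x = T *\<^sub>v x'" "y' \<in> carrier_vec e" "y = T *\<^sub>v y'" by auto
      then show ?thesis by (intro image_eqI[of _ _ "x' + y'"]) (simp_all add: mult_add_distrib_mat_vec[OF T])
    qed
    show "z \<cdot>\<^sub>v x \<in> ?I" if x: "x \<in> ?I" for z x
    proof -
      from x obtain x' where "x' \<in> carrier_vec e" "x = T *\<^sub>v x'" by auto
      then show ?thesis by (intro image_eqI[of _ _ "z \<cdot>\<^sub>v x'"]) (simp_all add: mult_mat_vec[OF T])
    qed
    show "\<phi> g *\<^sub>v x \<in> ?I" if "g \<in> carrier G" "x \<in> ?I" for g x
    proof -
      from that obtain x' where "x' \<in> carrier_vec e" "x = T *\<^sub>v x'" by auto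
      then show ?thesis using equiv[OF that(1)] \<psi>c[OF that(1)]
        by (intro image_eqI[of _ _ "\<psi> g *\<^sub>v x'"]) simp_all
    qed
  qed
  moreover have "T *\<^sub>v unit_vec e j \<in> ?I" using unit_vec_carrier by (rule imageI)
  ultimately have img: "?I = carrier_vec d" using not0 by (metis singletonD)
  have "\<exists>x. x \<in> carrier_vec e \<and> T *\<^sub>v x = unit_vec d b" for b
    using img unit_vec_carrier[of d b] by (metis imageE)
  then obtain xs where xs: "\<And>b. xs b \<in> carrier_vec e" "\<And>b. T *\<^sub>v xs b = unit_vec d b" by metis
  define X where "X = Matrix.mat e d (\<lambda>(a, b). vec_index (xs b) a)"
  have X: "X \<in> carrier_mat e d" by (simp add: X_def)
  have TX: "T * X = 1\<^sub>m d"
  proof (rule eq_matI)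
    fix a b assume ab: "a < dim_row (1\<^sub>m d)" "b < dim_col (1\<^sub>m d)"
    then have "Matrix.col X b = xs b" using xs(1)[of b] by (intro eq_vecI) (auto simp: X_def)
    then have "(T * X) $$ (a, b) = vec_index (T *\<^sub>v xs b) a" using ab T X by simp
    then show "(T * X) $$ (a, b) = 1\<^sub>m d $$ (a, b)" using ab xs(2) by (auto simp: unit_vec_def)
  qed (use T X in auto)
  have XT: "X * T = 1\<^sub>m e"
  proof (rule eq_matI)
    fix a b assume ab: "a < dim_row (1\<^sub>m e)" "b < dim_col (1\<^sub>m e)"
    let ?u = "unit_vec e b"
    let ?y = "X *\<^sub>v (T *\<^sub>v ?u) - ?u"
    have y: "?y \<in> carrier_vec e" using X T by auto
    have "T *\<^sub>v ?y = T *\<^sub>v (X *\<^sub>v (T *\<^sub>v ?u)) - T *\<^sub>v ?u"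
      by (rule mult_minus_distrib_mat_vec[OF T]) (use X T in auto)
    also have "T *\<^sub>v (X *\<^sub>v (T *\<^sub>v ?u)) = (T * X) *\<^sub>v (T *\<^sub>v ?u)"
      by (rule assoc_mult_mat_vec[OF T X, symmetric]) (use T in auto)
    also have "\<dots> = T *\<^sub>v ?u" unfolding TX by (rule one_mult_mat_vec) (use T in auto)
    finally have "T *\<^sub>v ?y = 0\<^sub>v d" using T by simp
    then have y0: "?y = 0\<^sub>v e" by (rule ker[OF y])
    have "X *\<^sub>v (T *\<^sub>v ?u) = ?u"
    proof (rule eq_vecI)
      fix i assume "i < dim_vec ?u"
      then have "vec_index ?y i = vec_index (X *\<^sub>v (T *\<^sub>v ?u)) i - vec_index ?u i"
        using X by simp
      moreover have "vec_index ?y i = 0" using \<open>i < dim_vec ?u\<close> unfolding y0 by simp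
      ultimately show "vec_index (X *\<^sub>v (T *\<^sub>v ?u)) i = vec_index ?u i" by simp
    qed (use X in auto)
    then have "(X * T) *\<^sub>v ?u = ?u" using assoc_mult_mat_vec[OF X T] by auto
    then have "vec_index ((X * T) *\<^sub>v ?u) a = vec_index ?u a" by simp
    then show "(X * T) $$ (a, b) = 1\<^sub>m e $$ (a, b)"
      using ab X T by (subst (asm) mult_mat_vec_unit[of _ e e]) (auto simp: unit_vec_def)
  qed (use T X in auto)
  show thesis using X TX XT by (rule that)
qed

text \<open>The traces of \<open>A * B\<close> and \<open>B * A\<close> agree.\<close>

lemma two_sided_inverse_square:
  fixes A B :: "complex mat"
  assumes A: "A \<in> carrier_mat d e" and B: "B \<in> carrier_mat e d"
    and AB: "A * B = 1\<^sub>m d" and BA: "B * A = 1\<^sub>m e"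
  shows "d = e"
proof -
  have "of_nat d = (\<Sum>i<d. (A * B) $$ (i, i))" by (simp add: AB)
  also have "\<dots> = (\<Sum>i<d. \<Sum>a<e. A $$ (i, a) * B $$ (a, i))"
    using mult_mat_entry[OF A B] by simp
  also have "\<dots> = (\<Sum>a<e. \<Sum>i<d. B $$ (a, i) * A $$ (i, a))"
    by (subst sum.swap) (simp add: mult.commute)
  also have "\<dots> = (\<Sum>i<e. (B * A) $$ (i, i))" using mult_mat_entry[OF B A] by simp
  also have "\<dots> = (of_nat e :: complex)" by (simp add: BA)
  finally show ?thesis by simp
qed

lemma schur_equivalent:
  assumes \<phi>: "irreducible_rep G d \<phi>" and \<psi>: "irreducible_rep G e \<psi>"
    and T: "T \<in> carrier_mat d e"
    and comm: "\<And>g. g \<in> carrier G \<Longrightarrow> \<phi> g * T = T * \<psi> g"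
    and nz: "T \<noteq> 0\<^sub>m d e"
  shows "equivalent_reps G e \<psi> d \<phi>"
proof -
  obtain X where X: "X \<in> carrier_mat e d" "T * X = 1\<^sub>m d" "X * T = 1\<^sub>m e"
    using schur_inverse[OF assms] by blast
  have [simp]: "e = d" using two_sided_inverse_square[OF T X] by simp
  have "invertible_mat T" using X T unfolding invertible_mat_def inverts_mat_def by auto
  then show ?thesis using T comm unfolding equivalent_reps_def by auto
qed

text \<open>
  Over the complex numbers \<open>T\<close> has an eigenvalue \<open>c\<close>; the intertwiner \<open>T - c\<close> is not invertible, so it
  vanishes.
\<close>

lemma schur_scalar:
  assumes \<phi>: "irreducible_rep G d \<phi>" and T: "T \<in> carrier_mat d d"
    and comm: "\<And>g. g \<in> carrier G \<Longrightarrow> \<phi> g * T = T * \<phi> g"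
  obtains c where "T = c \<cdot>\<^sub>m 1\<^sub>m d"
proof -
  have "degree (char_poly T) \<noteq> 0"
    using degree_monic_char_poly[OF T] irreducible_repD(2)[OF \<phi>] by simp
  then have "\<not> constant (poly (char_poly T))" by (simp add: constant_degree)
  then obtain c where "poly (char_poly T) c = 0" using fundamental_theorem_of_algebra by blast
  then have "eigenvalue T c" using eigenvalue_root_char_poly[OF T] by blast
  then obtain v where v: "v \<in> carrier_vec d" "v \<noteq> 0\<^sub>v d" "T *\<^sub>v v = c \<cdot>\<^sub>v v"
    using T unfolding eigenvalue_def eigenvector_def by auto
  let ?S = "T - c \<cdot>\<^sub>m 1\<^sub>m d"
  have S: "?S \<in> carrier_mat d d" using T by auto
  have "?S = 0\<^sub>m d d"
  proof (rule ccontr)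
    assume nz: "?S \<noteq> 0\<^sub>m d d"
    have "\<phi> g * ?S = ?S * \<phi> g" if g: "g \<in> carrier G" for g
    proof -
      have P: "\<phi> g \<in> carrier_mat d d" using matrix_repD(1)[OF irreducible_repD(1)[OF \<phi>] g] .
      have "\<phi> g * ?S = \<phi> g * T - \<phi> g * (c \<cdot>\<^sub>m 1\<^sub>m d)"
        by (rule mult_minus_distrib_mat[OF P T]) auto
      also have "\<phi> g * (c \<cdot>\<^sub>m 1\<^sub>m d) = (c \<cdot>\<^sub>m 1\<^sub>m d) * \<phi> g"
        unfolding mult_smult_distrib[OF P one_carrier_mat] mult_smult_assoc_mat[OF one_carrier_mat P]
        using P by simp
      finally show ?thesis using comm[OF g] minus_mult_distrib_mat[OF T _ P, of "c \<cdot>\<^sub>m 1\<^sub>m d"] by simp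
    qed
    then obtain X where X: "X \<in> carrier_mat d d" "X * ?S = 1\<^sub>m d"
      using schur_inverse[OF \<phi> \<phi> S _ nz] by blast
    have "?S *\<^sub>v v = T *\<^sub>v v - (c \<cdot>\<^sub>m 1\<^sub>m d) *\<^sub>v v"
      by (rule minus_mult_distrib_mat_vec[OF T _ v(1)]) auto
    also have "(c \<cdot>\<^sub>m 1\<^sub>m d) *\<^sub>v v = c \<cdot>\<^sub>v v"
      using v(1) by (intro eq_vecI) auto
    also have "T *\<^sub>v v - c \<cdot>\<^sub>v v = 0\<^sub>v d" using v by auto
    finally have "X *\<^sub>v (?S *\<^sub>v v) = 0\<^sub>v d" using X by auto
    then show False using X(2) v assoc_mult_mat_vec[OF X(1) S v(1)] by auto
  qed
  have "T = c \<cdot>\<^sub>m 1\<^sub>m d"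
  proof (rule eq_matI)
    fix i j assume ij: "i < dim_row (c \<cdot>\<^sub>m 1\<^sub>m d)" "j < dim_col (c \<cdot>\<^sub>m 1\<^sub>m d)"
    then have "?S $$ (i, j) = 0" using \<open>?S = 0\<^sub>m d d\<close> by simp
    then show "T $$ (i, j) = (c \<cdot>\<^sub>m 1\<^sub>m d) $$ (i, j)" using ij T by simp
  qed (use T in auto)
  then show thesis by (rule that)
qed

text \<open>
  This is \<open>\<Sum>\<^sub>g \<phi>(g\<^sup>-\<^sup>1) e \<psi>(g)\<close> for the matrix unit \<open>e\<close> with a one at \<open>(q, t)\<close>: an intertwiner of \<open>\<phi>\<close> and \<open>\<psi>\<close>
  whose entries are the sums of the orthogonality relations.
\<close>

definition intertwining_average where
  "intertwining_average G \<phi> d \<psi> e q t = Matrix.mat d e (\<lambda>(p, s).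
    \<Sum>g\<in>carrier G. \<phi> (inv\<^bsub>G\<^esub> g) $$ (p, q) * \<psi> g $$ (t, s) :: complex)"

lemma intertwining_average_commutes:
  assumes G: "group G" and \<phi>: "matrix_rep G d \<phi>" and \<psi>: "matrix_rep G e \<psi>"
    and q: "q < d" and t: "t < e" and h: "h \<in> carrier G"
  shows "\<phi> h * intertwining_average G \<phi> d \<psi> e q t = intertwining_average G \<phi> d \<psi> e q t * \<psi> h"
    (is "_ * ?T = _")
proof (rule eq_matI)
  interpret group G by fact
  note \<phi>D = matrix_repD[OF \<phi>] and \<psi>D = matrix_repD[OF \<psi>]
  have T: "?T \<in> carrier_mat d e" by (simp add: intertwining_average_def)
  fix p s assume "p < dim_row (?T * \<psi> h)" "s < dim_col (?T * \<psi> h)"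
  then have p: "p < d" and s: "s < e" using T \<psi>D(1)[OF h] by auto
  have "(\<phi> h * ?T) $$ (p, s) = (\<Sum>a<d. \<phi> h $$ (p, a) * ?T $$ (a, s))"
    by (rule mult_mat_entry[OF \<phi>D(1)[OF h] T p s])
  also have "\<dots> = (\<Sum>a<d. \<Sum>g\<in>carrier G. \<phi> h $$ (p, a) * \<phi> (inv\<^bsub>G\<^esub> g) $$ (a, q) * \<psi> g $$ (t, s))"
    using s by (simp add: intertwining_average_def sum_distrib_left mult.assoc)
  also have "\<dots> = (\<Sum>g\<in>carrier G. (\<Sum>a<d. \<phi> h $$ (p, a) * \<phi> (inv\<^bsub>G\<^esub> g) $$ (a, q)) * \<psi> g $$ (t, s))"
    by (subst sum.swap) (simp add: sum_distrib_right)
  also have "\<dots> = (\<Sum>g\<in>carrier G. \<phi> (h \<otimes>\<^bsub>G\<^esub> inv\<^bsub>G\<^esub> g) $$ (p, q) * \<psi> g $$ (t, s))"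
    by (intro sum.cong refl) (simp add: \<phi>D(3) h mult_mat_entry[OF \<phi>D(1) \<phi>D(1) p q])
  also have "\<dots> = (\<Sum>g\<in>carrier G. \<phi> (inv\<^bsub>G\<^esub> g) $$ (p, q) * \<psi> (g \<otimes>\<^bsub>G\<^esub> h) $$ (t, s))"
  proof (rule sum.reindex_bij_witness[of _ "\<lambda>g. g \<otimes>\<^bsub>G\<^esub> h" "\<lambda>g. g \<otimes>\<^bsub>G\<^esub> inv\<^bsub>G\<^esub> h"])
    fix g assume g: "g \<in> carrier G"
    show "\<phi> (inv\<^bsub>G\<^esub> (g \<otimes>\<^bsub>G\<^esub> inv\<^bsub>G\<^esub> h)) $$ (p, q) * \<psi> (g \<otimes>\<^bsub>G\<^esub> inv\<^bsub>G\<^esub> h \<otimes>\<^bsub>G\<^esub> h) $$ (t, s) =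
      \<phi> (h \<otimes>\<^bsub>G\<^esub> inv\<^bsub>G\<^esub> g) $$ (p, q) * \<psi> g $$ (t, s)"
      using g h by (simp add: inv_mult_group m_assoc)
  qed (use h in \<open>auto simp: m_assoc\<close>)
  also have "\<dots> = (\<Sum>g\<in>carrier G. \<phi> (inv\<^bsub>G\<^esub> g) $$ (p, q) * (\<Sum>b<e. \<psi> g $$ (t, b) * \<psi> h $$ (b, s)))"
    by (intro sum.cong refl) (simp add: \<psi>D(3) h mult_mat_entry[OF \<psi>D(1) \<psi>D(1) t s])
  also have "\<dots> = (\<Sum>b<e. ?T $$ (p, b) * \<psi> h $$ (b, s))"
    using p by (subst sum_distrib_left, subst sum.swap)
      (simp add: intertwining_average_def sum_distrib_right mult.assoc)
  also have "\<dots> = (?T * \<psi> h) $$ (p, s)"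
    by (rule mult_mat_entry[OF T \<psi>D(1)[OF h] p s, symmetric])
  finally show "(\<phi> h * ?T) $$ (p, s) = (?T * \<psi> h) $$ (p, s)" .
qed (use matrix_repD(1)[OF \<phi> h] matrix_repD(1)[OF \<psi> h] in \<open>auto simp: intertwining_average_def\<close>)

lemma schur_orthogonality_inequivalent:
  assumes G: "group G" and \<phi>: "irreducible_rep G d \<phi>" and \<psi>: "irreducible_rep G e \<psi>"
    and "\<not> equivalent_reps G e \<psi> d \<phi>" and "p < d" "q < d" "t < e" "s < e"
  shows "(\<Sum>g\<in>carrier G. \<phi> (inv\<^bsub>G\<^esub> g) $$ (p, q) * \<psi> g $$ (t, s)) = 0"
proof -
  let ?T = "intertwining_average G \<phi> d \<psi> e q t"
  have "?T = 0\<^sub>m d e"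
    using schur_equivalent[OF \<phi> \<psi>, of ?T] assms(4)
      intertwining_average_commutes[OF G irreducible_repD(1)[OF \<phi>] irreducible_repD(1)[OF \<psi>] assms(6,7)]
    by (auto simp: intertwining_average_def)
  then have "?T $$ (p, s) = 0" using assms by simp
  then show ?thesis using assms by (simp add: intertwining_average_def)
qed

text \<open>
  The intertwiner is a scalar matrix, and the scalar is found from its trace, in which
  \<open>\<phi>(g\<^sup>-\<^sup>1)\<close> and \<open>\<phi>(g)\<close> cancel.
\<close>

lemma schur_orthogonality:
  assumes G: "group G" and fin: "finite (carrier G)" and \<phi>: "irreducible_rep G d \<phi>"
    and p: "p < d" and q: "q < d" and t: "t < d" and s: "s < d"
  shows "(\<Sum>g\<in>carrier G. \<phi> (inv\<^bsub>G\<^esub> g) $$ (p, q) * \<phi> g $$ (t, s)) =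
    (if p = s \<and> q = t then of_nat (order G) / of_nat d else 0)"
proof -
  interpret group G by fact
  note rep = irreducible_repD(1)[OF \<phi>]
  note \<phi>D = matrix_repD[OF rep]
  let ?T = "intertwining_average G \<phi> d \<phi> d q t"
  obtain c where c: "?T = c \<cdot>\<^sub>m 1\<^sub>m d"
    using schur_scalar[OF \<phi>, of ?T] intertwining_average_commutes[OF G rep rep q t]
    by (auto simp: intertwining_average_def)
  have "of_nat d * c = (\<Sum>p<d. ?T $$ (p, p))" by (simp add: c)
  also have "\<dots> = (\<Sum>p<d. \<Sum>g\<in>carrier G. \<phi> (inv\<^bsub>G\<^esub> g) $$ (p, q) * \<phi> g $$ (t, p))"
    by (simp add: intertwining_average_def)
  also have "\<dots> = (\<Sum>g\<in>carrier G. \<phi> (g \<otimes>\<^bsub>G\<^esub> inv\<^bsub>G\<^esub> g) $$ (t, q))"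
    by (subst sum.swap) (intro sum.cong refl, simp only: \<phi>D(3) inv_closed mult_mat_entry[OF \<phi>D(1) \<phi>D(1) t q] mult.commute)
  also have "\<dots> = (if q = t then of_nat (order G) else 0)"
    using t q by (simp add: \<phi>D(2) order_def)
  finally have "c = (if q = t then of_nat (order G) / of_nat d else 0)"
    using irreducible_repD(2)[OF \<phi>] by (auto simp: field_simps split: if_splits)
  moreover have "?T $$ (p, s) = (if p = s then c else 0)" using p s by (simp add: c)
  ultimately show ?thesis using p s by (simp add: intertwining_average_def)
qed

section \<open>Finite group representations on function spaces\<close>

lemma mat_eq_of_mult_vec:
  fixes A B :: "complex mat"
  assumes A: "A \<in> carrier_mat n m" and B: "B \<in> carrier_mat n m"
    and eq: "\<And>x. x \<in> carrier_vec m \<Longrightarrow> A *\<^sub>v x = B *\<^sub>v x"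
  shows "A = B"
proof (rule eq_matI)
  fix i j assume "i < dim_row B" "j < dim_col B"
  then have ij: "i < n" "j < m" using B by auto
  show "A $$ (i, j) = B $$ (i, j)"
    using mult_mat_vec_unit[OF A ij] mult_mat_vec_unit[OF B ij] eq[OF unit_vec_carrier] by metis
qed (use A B in auto)

locale finite_group_rep = group G for G (structure) +
  fixes W :: "('x \<Rightarrow> complex) set" and \<rho> :: "'g \<Rightarrow> ('x \<Rightarrow> complex) \<Rightarrow> 'x \<Rightarrow> complex"
  assumes fin: "finite (carrier G)"
    and subspace: "fs.subspace W"
    and closed: "g \<in> carrier G \<Longrightarrow> v \<in> W \<Longrightarrow> \<rho> g v \<in> W"
    and linear: "g \<in> carrier G \<Longrightarrow> linear_on W (\<rho> g)"
    and rho_one: "v \<in> W \<Longrightarrow> \<rho> \<one> v = v"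
    and rho_mult: "g \<in> carrier G \<Longrightarrow> h \<in> carrier G \<Longrightarrow> v \<in> W \<Longrightarrow> \<rho> (g \<otimes> h) v = \<rho> g (\<rho> h v)"
begin

lemma weighted_sum_cong:
  "(\<And>g. g \<in> carrier G \<Longrightarrow> f g = f' g) \<Longrightarrow> weighted_sum G d f \<rho> v = weighted_sum G d f' \<rho> v"
  by (simp add: weighted_sum_def)

lemma weighted_sum_closed: "v \<in> W \<Longrightarrow> weighted_sum G d f \<rho> v \<in> W"
  unfolding weighted_sum_def
  by (intro fs.subspace_scale fs.subspace_sum subspace closed)

lemma weighted_sum_linear: "linear_on W (weighted_sum G d f \<rho>)"
proof -
  have "weighted_sum G d f \<rho> (x + y) = weighted_sum G d f \<rho> x + weighted_sum G d f \<rho> y"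
    if "x \<in> W" "y \<in> W" for x y
  proof -
    have "(\<Sum>g\<in>carrier G. pscale (f (inv g)) (\<rho> g (x + y))) =
      (\<Sum>g\<in>carrier G. pscale (f (inv g)) (\<rho> g x) + pscale (f (inv g)) (\<rho> g y))"
      using linear that unfolding linear_on_def by (intro sum.cong) (simp_all add: fs.scale_right_distrib)
    then show ?thesis unfolding weighted_sum_def by (simp only: sum.distrib fs.scale_right_distrib)
  qed
  moreover have "weighted_sum G d f \<rho> (pscale z x) = pscale z (weighted_sum G d f \<rho> x)"
    if "x \<in> W" for z x
  proof -
    have "(\<Sum>g\<in>carrier G. pscale (f (inv g)) (\<rho> g (pscale z x))) =
      (\<Sum>g\<in>carrier G. pscale z (pscale (f (inv g)) (\<rho> g x)))"
      using linear that unfolding linear_on_def by (intro sum.cong) (simp_all add: mult.commute)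
    then show ?thesis unfolding weighted_sum_def
      by (simp only: fs.scale_sum_right[symmetric] fs.scale_left_commute)
  qed
  ultimately show ?thesis unfolding linear_on_def by blast
qed

lemma weighted_sum_sum:
  "weighted_sum G d (\<lambda>g. \<Sum>t\<in>I. c t * f t g) \<rho> v = (\<Sum>t\<in>I. pscale (c t) (weighted_sum G d (f t) \<rho> v))"
proof -
  have "(\<Sum>g\<in>carrier G. pscale (\<Sum>t\<in>I. c t * f t (inv g)) (\<rho> g v)) =
    (\<Sum>g\<in>carrier G. \<Sum>t\<in>I. pscale (c t) (pscale (f t (inv g)) (\<rho> g v)))"
    by (simp only: fs.scale_sum_left fs.scale_scale)
  also have "\<dots> = (\<Sum>t\<in>I. pscale (c t) (\<Sum>g\<in>carrier G. pscale (f t (inv g)) (\<rho> g v)))"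
    by (subst sum.swap) (simp only: fs.scale_sum_right)
  finally show ?thesis unfolding weighted_sum_def
    by (simp only: fs.scale_sum_right fs.scale_left_commute[of "of_nat d / of_nat (order G)"])
qed

lemma rho_weighted_sum:
  assumes h: "h \<in> carrier G" and v: "v \<in> W"
  shows "\<rho> h (weighted_sum G d f \<rho> v) = weighted_sum G d (\<lambda>k. f (k \<otimes> h)) \<rho> v"
proof -
  have "\<rho> h (\<Sum>g\<in>carrier G. pscale (f (inv g)) (\<rho> g v)) = (\<Sum>g\<in>carrier G. pscale (f (inv g)) (\<rho> h (\<rho> g v)))"
    by (intro linear_on_sum_scale[OF linear[OF h] subspace] closed v)
  also have "\<dots> = (\<Sum>k\<in>carrier G. pscale (f (inv k \<otimes> h)) (\<rho> k v))"
  proof (rule sum.reindex_bij_witness[of _ "\<lambda>k. inv h \<otimes> k" "\<lambda>g. h \<otimes> g"])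
    fix g assume g: "g \<in> carrier G"
    show "pscale (f (inv (h \<otimes> g) \<otimes> h)) (\<rho> (h \<otimes> g) v) = pscale (f (inv g)) (\<rho> h (\<rho> g v))"
      using g h v by (simp add: inv_mult_group m_assoc rho_mult)
  qed (use h in \<open>auto simp: m_assoc[symmetric]\<close>)
  finally have "\<rho> h (\<Sum>g\<in>carrier G. pscale (f (inv g)) (\<rho> g v)) =
    (\<Sum>k\<in>carrier G. pscale (f (inv k \<otimes> h)) (\<rho> k v))" .
  moreover have "(\<Sum>g\<in>carrier G. pscale (f (inv g)) (\<rho> g v)) \<in> W"
    by (intro fs.subspace_scale fs.subspace_sum subspace closed v)
  ultimately show ?thesis
    using linear[OF h] unfolding linear_on_def weighted_sum_def by simp
qed

text \<open>For fixed \<open>p\<close> the vectors \<open>P\<^sub>p\<^sub>t v\<close> transform under the group like the unit vectors under \<open>\<phi>\<close>.\<close>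

lemma rho_transfer:
  assumes \<phi>: "matrix_rep G d \<phi>" and h: "h \<in> carrier G" and v: "v \<in> W" and p: "p < d" and q: "q < d"
  shows "\<rho> h (transfer_operator G d \<phi> p q \<rho> v) =
    (\<Sum>t<d. pscale (\<phi> h $$ (t, q)) (transfer_operator G d \<phi> p t \<rho> v))"
proof -
  note \<phi>D = matrix_repD[OF \<phi>]
  have "\<rho> h (transfer_operator G d \<phi> p q \<rho> v) = weighted_sum G d (\<lambda>k. \<phi> (k \<otimes> h) $$ (p, q)) \<rho> v"
    unfolding transfer_operator_def by (rule rho_weighted_sum[OF h v])
  also have "\<dots> = weighted_sum G d (\<lambda>k. \<Sum>t<d. \<phi> h $$ (t, q) * \<phi> k $$ (p, t)) \<rho> v"
    by (rule weighted_sum_cong)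
      (simp only: \<phi>D(3) h mult_mat_entry[OF \<phi>D(1) \<phi>D(1) p q] mult.commute)
  finally show ?thesis by (simp only: weighted_sum_sum transfer_operator_def)
qed

text \<open>
  On a vector whose orbit is known through coefficients \<open>c g t\<close>, a weighted sum reduces to sums
  of products of functions on the group, to which orthogonality applies.
\<close>

lemma weighted_sum_on_copy:
  assumes act: "\<And>g. g \<in> carrier G \<Longrightarrow> \<rho> g x = (\<Sum>t\<in>I. pscale (c g t) (e t))"
  shows "weighted_sum G d f \<rho> x =
    (\<Sum>t\<in>I. pscale (of_nat d / of_nat (order G) * (\<Sum>g\<in>carrier G. f (inv g) * c g t)) (e t))"
proof -
  have "(\<Sum>g\<in>carrier G. pscale (f (inv g)) (\<rho> g x)) =
    (\<Sum>g\<in>carrier G. \<Sum>t\<in>I. pscale (f (inv g) * c g t) (e t))"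
    by (intro sum.cong refl) (simp only: act fs.scale_sum_right fs.scale_scale)
  also have "\<dots> = (\<Sum>t\<in>I. pscale (\<Sum>g\<in>carrier G. f (inv g) * c g t) (e t))"
    by (subst sum.swap) (simp only: fs.scale_sum_left)
  finally show ?thesis
    unfolding weighted_sum_def by (simp only: fs.scale_sum_right fs.scale_scale)
qed

text \<open>
  The span of the orbit of \<open>w\<close> is an invariant subspace of \<open>C\<close> with a finite basis. Among the finite
  bases of nonzero invariant subspaces of \<open>C\<close> take one of minimal size: its span has no proper
  nonzero invariant subspace, and coordinates turn the action into matrices.
\<close>

lemma irreducible_subrep_exists:
  assumes C: "fs.subspace C" "C \<subseteq> W"
    and inv: "\<And>g v. g \<in> carrier G \<Longrightarrow> v \<in> C \<Longrightarrow> \<rho> g v \<in> C" and w: "w \<in> C" "w \<noteq> 0"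
  obtains d \<psi> U where "irreducible_rep G d \<psi>" "U \<subseteq> C" "equivalent_to G \<rho> U d \<psi>"
proof -
  define Q where "Q B \<longleftrightarrow> finite B \<and> fs.independent B \<and> B \<noteq> {} \<and> B \<subseteq> C \<and>
    (\<forall>g\<in>carrier G. \<forall>b\<in>B. \<rho> g b \<in> fs.span B)" for B
  have "\<exists>B. Q B"
  proof -
    let ?S = "(\<lambda>g. \<rho> g w) ` carrier G"
    obtain B where B: "B \<subseteq> ?S" "fs.independent B" "?S \<subseteq> fs.span B"
      using fs.maximal_independent_subset by blast
    have "finite B" using B(1) fin by (meson finite_imageI finite_subset)
    moreover have "w \<in> ?S" using rho_one w C by force
    then have "B \<noteq> {}" using B(3) w(2) by auto
    moreover have "B \<subseteq> C" using B(1) inv w(1) by blast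
    moreover have "\<rho> g b \<in> fs.span B" if "g \<in> carrier G" "b \<in> B" for g b
    proof -
      have wW: "w \<in> W" using w(1) C(2) by (rule subsetD[rotated])
      have "b \<in> ?S" using that(2) B(1) by (rule subsetD[rotated])
      then obtain h where h: "b = \<rho> h w" "h \<in> carrier G" by (rule imageE)
      have "\<rho> g b = \<rho> (g \<otimes> h) w" unfolding h(1) using that(1) h(2) wW by (rule rho_mult[symmetric])
      then have "\<rho> g b \<in> ?S" using that(1) h(2) by (simp only:) (intro imageI m_closed)
      then show ?thesis using B(3) by (rule subsetD[rotated])
    qed
    ultimately have "Q B" using B(2) unfolding Q_def by simp
    then show ?thesis by (rule exI)
  qed
  then obtain B where B: "Q B" and least: "\<And>B'. Q B' \<Longrightarrow> card B \<le> card B'"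
    using ex_has_least_nat[of Q _ card] by metis
  have finB: "finite B" and ind: "fs.independent B" and ne: "B \<noteq> {}" and BC: "B \<subseteq> C"
    and Binv: "\<And>g b. g \<in> carrier G \<Longrightarrow> b \<in> B \<Longrightarrow> \<rho> g b \<in> fs.span B"
    using B unfolding Q_def by auto
  have BW: "B \<subseteq> W" using BC C by blast
  let ?U = "fs.span B"
  have UC: "?U \<subseteq> C" using fs.span_minimal[OF BC C(1)] .
  obtain bs where bs: "set bs = B" "distinct bs" using finite_distinct_list[OF finB] by blast
  define d where "d = length bs"
  have bij: "bij_betw ((!) bs) {..<d} B" using bij_betw_nth[OF bs(2)] bs(1) d_def by blast
  have dB: "card B = d" using bij_betw_same_card[OF bij] by simp
  have bsB: "bs ! a \<in> B" if "a < d" for a using that bs(1) d_def by auto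
  define f where "f x = (\<Sum>a<d. pscale (vec_index x a) (bs ! a))" for x
  \<comment> \<open>\<open>f\<close> and \<open>co\<close> are the mutually inverse passages between coordinate vectors and the span of \<open>B\<close>.\<close>
  define co where "co v = Matrix.vec d (\<lambda>a. fs.representation B v (bs ! a))" for v
  have f_co: "f (co v) = v" if "v \<in> ?U" for v
  proof -
    have "f (co v) = (\<Sum>a<d. pscale (fs.representation B v (bs ! a)) (bs ! a))"
      by (simp add: f_def co_def)
    also have "\<dots> = (\<Sum>b\<in>B. pscale (fs.representation B v b) b)"
      by (rule sum.reindex_bij_betw[OF bij])
    also have "\<dots> = v" using fs.sum_representation_eq[OF ind that finB] by simp
    finally show ?thesis .
  qed
  have co_carrier: "co v \<in> carrier_vec d" for v by (simp add: co_def)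
  have f_U: "f x \<in> ?U" for x
    unfolding f_def by (intro fs.span_sum fs.span_scale fs.span_base) (use bsB in auto)
  have f_W: "f x \<in> W" for x using f_U UC C(2) by (rule subsetD[OF subset_trans, rotated 2])
  have f_add: "f (x + y) = f x + f y" if "x \<in> carrier_vec d" "y \<in> carrier_vec d" for x y
  proof -
    have "f (x + y) = (\<Sum>a<d. pscale (vec_index x a) (bs ! a) + pscale (vec_index y a) (bs ! a))"
      unfolding f_def using that by (intro sum.cong refl) (simp add: fs.scale_left_distrib)
    then show ?thesis by (simp only: sum.distrib f_def)
  qed
  have f_scale: "f (z \<cdot>\<^sub>v x) = pscale z (f x)" if "x \<in> carrier_vec d" for x z
    unfolding f_def fs.scale_sum_right using that by (intro sum.cong refl) simp
  have f_inj: "x = y" if x: "x \<in> carrier_vec d" "y \<in> carrier_vec d" "f x = f y" for x y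
  proof -
    define u where "u b = vec_index x (inv_into {..<d} ((!) bs) b) - vec_index y (inv_into {..<d} ((!) bs) b)" for b
    have u: "u (bs ! a) = vec_index x a - vec_index y a" if "a < d" for a
      using that bij_betw_imp_inj_on[OF bij] by (simp add: u_def inv_into_f_f)
    have "(\<Sum>b\<in>B. pscale (u b) b) = (\<Sum>a<d. pscale (u (bs ! a)) (bs ! a))"
      by (rule sum.reindex_bij_betw[OF bij, symmetric])
    also have "\<dots> = (\<Sum>a<d. pscale (vec_index x a) (bs ! a) - pscale (vec_index y a) (bs ! a))"
      by (intro sum.cong refl) (simp add: u fs.scale_left_diff_distrib)
    also have "\<dots> = 0" using x(3) unfolding f_def sum_subtractf by (simp only: right_minus_eq)
    finally have "\<forall>b\<in>B. u b = 0" using ind unfolding independent_finite_iff[OF finB] by blast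
    then have "vec_index x a = vec_index y a" if "a < d" for a using u[OF that] bsB[OF that] by simp
    then show ?thesis using x by (intro eq_vecI) auto
  qed
  have rho_sum: "\<rho> g (\<Sum>a<d. pscale (c a) (bs ! a)) = (\<Sum>a<d. pscale (c a) (\<rho> g (bs ! a)))"
    if "g \<in> carrier G" for g c
    by (rule linear_on_sum_scale[OF linear[OF that] subspace]) (use bsB BW in auto)
  have rhoU: "\<rho> g v \<in> ?U" if "g \<in> carrier G" "v \<in> ?U" for g v
  proof -
    have "v = (\<Sum>a<d. pscale (vec_index (co v) a) (bs ! a))" using f_co[OF that(2)] unfolding f_def by simp
    then have "\<rho> g v = (\<Sum>a<d. pscale (vec_index (co v) a) (\<rho> g (bs ! a)))"
      using rho_sum[OF that(1)] by metis
    then show ?thesis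
      by (simp only:) (intro fs.span_sum fs.span_scale Binv that(1) bsB, simp)
  qed
  define \<psi> where "\<psi> g = Matrix.mat d d (\<lambda>(a, b). vec_index (co (\<rho> g (bs ! b))) a)" for g
  have \<psi>_carrier: "\<psi> g \<in> carrier_mat d d" for g by (simp add: \<psi>_def)
  have f_\<psi>: "f (\<psi> g *\<^sub>v x) = \<rho> g (f x)" if g: "g \<in> carrier G" and x: "x \<in> carrier_vec d" for g x
  proof -
    have "f (\<psi> g *\<^sub>v x) = (\<Sum>a<d. pscale (\<Sum>b<d. vec_index x b * vec_index (co (\<rho> g (bs ! b))) a) (bs ! a))"
      unfolding f_def using x
      by (intro sum.cong refl) (simp add: \<psi>_def scalar_prod_def atLeast0LessThan mult.commute)
    also have "\<dots> = (\<Sum>b<d. pscale (vec_index x b) (f (co (\<rho> g (bs ! b)))))"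
      unfolding f_def fs.scale_sum_left fs.scale_sum_right fs.scale_scale
      by (rule sum.swap)
    also have "\<dots> = (\<Sum>b<d. pscale (vec_index x b) (\<rho> g (bs ! b)))"
      using Binv[OF g] bsB by (intro sum.cong refl) (simp add: f_co)
    also have "\<dots> = \<rho> g (f x)"
      unfolding f_def by (rule rho_sum[OF g, symmetric])
    finally show ?thesis .
  qed
  have "matrix_rep G d \<psi>"
    unfolding matrix_rep_def
  proof (intro conjI ballI)
    show "\<psi> \<one> = 1\<^sub>m d"
    proof (rule mat_eq_of_mult_vec[OF \<psi>_carrier one_carrier_mat])
      fix x :: "complex Matrix.vec" assume x: "x \<in> carrier_vec d"
      have "f (\<psi> \<one> *\<^sub>v x) = f x" using f_\<psi>[OF _ x] rho_one[OF f_W] by simp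
      then show "\<psi> \<one> *\<^sub>v x = 1\<^sub>m d *\<^sub>v x"
        using f_inj[OF mult_mat_vec_carrier[OF \<psi>_carrier x] x] x by simp
    qed
    show "\<psi> (g \<otimes> h) = \<psi> g * \<psi> h" if gh: "g \<in> carrier G" "h \<in> carrier G" for g h
    proof (rule mat_eq_of_mult_vec[OF \<psi>_carrier mult_carrier_mat[OF \<psi>_carrier \<psi>_carrier]])
      fix x :: "complex Matrix.vec" assume x: "x \<in> carrier_vec d"
      have hx: "\<psi> h *\<^sub>v x \<in> carrier_vec d" by (rule mult_mat_vec_carrier[OF \<psi>_carrier x])
      have "f (\<psi> (g \<otimes> h) *\<^sub>v x) = \<rho> g (\<rho> h (f x))"
        using f_\<psi>[OF _ x] rho_mult[OF _ _ f_W] gh by simp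
      also have "\<dots> = f (\<psi> g *\<^sub>v (\<psi> h *\<^sub>v x))" using f_\<psi> gh x hx by simp
      finally show "\<psi> (g \<otimes> h) *\<^sub>v x = \<psi> g * \<psi> h *\<^sub>v x"
        unfolding assoc_mult_mat_vec[OF \<psi>_carrier \<psi>_carrier x]
        by (intro f_inj mult_mat_vec_carrier[OF \<psi>_carrier] x hx)
    qed
  qed (rule \<psi>_carrier)
  moreover have "0 < d" using ne finB unfolding dB[symmetric] by (simp add: card_gt_0_iff)
  moreover have "X = {0\<^sub>v d} \<or> X = carrier_vec d"
    if X: "X \<subseteq> carrier_vec d" and X0: "0\<^sub>v d \<in> X" and Xadd: "\<forall>x\<in>X. \<forall>y\<in>X. x + y \<in> X"
      and Xscale: "\<forall>z. \<forall>x\<in>X. z \<cdot>\<^sub>v x \<in> X" and Xinv: "\<forall>g\<in>carrier G. \<forall>x\<in>X. \<psi> g *\<^sub>v x \<in> X" for X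
  proof (cases "X = {0\<^sub>v d}")
    case False
    have Xc: "x \<in> carrier_vec d" if "x \<in> X" for x using that X by (rule subsetD[rotated])
    have f0: "f (0\<^sub>v d) = 0" unfolding f_def by simp
    have sub: "fs.subspace (f ` X)"
    proof (rule fs.subspaceI)
      show "0 \<in> f ` X" using X0 f0 by (metis image_eqI)
      show "u + v \<in> f ` X" if uv: "u \<in> f ` X" "v \<in> f ` X" for u v
      proof -
        obtain x y where xy: "x \<in> X" "u = f x" "y \<in> X" "v = f y"
          using uv by (elim imageE)
        then have "u + v = f (x + y)" using f_add[of x y] Xc by metis
        then show ?thesis using xy Xadd by (simp only: imageI)
      qed
      show "pscale c u \<in> f ` X" if u: "u \<in> f ` X" for c u
      proof -
        obtain x where x: "x \<in> X" "u = f x" using u by (elim imageE)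
        then have "pscale c u = f (c \<cdot>\<^sub>v x)" using f_scale[of x] Xc by metis
        then show ?thesis using x Xscale by (simp only: imageI)
      qed
    qed
    \<comment> \<open>An invariant subspace \<open>X\<close> of coordinate vectors corresponds to the invariant span of \<open>B'\<close>;
      by minimality \<open>B'\<close> has at least as many elements as \<open>B\<close>.\<close>
    obtain B' where B': "B' \<subseteq> f ` X" "fs.independent B'" "f ` X \<subseteq> fs.span B'"
      using fs.maximal_independent_subset by blast
    have spanB': "fs.span B' = f ` X" using B' fs.span_minimal[OF B'(1) sub] by blast
    have B'U: "B' \<subseteq> ?U" using B'(1) f_U by blast
    have fin': "finite B'" "card B' \<le> card B" using fs.independent_span_bound[OF finB B'(2) B'U] by auto
    have "B' \<noteq> {}"
    proof
      assume "B' = {}"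
      then have "f ` X = {0}" using spanB' by simp
      then have "x = 0\<^sub>v d" if "x \<in> X" for x using f_inj[OF Xc[OF that] zero_carrier_vec] that f0 by auto
      then show False using False X0 by blast
    qed
    moreover have "\<rho> g b \<in> fs.span B'" if g: "g \<in> carrier G" and b: "b \<in> B'" for g b
    proof -
      have "b \<in> f ` X" using b B'(1) by (rule subsetD[rotated])
      then obtain x where x: "x \<in> X" "b = f x" by (elim imageE)
      then have "\<rho> g b = f (\<psi> g *\<^sub>v x)" using f_\<psi>[OF g] Xc by metis
      then show ?thesis using Xinv g x(1) unfolding spanB' by (simp only: imageI)
    qed
    moreover have "B' \<subseteq> C" using B'U UC by blast
    ultimately have "card B \<le> card B'" using least fin' B'(2) unfolding Q_def by blast
    then have card: "card B' = card B" using fin' by simp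
    have "b \<in> fs.span B'" if b: "b \<in> B" for b
    proof (rule ccontr)
      assume nb: "b \<notin> fs.span B'"
      then have "fs.independent (insert b B')"
        using fs.independent_insertI[OF nb B'(2)] by simp
      moreover have "insert b B' \<subseteq> ?U" using fs.span_base[OF b] B'U by simp
      ultimately have "card (insert b B') \<le> card B" using fs.independent_span_bound[OF finB] by blast
      moreover have "b \<notin> B'" using nb fs.span_base by metis
      ultimately show False using card fin' by simp
    qed
    then have "?U \<subseteq> fs.span B'" by (intro fs.span_minimal fs.subspace_span subsetI)
    then have "?U \<subseteq> f ` X" using spanB' by simp
    have "x \<in> X" if x: "x \<in> carrier_vec d" for x
    proof -
      have "f x \<in> f ` X" using f_U[of x] \<open>?U \<subseteq> f ` X\<close> by (rule subsetD[rotated])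
      then obtain y where "y \<in> X" "f x = f y" by (elim imageE)
      then show ?thesis using f_inj[OF x Xc, of y] by simp
    qed
    then show ?thesis using X by blast
  qed simp
  ultimately have "irreducible_rep G d \<psi>" unfolding irreducible_rep_def by blast
  moreover have "bij_betw f (carrier_vec d) ?U"
  proof (rule bij_betwI[where g = co])
    show "co (f x) = x" if "x \<in> carrier_vec d" for x
      using f_inj[OF co_carrier that f_co[OF f_U]] .
  qed (use f_U co_carrier f_co in auto)
  then have "equivalent_to G \<rho> ?U d \<psi>"
    unfolding equivalent_to_def using f_add f_scale f_\<psi> by blast
  ultimately show thesis using UC by (intro that)
qed

end

section \<open>Isotypic components and symmetry-adapted bases\<close>

text \<open>Composition of the parametrization of \<open>U\<close> with an invertible intertwiner of the matrix forms.\<close>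

lemma equivalent_to_change_matrices:
  assumes eq: "equivalent_reps G d \<phi> e \<psi>" and \<phi>: "matrix_rep G d \<phi>" and \<psi>: "matrix_rep G e \<psi>"
    and U: "equivalent_to G \<rho> U e \<psi>"
  shows "equivalent_to G \<rho> U d \<phi>"
proof -
  obtain T where de: "d = e" and T: "T \<in> carrier_mat d d" "invertible_mat T"
    and comm: "\<And>g. g \<in> carrier G \<Longrightarrow> T * \<phi> g = \<psi> g * T"
    using eq unfolding equivalent_reps_def by blast
  obtain X where X: "inverts_mat T X" "inverts_mat X T"
    using T(2) unfolding invertible_mat_def by blast
  have X1: "T * X = 1\<^sub>m d" using X(1) T(1) unfolding inverts_mat_def by simp
  have "X * T = 1\<^sub>m (dim_row X)" using X(2) unfolding inverts_mat_def .
  then have "dim_col (X * T) = dim_row X" by simp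
  moreover have "dim_col (T * X) = d" unfolding X1 by simp
  ultimately have Xc: "X \<in> carrier_mat d d" using T(1) by (intro carrier_matI) simp_all
  have X2: "X * T = 1\<^sub>m d" using X(2) Xc unfolding inverts_mat_def by simp
  obtain f where f: "bij_betw f (carrier_vec d) U"
    and add: "\<And>x y. x \<in> carrier_vec d \<Longrightarrow> y \<in> carrier_vec d \<Longrightarrow> f (x + y) = f x + f y"
    and scale: "\<And>z x. x \<in> carrier_vec d \<Longrightarrow> f (z \<cdot>\<^sub>v x) = pscale z (f x)"
    and act: "\<And>g x. g \<in> carrier G \<Longrightarrow> x \<in> carrier_vec d \<Longrightarrow> f (\<psi> g *\<^sub>v x) = \<rho> g (f x)"
    using U unfolding equivalent_to_def de by blast
  have Tc: "T *\<^sub>v x \<in> carrier_vec d" for x using T(1) by (intro carrier_vecI) simp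
  have Xvc: "X *\<^sub>v x \<in> carrier_vec d" for x using Xc by (intro carrier_vecI) simp
  have "bij_betw (\<lambda>x. T *\<^sub>v x) (carrier_vec d) (carrier_vec d)"
  proof (rule bij_betwI[where g = "\<lambda>x. X *\<^sub>v x"])
    show "X *\<^sub>v (T *\<^sub>v x) = x" if "x \<in> carrier_vec d" for x
      using assoc_mult_mat_vec[OF Xc T(1) that] X2 that by simp
    show "T *\<^sub>v (X *\<^sub>v x) = x" if "x \<in> carrier_vec d" for x
      using assoc_mult_mat_vec[OF T(1) Xc that] X1 that by simp
  qed (use Tc Xvc in auto)
  then have "bij_betw (f \<circ> (\<lambda>x. T *\<^sub>v x)) (carrier_vec d) U" using f by (rule bij_betw_trans)
  moreover have "f (T *\<^sub>v (x + y)) = f (T *\<^sub>v x) + f (T *\<^sub>v y)"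
    if "x \<in> carrier_vec d" "y \<in> carrier_vec d" for x y
    using mult_add_distrib_mat_vec[OF T(1) that] add[OF Tc Tc] by simp
  moreover have "f (T *\<^sub>v (z \<cdot>\<^sub>v x)) = pscale z (f (T *\<^sub>v x))" if "x \<in> carrier_vec d" for x z
    using mult_mat_vec[OF T(1) that] scale[OF Tc] by simp
  moreover have "f (T *\<^sub>v (\<phi> g *\<^sub>v x)) = \<rho> g (f (T *\<^sub>v x))" if g: "g \<in> carrier G" and x: "x \<in> carrier_vec d" for g x
  proof -
    have "T *\<^sub>v (\<phi> g *\<^sub>v x) = (T * \<phi> g) *\<^sub>v x"
      using assoc_mult_mat_vec[OF T(1) matrix_repD(1)[OF \<phi> g] x] by simp
    also have "\<dots> = \<psi> g *\<^sub>v (T *\<^sub>v x)"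
      unfolding comm[OF g] using assoc_mult_mat_vec[OF matrix_repD(1)[OF \<psi> g, folded de] T(1) x] .
    finally show ?thesis using act[OF g Tc] by simp
  qed
  ultimately show ?thesis unfolding equivalent_to_def by (intro exI[of _ "f \<circ> (\<lambda>x. T *\<^sub>v x)"]) simp
qed

text \<open>Expansion in unit vectors, by truncating \<open>x\<close> to its first \<open>m\<close> entries.\<close>

lemma linear_vec_expansion:
  fixes f :: "complex Matrix.vec \<Rightarrow> 'x \<Rightarrow> complex"
  assumes add: "\<And>x y. x \<in> carrier_vec d \<Longrightarrow> y \<in> carrier_vec d \<Longrightarrow> f (x + y) = f x + f y"
    and scale: "\<And>z x. x \<in> carrier_vec d \<Longrightarrow> f (z \<cdot>\<^sub>v x) = pscale z (f x)"
    and x: "x \<in> carrier_vec d"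
  shows "f x = (\<Sum>t<d. pscale (vec_index x t) (f (unit_vec d t)))"
proof -
  have "f (Matrix.vec d (\<lambda>i. if i < m then vec_index x i else 0)) =
    (\<Sum>t<m. pscale (vec_index x t) (f (unit_vec d t)))" if "m \<le> d" for m
    using that
  proof (induction m)
    case 0
    have "Matrix.vec d (\<lambda>i. if i < 0 then vec_index x i else 0) = 0 \<cdot>\<^sub>v 0\<^sub>v d" by (intro eq_vecI) simp_all
    then show ?case by (simp only: scale[OF zero_carrier_vec] pscale_0) simp
  next
    case (Suc m)
    let ?y = "\<lambda>m. Matrix.vec d (\<lambda>i. if i < m then vec_index x i else 0)"
    have "?y (Suc m) = ?y m + vec_index x m \<cdot>\<^sub>v unit_vec d m"
      using Suc.prems by (intro eq_vecI) (auto simp: less_Suc_eq)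
    then have "f (?y (Suc m)) = f (?y m) + pscale (vec_index x m) (f (unit_vec d m))"
      using add[of "?y m" "vec_index x m \<cdot>\<^sub>v unit_vec d m"] scale[of "unit_vec d m"] by simp
    then show ?case using Suc by (simp only: sum.lessThan_Suc)
  qed
  from this[of d] show ?thesis
    using x eq_vecI[of x "Matrix.vec d (\<lambda>i. if i < d then vec_index x i else 0)"] by simp
qed

locale rep_with_irreducibles = finite_group_rep G W \<rho>
  for G (structure) and W :: "('x \<Rightarrow> complex) set" and \<rho> :: "'g \<Rightarrow> ('x \<Rightarrow> complex) \<Rightarrow> 'x \<Rightarrow> complex" +
  fixes r :: nat and deg :: "nat \<Rightarrow> nat" and \<phi> :: "nat \<Rightarrow> 'g \<Rightarrow> complex mat"
  assumes irreducibles: "distinct_irreducibles G r deg \<phi>"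
begin

text \<open>The transfer operators \<open>P\<^sup>i\<^sub>p\<^sub>q\<close> and the isotypic projections \<open>\<Pi>\<^sub>i\<close>.\<close>

abbreviation "T i p q \<equiv> transfer_operator G (deg i) (\<phi> i) p q \<rho>"
abbreviation "E i \<equiv> isotypic_projection G (deg i) (\<phi> i) \<rho>"

lemma irred: "i < r \<Longrightarrow> irreducible_rep G (deg i) (\<phi> i)"
  using irreducibles unfolding distinct_irreducibles_def by blast

lemma mrep: "i < r \<Longrightarrow> matrix_rep G (deg i) (\<phi> i)"
  using irred irreducible_repD(1) by blast

lemma deg_pos: "i < r \<Longrightarrow> 0 < deg i"
  using irred irreducible_repD(2) by blast

lemma order_nonzero: "(of_nat (order G) :: complex) \<noteq> 0"
  using fin order_gt_0_iff_finite by simp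

lemma orthogonality:
  assumes "i < r" "j < r" "p < deg i" "q < deg i" "t < deg j" "s < deg j"
  shows "of_nat (deg i) / of_nat (order G) *
      (\<Sum>g\<in>carrier G. \<phi> i (inv g) $$ (p, q) * \<phi> j g $$ (t, s)) =
    (if i = j \<and> p = s \<and> q = t then 1 else 0)"
proof (cases "i = j")
  case True
  then show ?thesis
    using schur_orthogonality[OF is_group fin irred[OF assms(1)], of p q t s] assms deg_pos[OF assms(1)] order_nonzero
    by auto
next
  case False
  then have "\<not> equivalent_reps G (deg j) (\<phi> j) (deg i) (\<phi> i)"
    using irreducibles assms(1,2) unfolding distinct_irreducibles_def by auto
  then show ?thesis
    using schur_orthogonality_inequivalent[OF is_group irred[OF assms(1)] irred[OF assms(2)] _ assms(3-6)] False by simp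
qed

lemma T_closed: "v \<in> W \<Longrightarrow> T i p q v \<in> W"
  unfolding transfer_operator_def by (rule weighted_sum_closed)

lemma T_linear: "linear_on W (T i p q)"
  unfolding transfer_operator_def by (rule weighted_sum_linear)

lemma E_closed: "v \<in> W \<Longrightarrow> E i v \<in> W"
  unfolding isotypic_projection_def by (rule weighted_sum_closed)

lemma E_linear: "linear_on W (E i)"
  unfolding isotypic_projection_def by (rule weighted_sum_linear)

text \<open>
  The multiplication table: by \<open>rho_transfer\<close> the group moves \<open>P\<^sup>j\<^sub>a\<^sub>b v\<close> along the vectors \<open>P\<^sup>j\<^sub>a\<^sub>t v\<close> with
  coefficients \<open>\<phi> j g $$ (t, b)\<close>, and orthogonality selects \<open>t = q\<close>.
\<close>

lemma T_T:
  assumes v: "v \<in> W" and ij: "i < r" "j < r" and "p < deg i" "q < deg i" "a < deg j" "b < deg j"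
  shows "T i p q (T j a b v) = (if i = j \<and> p = b then T i a q v else 0)"
proof -
  have "T i p q (T j a b v) = (\<Sum>t<deg j. pscale (of_nat (deg i) / of_nat (order G) *
      (\<Sum>g\<in>carrier G. \<phi> i (inv g) $$ (p, q) * \<phi> j g $$ (t, b))) (T j a t v))"
    unfolding transfer_operator_def[of _ "deg i" "\<phi> i"]
    by (rule weighted_sum_on_copy) (rule rho_transfer[OF mrep[OF ij(2)] _ v assms(6,7)])
  also have "\<dots> = (\<Sum>t<deg j. if t = q \<and> i = j \<and> p = b then T i a q v else 0)"
  proof (rule sum.cong[OF refl])
    fix t assume "t \<in> {..<deg j}"
    then have t: "t < deg j" by simp
    show "pscale (of_nat (deg i) / of_nat (order G) *
        (\<Sum>g\<in>carrier G. \<phi> i (inv g) $$ (p, q) * \<phi> j g $$ (t, b))) (T j a t v) =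
      (if t = q \<and> i = j \<and> p = b then T i a q v else 0)"
      unfolding orthogonality[OF assms(2,3,4,5) t assms(7)] by auto
  qed
  also have "\<dots> = (if i = j \<and> p = b then T i a q v else 0)" using assms by auto
  finally show ?thesis .
qed

lemma E_eq: "E i v = (\<Sum>p<deg i. T i p p v)"
  unfolding isotypic_projection_def transfer_operator_def character_def
  using weighted_sum_sum[of "deg i" "\<lambda>_. 1" "\<lambda>p g. \<phi> i g $$ (p, p)" "{..<deg i}" v]
  by (simp only: mult_1 fs.scale_one)

lemma E_T:
  assumes v: "v \<in> W" and ij: "i < r" "j < r" and ab: "a < deg j" "b < deg j"
  shows "E i (T j a b v) = (if i = j then T j a b v else 0)"
proof -
  have "E i (T j a b v) = (\<Sum>p<deg i. if p = b then (if i = j then T i a p v else 0) else 0)"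
    unfolding E_eq using assms by (intro sum.cong refl) (simp add: T_T)
  also have "\<dots> = (if i = j then T j a b v else 0)" using ab by auto
  finally show ?thesis .
qed

lemma E_E:
  assumes "v \<in> W" "i < r" "j < r"
  shows "E i (E j v) = (if i = j then E j v else 0)"
proof -
  have "E i (E j v) = (\<Sum>p<deg j. E i (T j p p v))"
    unfolding E_eq[of j] by (rule linear_on_sum[OF E_linear subspace]) (use assms in \<open>auto intro: T_closed\<close>)
  also have "\<dots> = (\<Sum>p<deg j. if i = j then T j p p v else 0)"
    using assms by (intro sum.cong refl) (simp add: E_T)
  also have "\<dots> = (if i = j then E j v else 0)" by (simp add: E_eq)
  finally show ?thesis .
qed

lemma E_image_fixed: "i < r \<Longrightarrow> v \<in> E i ` W \<Longrightarrow> E i v = v"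
  using E_E by auto

lemma E_subspace: "fs.subspace (E i ` W)"
  by (rule subspace_linear_image[OF E_linear subspace])

lemma E_subset: "E i ` W \<subseteq> W"
  using E_closed by auto

lemma T_rho:
  assumes i: "i < r" and h: "h \<in> carrier G" and v: "v \<in> W" and p: "p < deg i" and q: "q < deg i"
  shows "T i p q (\<rho> h v) = (\<Sum>t<deg i. pscale (\<phi> i h $$ (p, t)) (T i t q v))"
proof -
  note \<phi>D = matrix_repD[OF mrep[OF i]]
  have "(\<Sum>g\<in>carrier G. pscale (\<phi> i (inv g) $$ (p, q)) (\<rho> g (\<rho> h v))) =
    (\<Sum>k\<in>carrier G. pscale (\<phi> i (h \<otimes> inv k) $$ (p, q)) (\<rho> k v))"
  proof (rule sum.reindex_bij_witness[of _ "\<lambda>k. k \<otimes> inv h" "\<lambda>g. g \<otimes> h"])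
    fix g assume g: "g \<in> carrier G"
    show "pscale (\<phi> i (h \<otimes> inv (g \<otimes> h)) $$ (p, q)) (\<rho> (g \<otimes> h) v) =
      pscale (\<phi> i (inv g) $$ (p, q)) (\<rho> g (\<rho> h v))"
      using g h v by (simp add: inv_mult_group m_assoc[symmetric] rho_mult)
  qed (use h in \<open>auto simp: m_assoc\<close>)
  then have "T i p q (\<rho> h v) = weighted_sum G (deg i) (\<lambda>k. \<phi> i (h \<otimes> k) $$ (p, q)) \<rho> v"
    by (simp only: transfer_operator_def weighted_sum_def)
  also have "\<dots> = weighted_sum G (deg i) (\<lambda>k. \<Sum>t<deg i. \<phi> i h $$ (p, t) * \<phi> i k $$ (t, q)) \<rho> v"
    by (rule weighted_sum_cong) (simp only: \<phi>D(3) h mult_mat_entry[OF \<phi>D(1) \<phi>D(1) p q])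
  finally show ?thesis by (simp only: weighted_sum_sum transfer_operator_def)
qed

text \<open>
  It is enough to treat the images of the unit vectors, on which \<open>P\<^sup>i\<^sub>p\<^sub>p\<close> acts as the \<open>p\<close>-th coordinate
  projection by orthogonality.
\<close>

lemma E_fixes_copy:
  assumes i: "i < r" and U: "U \<subseteq> W" "equivalent_to G \<rho> U (deg i) (\<phi> i)" and u: "u \<in> U"
  shows "E i u = u"
proof -
  let ?d = "deg i"
  note \<phi>D = matrix_repD[OF mrep[OF i]]
  obtain f where f: "bij_betw f (carrier_vec ?d) U"
    and add: "\<And>x y. x \<in> carrier_vec ?d \<Longrightarrow> y \<in> carrier_vec ?d \<Longrightarrow> f (x + y) = f x + f y"
    and scale: "\<And>z x. x \<in> carrier_vec ?d \<Longrightarrow> f (z \<cdot>\<^sub>v x) = pscale z (f x)"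
    and act: "\<And>g x. g \<in> carrier G \<Longrightarrow> x \<in> carrier_vec ?d \<Longrightarrow> f (\<phi> i g *\<^sub>v x) = \<rho> g (f x)"
    using U(2) unfolding equivalent_to_def by blast
  have expand: "f x = (\<Sum>t<?d. pscale (vec_index x t) (f (unit_vec ?d t)))"
    if "x \<in> carrier_vec ?d" for x
    using linear_vec_expansion[of ?d f x] add scale that by blast
  have fW: "f x \<in> W" if "x \<in> carrier_vec ?d" for x using bij_betw_apply[OF f that] U(1) by blast
  have copy: "T i p p (f (unit_vec ?d b)) = (if p = b then f (unit_vec ?d b) else 0)"
    if p: "p < ?d" and b: "b < ?d" for p b
  proof -
    have "\<rho> g (f (unit_vec ?d b)) = (\<Sum>t<?d. pscale (\<phi> i g $$ (t, b)) (f (unit_vec ?d t)))"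
      if g: "g \<in> carrier G" for g
    proof -
      have "\<rho> g (f (unit_vec ?d b)) = f (\<phi> i g *\<^sub>v unit_vec ?d b)" using act[OF g] by simp
      also have "\<dots> = (\<Sum>t<?d. pscale (vec_index (\<phi> i g *\<^sub>v unit_vec ?d b) t) (f (unit_vec ?d t)))"
        by (rule expand) (use mult_mat_vec_carrier[OF \<phi>D(1)[OF g] unit_vec_carrier] in auto)
      also have "\<dots> = (\<Sum>t<?d. pscale (\<phi> i g $$ (t, b)) (f (unit_vec ?d t)))"
        using mult_mat_vec_unit[OF \<phi>D(1)[OF g] _ b] by (intro sum.cong refl) simp
      finally show ?thesis .
    qed
    then have "T i p p (f (unit_vec ?d b)) = (\<Sum>t<?d. pscale (of_nat ?d / of_nat (order G) *
        (\<Sum>g\<in>carrier G. \<phi> i (inv g) $$ (p, p) * \<phi> i g $$ (t, b))) (f (unit_vec ?d t)))"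
      unfolding transfer_operator_def by (rule weighted_sum_on_copy)
    also have "\<dots> = (\<Sum>t<?d. if t = p then (if p = b then f (unit_vec ?d b) else 0) else 0)"
    proof (rule sum.cong[OF refl])
      fix t assume "t \<in> {..<?d}"
      then have t: "t < ?d" by simp
      show "pscale (of_nat ?d / of_nat (order G) *
          (\<Sum>g\<in>carrier G. \<phi> i (inv g) $$ (p, p) * \<phi> i g $$ (t, b))) (f (unit_vec ?d t)) =
        (if t = p then (if p = b then f (unit_vec ?d b) else 0) else 0)"
        unfolding orthogonality[OF i i p p t b] by auto
    qed
    also have "\<dots> = (if p = b then f (unit_vec ?d b) else 0)" using p by simp
    finally show ?thesis .
  qed
  have E_unit: "E i (f (unit_vec ?d b)) = f (unit_vec ?d b)" if "b < ?d" for b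
    unfolding E_eq using that by (simp add: copy)
  obtain x where x: "x \<in> carrier_vec ?d" "u = f x" using f u unfolding bij_betw_def by blast
  have "E i (\<Sum>t<?d. pscale (vec_index x t) (f (unit_vec ?d t))) =
    (\<Sum>t<?d. pscale (vec_index x t) (E i (f (unit_vec ?d t))))"
    by (rule linear_on_sum_scale[OF E_linear subspace]) (intro fW unit_vec_carrier)
  also have "\<dots> = (\<Sum>t<?d. pscale (vec_index x t) (f (unit_vec ?d t)))"
    by (intro sum.cong refl) (simp add: E_unit)
  finally show ?thesis unfolding x(2) expand[OF x(1), symmetric] .
qed

text \<open>
  The difference of a vector and the sum of its projections is killed by all transfer operators.
  The space \<open>C\<close> of all vectors with this property is invariant. If it were nonzero it would contain
  an irreducible subspace \<open>U\<close>, on which some projection is the identity, although it vanishes on \<open>C\<close>.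
\<close>

lemma sum_E:
  assumes v: "v \<in> W"
  shows "(\<Sum>i<r. E i v) = v"
proof (rule ccontr)
  assume ne: "(\<Sum>i<r. E i v) \<noteq> v"
  let ?w = "v - (\<Sum>i<r. E i v)"
  define C where "C = {w \<in> W. \<forall>i<r. \<forall>p<deg i. \<forall>q<deg i. T i p q w = 0}"
  have sumW: "(\<Sum>i<r. E i v) \<in> W" using v by (intro fs.subspace_sum subspace E_closed)
  have T0: "T i p q ?w = 0" if "i < r" "p < deg i" "q < deg i" for i p q
  proof -
    have "T i p q (\<Sum>j<r. E j v) = (\<Sum>j<r. \<Sum>a<deg j. T i p q (T j a a v))"
    proof -
      have "T i p q (\<Sum>j<r. E j v) = (\<Sum>j<r. T i p q (E j v))"
        by (rule linear_on_sum[OF T_linear subspace E_closed[OF v]])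
      also have "\<dots> = (\<Sum>j<r. \<Sum>a<deg j. T i p q (T j a a v))"
        unfolding E_eq by (intro sum.cong refl linear_on_sum[OF T_linear subspace T_closed[OF v]])
      finally show ?thesis .
    qed
    also have "\<dots> = (\<Sum>j<r. if j = i then T i p q v else 0)"
    proof (rule sum.cong[OF refl])
      fix j assume j: "j \<in> {..<r}"
      have "(\<Sum>a<deg j. T i p q (T j a a v)) = (\<Sum>a<deg j. if a = p then (if i = j then T i a q v else 0) else 0)"
        using j that v by (intro sum.cong refl) (simp add: T_T)
      also have "\<dots> = (if j = i then T i p q v else 0)" using that by auto
      finally show "(\<Sum>a<deg j. T i p q (T j a a v)) = (if j = i then T i p q v else 0)" .
    qed
    also have "\<dots> = T i p q v" using that by simp
    finally show ?thesis using linear_on_diff[OF T_linear subspace v sumW] by simp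
  qed
  have "?w \<in> W" using v sumW by (rule fs.subspace_diff[OF subspace])
  then have wC: "?w \<in> C" using T0 unfolding C_def by blast
  have w0: "?w \<noteq> 0" using ne by (metis right_minus_eq)
  have Cs: "fs.subspace C"
  proof (rule fs.subspaceI)
    show "0 \<in> C" unfolding C_def using fs.subspace_0[OF subspace] linear_on_0[OF T_linear subspace] by blast
    show "x + y \<in> C" if "x \<in> C" "y \<in> C" for x y
      using that fs.subspace_add[OF subspace] T_linear unfolding C_def linear_on_def by simp
    show "pscale c x \<in> C" if "x \<in> C" for c x
      using that fs.subspace_scale[OF subspace] T_linear unfolding C_def linear_on_def by simp
  qed
  have Cinv: "\<rho> g x \<in> C" if "g \<in> carrier G" "x \<in> C" for g x
  proof -
    have xW: "x \<in> W" and x0: "\<And>i p q. i < r \<Longrightarrow> p < deg i \<Longrightarrow> q < deg i \<Longrightarrow> T i p q x = 0"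
      using that(2) unfolding C_def by auto
    have "T i p q (\<rho> g x) = 0" if "i < r" "p < deg i" "q < deg i" for i p q
      unfolding T_rho[OF that(1) \<open>g \<in> carrier G\<close> xW that(2,3)]
      using x0[OF that(1) _ that(3)] by (intro sum.neutral ballI) simp
    then show ?thesis using closed[OF that(1) xW] unfolding C_def by blast
  qed
  have CW: "C \<subseteq> W" unfolding C_def by blast
  obtain d \<psi> U where U: "irreducible_rep G d \<psi>" "U \<subseteq> C" "equivalent_to G \<rho> U d \<psi>"
    by (rule irreducible_subrep_exists[OF Cs CW Cinv wC w0])
  obtain i where i: "i < r" "equivalent_reps G (deg i) (\<phi> i) d \<psi>"
    using irreducibles U(1) unfolding distinct_irreducibles_def by blast
  have Ui: "equivalent_to G \<rho> U (deg i) (\<phi> i)"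
    by (rule equivalent_to_change_matrices[OF i(2) mrep[OF i(1)] irreducible_repD(1)[OF U(1)] U(3)])
  have "u = 0" if u: "u \<in> U" for u
  proof -
    have "u = E i u" using E_fixes_copy[OF i(1) _ Ui u] U(2) CW by simp
    also have "\<dots> = 0" unfolding E_eq
    proof (rule sum.neutral, rule ballI)
      fix p assume "p \<in> {..<deg i}"
      then show "T i p p u = 0" using u U(2) i(1) unfolding C_def by blast
    qed
    finally show ?thesis .
  qed
  \<comment> \<open>But \<open>U\<close> is in bijection with a coordinate space of positive dimension.\<close>
  then have Usub: "U \<subseteq> {0}" by blast
  obtain f :: "complex Matrix.vec \<Rightarrow> 'x \<Rightarrow> complex" where "bij_betw f (carrier_vec d) U" using U(3) unfolding equivalent_to_def by (elim exE conjE)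
  then have inj: "inj_on f (carrier_vec d)" and im: "f ` carrier_vec d = U" unfolding bij_betw_def by auto
  have d: "0 < d" by (rule irreducible_repD(2)[OF U(1)])
  have "f (unit_vec d 0) = f (0\<^sub>v d)"
  proof -
    have "f x = 0" if "x \<in> carrier_vec d" for x
      using imageI[OF that, of f] Usub unfolding im by (metis subsetD singletonD)
    then show ?thesis by simp
  qed
  then have "unit_vec d 0 = (0\<^sub>v d :: complex Matrix.vec)" by (rule inj_onD[OF inj]) simp_all
  then have "vec_index (unit_vec d 0 :: complex Matrix.vec) 0 = vec_index (0\<^sub>v d) 0" by simp
  then show False using d by simp
qed

text \<open>
  Any nonzero vector \<open>P\<^sup>i\<^sub>p\<^sub>p v\<close> lies in a copy of \<open>\<phi> i\<close>, spanned by the vectors \<open>P\<^sup>i\<^sub>p\<^sub>t v\<close>. These are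
  independent because \<open>P\<^sup>i\<^sub>t\<^sub>p\<close> maps a linear combination of them to its \<open>t\<close>-th coefficient times
  \<open>P\<^sup>i\<^sub>p\<^sub>p v\<close>.
\<close>

lemma T_copy:
  assumes i: "i < r" and p: "p < deg i" and v: "v \<in> W" and nz: "T i p p v \<noteq> 0"
  obtains U where "U \<subseteq> W" "equivalent_to G \<rho> U (deg i) (\<phi> i)" "T i p p v \<in> U"
proof -
  let ?d = "deg i"
  note \<phi>D = matrix_repD[OF mrep[OF i]]
  define f where "f x = (\<Sum>t<?d. pscale (vec_index x t) (T i p t v))" for x
  have f_W: "f x \<in> W" for x
    unfolding f_def by (intro fs.subspace_sum fs.subspace_scale subspace T_closed v)
  have f_add: "f (x + y) = f x + f y" if "x \<in> carrier_vec ?d" "y \<in> carrier_vec ?d" for x y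
  proof -
    have "f (x + y) = (\<Sum>t<?d. pscale (vec_index x t) (T i p t v) + pscale (vec_index y t) (T i p t v))"
      unfolding f_def using that by (intro sum.cong refl) (simp add: fs.scale_left_distrib)
    then show ?thesis by (simp only: sum.distrib f_def)
  qed
  have f_scale: "f (z \<cdot>\<^sub>v x) = pscale z (f x)" if "x \<in> carrier_vec ?d" for x z
    unfolding f_def fs.scale_sum_right using that by (intro sum.cong refl) simp
  have f_act: "f (\<phi> i g *\<^sub>v x) = \<rho> g (f x)" if g: "g \<in> carrier G" and x: "x \<in> carrier_vec ?d" for g x
  proof -
    have "f (\<phi> i g *\<^sub>v x) = (\<Sum>t<?d. pscale (\<Sum>b<?d. vec_index x b * \<phi> i g $$ (t, b)) (T i p t v))"
      unfolding f_def using x \<phi>D(1)[OF g]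
      by (intro sum.cong refl) (simp add: scalar_prod_def atLeast0LessThan mult.commute)
    also have "\<dots> = (\<Sum>b<?d. pscale (vec_index x b) (\<Sum>t<?d. pscale (\<phi> i g $$ (t, b)) (T i p t v)))"
      unfolding fs.scale_sum_left fs.scale_sum_right fs.scale_scale by (rule sum.swap)
    also have "\<dots> = (\<Sum>b<?d. pscale (vec_index x b) (\<rho> g (T i p b v)))"
      by (intro sum.cong refl) (simp add: rho_transfer[OF mrep[OF i] g v p])
    also have "\<dots> = \<rho> g (f x)"
      unfolding f_def by (rule linear_on_sum_scale[OF linear[OF g] subspace T_closed[OF v], symmetric])
    finally show ?thesis .
  qed
  have coord: "T i t p (f x) = pscale (vec_index x t) (T i p p v)" if t: "t < ?d" for t x
  proof -
    have "T i t p (f x) = (\<Sum>s<?d. pscale (vec_index x s) (T i t p (T i p s v)))"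
      unfolding f_def by (rule linear_on_sum_scale[OF T_linear subspace T_closed[OF v]])
    also have "\<dots> = (\<Sum>s<?d. if s = t then pscale (vec_index x t) (T i p p v) else 0)"
      using i p t v by (intro sum.cong refl) (auto simp: T_T)
    also have "\<dots> = pscale (vec_index x t) (T i p p v)" using t by simp
    finally show ?thesis .
  qed
  have "x = y" if "x \<in> carrier_vec ?d" "y \<in> carrier_vec ?d" "f x = f y" for x y
  proof (rule eq_vecI)
    fix t assume "t < dim_vec y"
    then have "t < ?d" using that(2) by simp
    then have "pscale (vec_index x t) (T i p p v) = pscale (vec_index y t) (T i p p v)"
      unfolding coord[OF \<open>t < ?d\<close>, symmetric] that(3) by simp
    then show "vec_index x t = vec_index y t" unfolding fs.scale_cancel_right using nz by simp
  qed (use that in simp)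
  then have "bij_betw f (carrier_vec ?d) (f ` carrier_vec ?d)"
    by (intro inj_on_imp_bij_betw inj_onI)
  then have "equivalent_to G \<rho> (f ` carrier_vec ?d) ?d (\<phi> i)"
    unfolding equivalent_to_def using f_add f_scale f_act by blast
  moreover have "f (unit_vec ?d p) = (\<Sum>t<?d. if t = p then T i p p v else 0)"
    unfolding f_def using p by (intro sum.cong refl) auto
  then have "T i p p v = f (unit_vec ?d p)" using p by simp
  then have "T i p p v \<in> f ` carrier_vec ?d" by (rule image_eqI) simp
  ultimately show thesis using f_W by (intro that[of "f ` carrier_vec ?d"]) auto
qed

lemma isotypic_component_eq:
  assumes i: "i < r"
  shows "isotypic_component G \<rho> W (deg i) (\<phi> i) = E i ` W"
proof
  let ?S = "\<Union>{U. U \<subseteq> W \<and> equivalent_to G \<rho> U (deg i) (\<phi> i)}"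
  show "isotypic_component G \<rho> W (deg i) (\<phi> i) \<subseteq> E i ` W"
    unfolding isotypic_component_def
  proof (rule fs.span_minimal[OF _ E_subspace], rule subsetI)
    fix u assume "u \<in> ?S"
    then obtain U where U: "U \<subseteq> W" "equivalent_to G \<rho> U (deg i) (\<phi> i)" "u \<in> U" by blast
    have "u = E i u" using E_fixes_copy[OF i U] by simp
    moreover have "u \<in> W" using U by blast
    ultimately show "u \<in> E i ` W" by (rule image_eqI)
  qed
  show "E i ` W \<subseteq> isotypic_component G \<rho> W (deg i) (\<phi> i)"
    unfolding isotypic_component_def
  proof (rule image_subsetI)
    fix v assume v: "v \<in> W"
    have "T i p p v \<in> fs.span ?S" if p: "p < deg i" for p
    proof (cases "T i p p v = 0")
      case True
      then show ?thesis by (simp only: fs.span_zero)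
    next
      case False
      obtain U where "U \<subseteq> W" "equivalent_to G \<rho> U (deg i) (\<phi> i)" "T i p p v \<in> U"
        by (rule T_copy[OF i p v False])
      then have "T i p p v \<in> ?S" by blast
      then show ?thesis by (rule fs.span_base)
    qed
    then show "E i v \<in> fs.span ?S"
      unfolding E_eq by (intro fs.span_sum) simp
  qed
qed

lemma E_component:
  assumes v: "\<And>j. j < r \<Longrightarrow> v j \<in> E j ` W" and i: "i < r"
  shows "E i (\<Sum>j<r. v j) = v i"
proof -
  have "E i (\<Sum>j<r. v j) = (\<Sum>j<r. E i (v j))"
    using v E_subset by (intro linear_on_sum[OF E_linear subspace]) blast
  also have "\<dots> = (\<Sum>j<r. if j = i then v i else 0)"
  proof (rule sum.cong[OF refl])
    fix j assume "j \<in> {..<r}"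
    then have j: "j < r" by simp
    obtain y where y: "v j = E j y" "y \<in> W" using v[OF j] by (rule imageE)
    show "E i (v j) = (if j = i then v i else 0)" using E_E[OF y(2) i j] y(1) by auto
  qed
  also have "\<dots> = v i" using i by simp
  finally show ?thesis .
qed

lemma direct_sum_E: "direct_sum W r (\<lambda>i. E i ` W)"
  unfolding direct_sum_def
proof (intro conjI allI impI ballI)
  fix x assume x: "x \<in> W"
  show "\<exists>!v. v \<in> Pi\<^sub>E {..<r} (\<lambda>i. E i ` W) \<and> x = (\<Sum>i<r. v i)"
  proof (rule ex1I[of _ "restrict (\<lambda>i. E i x) {..<r}"])
    show "restrict (\<lambda>i. E i x) {..<r} \<in> Pi\<^sub>E {..<r} (\<lambda>i. E i ` W) \<and>
      x = (\<Sum>i<r. restrict (\<lambda>i. E i x) {..<r} i)"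
      using x sum_E[OF x] by auto
    fix v assume v: "v \<in> Pi\<^sub>E {..<r} (\<lambda>i. E i ` W) \<and> x = (\<Sum>i<r. v i)"
    show "v = restrict (\<lambda>i. E i x) {..<r}"
    proof (rule extensionalityI[of _ "{..<r}"])
      fix i assume "i \<in> {..<r}"
      then have i: "i < r" by simp
      have "v j \<in> E j ` W" if "j < r" for j using v that by (auto dest: PiE_mem)
      from E_component[OF this i] have "E i x = v i" using v by simp
      then show "v i = restrict (\<lambda>i. E i x) {..<r} i" using i by simp
    qed (use v in \<open>auto simp: PiE_def\<close>)
  qed
qed (use E_subspace E_closed in auto)

text \<open>
  Each \<open>U j\<close> is generated by copies of \<open>\<phi> j\<close> in \<open>W\<close>, hence contained in the \<open>j\<close>-th component. The
  components are independent, so a vector of the \<open>i\<close>-th one equals its summand in \<open>U i\<close>.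
\<close>

lemma direct_sum_unique:
  assumes U: "direct_sum W r U" and iso: "\<And>i. i < r \<Longrightarrow> U i = isotypic_component G \<rho> (U i) (deg i) (\<phi> i)"
    and i: "i < r"
  shows "U i = E i ` W"
proof
  have UE: "U j \<subseteq> E j ` W" if j: "j < r" for j
  proof -
    have "U j \<subseteq> W" using U j unfolding direct_sum_def by blast
    then have "\<Union>{V. V \<subseteq> U j \<and> equivalent_to G \<rho> V (deg j) (\<phi> j)} \<subseteq>
      \<Union>{V. V \<subseteq> W \<and> equivalent_to G \<rho> V (deg j) (\<phi> j)}" by blast
    then have "isotypic_component G \<rho> (U j) (deg j) (\<phi> j) \<subseteq> isotypic_component G \<rho> W (deg j) (\<phi> j)"
      unfolding isotypic_component_def by (rule fs.span_mono)
    then show ?thesis using iso[OF j] isotypic_component_eq[OF j] by simp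
  qed
  then show "U i \<subseteq> E i ` W" using i .
  show "E i ` W \<subseteq> U i"
  proof
    fix x assume x: "x \<in> E i ` W"
    then have xW: "x \<in> W" using E_subset by blast
    then obtain v where v: "v \<in> Pi\<^sub>E {..<r} U" "x = (\<Sum>j<r. v j)" using U unfolding direct_sum_def by blast
    have "v j \<in> E j ` W" if "j < r" for j using v(1) UE[OF that] that by (auto dest: PiE_mem)
    from E_component[OF this i] have "E i x = v i" unfolding v(2) .
    then have "x = v i" using E_image_fixed[OF i x] by simp
    then show "x \<in> U i" using v(1) i by (auto dest: PiE_mem)
  qed
qed

text \<open>
  \<open>P\<^sup>i\<^sub>0\<^sub>m\<close> maps the image of \<open>P\<^sup>i\<^sub>0\<^sub>0\<close> onto that of \<open>P\<^sup>i\<^sub>m\<^sub>m\<close> with inverse \<open>P\<^sup>i\<^sub>m\<^sub>0\<close>, and the \<open>P\<^sup>i\<^sub>m\<^sub>m\<close> are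
  orthogonal projections with sum \<open>\<Pi>\<^sub>i\<close>. The first block of the list fits this pattern because
  \<open>P\<^sup>i\<^sub>0\<^sub>0\<close> fixes its own image.
\<close>

lemma adapted_part_basis:
  assumes i: "i < r" and v1: "ordered_basis (T i 0 0 ` W) v1"
  shows "ordered_basis (E i ` W) (adapted_part G \<rho> (deg i) (\<phi> i) v1)"
proof -
  let ?d = "deg i"
  have d: "0 < ?d" using deg_pos[OF i] .
  have fixed: "T i 0 0 v = v" if "v \<in> T i 0 0 ` W" for v
    using that T_T[OF _ i i d d d d] by auto
  have sub: "T i 0 0 ` W \<subseteq> W" using T_closed by auto
  have "map (T i 0 0) v1 = v1"
    using fixed ordered_basis_subset[OF v1] by (intro map_idI) blast
  then have eq: "adapted_part G \<rho> ?d (\<phi> i) v1 = concat (map (\<lambda>m. map (T i 0 m) v1) [0..<?d])"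
    unfolding adapted_part_def using d by (simp add: upt_conv_Cons)
  have part: "ordered_basis (T i m m ` (E i ` W)) (map (T i 0 m) v1)" if m: "m < ?d" for m
  proof -
    have "T i 0 m ` (T i 0 0 ` W) = T i m m ` (E i ` W)"
    proof (rule subset_antisym; rule subsetI)
      fix x assume "x \<in> T i 0 m ` (T i 0 0 ` W)"
      then obtain v where v: "v \<in> W" "x = T i 0 m (T i 0 0 v)" by blast
      have "x = T i 0 m v" using v T_T[OF v(1) i i d m d d] by simp
      also have "\<dots> = T i m m (T i 0 m v)" using T_T[OF v(1) i i m m d m] by simp
      also have "T i 0 m v = E i (T i 0 m v)" using E_T[OF v(1) i i d m] by simp
      finally show "x \<in> T i m m ` (E i ` W)" using T_closed[OF v(1)] by (simp only: imageI)
    next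
      fix x assume "x \<in> T i m m ` (E i ` W)"
      then obtain v where v: "v \<in> W" "x = T i m m (E i v)" by blast
      let ?y = "T i m 0 (E i v)"
      have Ev: "E i v \<in> W" using E_closed[OF v(1)] .
      have "T i 0 m (T i 0 0 ?y) = T i 0 m ?y" using T_T[OF T_closed[OF Ev] i i d m d d] by simp
      also have "\<dots> = x" unfolding v(2) using T_T[OF Ev i i d m m d] by simp
      finally show "x \<in> T i 0 m ` (T i 0 0 ` W)" using T_closed[OF Ev] by (metis imageI)
    qed
    moreover have "inj_on (T i 0 m) (T i 0 0 ` W)"
    proof (rule inj_on_inverseI[of _ "T i m 0"])
      fix v assume v: "v \<in> T i 0 0 ` W"
      then show "T i m 0 (T i 0 m v) = v" using T_T[of v i i m 0 0 m] sub fixed[OF v] i m d by auto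
    qed
    ultimately show ?thesis
      using ordered_basis_map[OF v1 linear_on_subset[OF T_linear sub], of i 0 m] by simp
  qed
  show ?thesis unfolding eq
  proof (rule ordered_basis_concat[where E = "\<lambda>m. T i m m"])
    show "fs.subspace (E i ` W)" by (rule E_subspace)
    show "linear_on (E i ` W) (T i j j)" for j by (rule linear_on_subset[OF T_linear E_subset])
    show "T i j j v \<in> E i ` W" if "j < ?d" "v \<in> E i ` W" for j v
    proof -
      have "v \<in> W" using that(2) E_subset by blast
      then have "T i j j v = E i (T i j j v)" "T i j j v \<in> W" using E_T[OF _ i i that(1) that(1)] T_closed by simp_all
      then show ?thesis by (rule image_eqI)
    qed
    show "T i j j (T i l l v) = (if j = l then T i l l v else 0)" if "j < ?d" "l < ?d" "v \<in> E i ` W" for j l v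
    proof -
      have "v \<in> W" using that(3) E_subset by blast
      then show ?thesis using T_T[OF _ i i that(1,1,2,2)] by simp
    qed
    show "(\<Sum>j<?d. T i j j v) = v" if "v \<in> E i ` W" for v
      using E_image_fixed[OF i that] unfolding E_eq .
  qed (rule part)
qed

lemma adapted_basis:
  assumes "\<And>i. i < r \<Longrightarrow> ordered_basis (T i 0 0 ` W) (v1 i)"
  shows "ordered_basis W (concat (map (\<lambda>i. adapted_part G \<rho> (deg i) (\<phi> i) (v1 i)) [0..<r]))"
proof (rule ordered_basis_concat[where E = E])
  show "E j (E l v) = (if j = l then E l v else 0)" if "j < r" "l < r" "v \<in> W" for j l v
    using E_E[OF that(3,1,2)] by auto
qed (simp_all add: subspace E_linear E_closed adapted_part_basis assms sum_E)

end

lemma equivariant_weighted_sum: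
  assumes rep: "finite_group_rep G W \<rho>"
    and P: "linear_on W P" and comm: "\<And>g v. g \<in> carrier G \<Longrightarrow> v \<in> W \<Longrightarrow> P (\<rho> g v) = \<rho>' g (P v)"
    and v: "v \<in> W"
  shows "P (weighted_sum G d f \<rho> v) = weighted_sum G d f \<rho>' (P v)"
proof -
  interpret A: finite_group_rep G W \<rho> by fact
  have in_W: "(\<Sum>g\<in>carrier G. pscale (f (inv\<^bsub>G\<^esub> g)) (\<rho> g v)) \<in> W"
    by (intro fs.subspace_sum fs.subspace_scale A.subspace A.closed v)
  have "P (\<Sum>g\<in>carrier G. pscale (f (inv\<^bsub>G\<^esub> g)) (\<rho> g v)) =
    (\<Sum>g\<in>carrier G. pscale (f (inv\<^bsub>G\<^esub> g)) (P (\<rho> g v)))"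
    by (intro linear_on_sum_scale[OF P A.subspace] A.closed v)
  also have "\<dots> = (\<Sum>g\<in>carrier G. pscale (f (inv\<^bsub>G\<^esub> g)) (\<rho>' g (P v)))"
    by (intro sum.cong refl) (simp add: comm v)
  finally show ?thesis using P in_W unfolding weighted_sum_def linear_on_def by simp
qed

section \<open>Isometries and circumcentric dual volumes\<close>

definition simplicial_isometry :: "'a::euclidean_space set set \<Rightarrow> ('a \<Rightarrow> 'a) \<Rightarrow> bool"
  where "simplicial_isometry K h \<longleftrightarrow>
    (\<forall>x y. dist (h x) (h y) = dist x y) \<and> bij_betw (\<lambda>S. h ` S) K K"

context
  fixes h :: "'a::euclidean_space \<Rightarrow> 'a"
  assumes isometry: "\<forall>x y. dist (h x) (h y) = dist x y"
begin

text \<open>Hence \<open>h\<close> is affine. This is why it respects hulls, segments, extreme points and simplices below.\<close>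

lemma isometry_orthogonal: "orthogonal_transformation (\<lambda>x. h x - h 0)"
  unfolding orthogonal_transformation_isometry using isometry by (simp add: dist_norm)

lemma isometry_affine:
  obtains c L where "h = (\<lambda>x. c + L x)" "orthogonal_transformation L"
  using isometry_orthogonal by (intro that[of "h 0" "\<lambda>x. h x - h 0"]) auto

lemma isometry_inj: "inj h"
  using isometry by (metis dist_eq_0_iff injI)

lemma isometry_bij: "bij h"
proof -
  obtain c L where h: "h = (\<lambda>x. c + L x)" and L: "orthogonal_transformation L" by (rule isometry_affine)
  have "surj h"
  proof (rule surjI[of _ "\<lambda>y. inv_into UNIV L (y - c)"])
    show "h (inv_into UNIV L (y - c)) = y" for y
      unfolding h using surj_f_inv_f[OF orthogonal_transformation_surj[OF L]] by simp
  qed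
  then show ?thesis using isometry_inj by (simp add: bij_def)
qed

lemma isometry_hulls:
  "affine hull (h ` S) = h ` (affine hull S)" (is ?A)
  "convex hull (h ` S) = h ` (convex hull S)" (is ?B)
  "closed_segment (h a) (h b) = h ` closed_segment a b" (is ?C)
  "open_segment (h a) (h b) = h ` open_segment a b" (is ?D)
  "aff_dim (h ` S) = aff_dim S" (is ?E)
proof -
  obtain c L where h: "h = (\<lambda>x. c + L x)" and L: "orthogonal_transformation L" by (rule isometry_affine)
  have lin: "linear L" and inj: "inj L" using L orthogonal_transformation_linear orthogonal_transformation_inj by auto
  have im: "h ` X = (\<lambda>x. c + x) ` (L ` X)" for X unfolding h by (simp add: image_image)
  show ?A unfolding im affine_hull_translation
    using affine_hull_linear_image[of L S] lin by (simp add: linear_conv_bounded_linear)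
  show ?B unfolding im convex_hull_translation by (simp add: convex_hull_linear_image[OF lin])
  show ?C unfolding im unfolding h by (simp add: closed_segment_translation closed_segment_linear_image[OF lin])
  show ?D unfolding im unfolding h by (simp add: open_segment_translation open_segment_linear_image[OF lin inj])
  show ?E unfolding im using aff_dim_translation_eq[of c "L ` S"] lin inj by simp
qed

lemma isometry_vertices: "vertices_of (h ` S) = h ` vertices_of S"
proof -
  have ext: "h x extreme_point_of (h ` S) \<longleftrightarrow> x extreme_point_of S" for x
    unfolding extreme_point_of_def by (simp add: isometry_hulls inj_image_mem_iff[OF isometry_inj])
  have "x \<in> h ` S" if "x extreme_point_of (h ` S)" for x
    using that unfolding extreme_point_of_def by blast
  with ext show ?thesis unfolding vertices_of_def by blast
qed

lemma isometry_simplex: "n simplex S \<Longrightarrow> n simplex (h ` S)"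
proof -
  assume "n simplex S"
  then obtain C where C: "\<not> affine_dependent C" "int (card C) = n + 1" "S = convex hull C"
    unfolding simplex_def by blast
  have "card (h ` C) = card C" by (intro card_image inj_on_subset[OF isometry_inj]) simp
  then have "\<not> affine_dependent (h ` C)" "int (card (h ` C)) = n + 1"
    using C(1,2) by (auto simp: affine_independent_iff_card isometry_hulls)
  then show ?thesis unfolding simplex_def C(3) isometry_hulls(2)[symmetric] by blast
qed

lemma isometry_orderings: "vs \<in> orderings S \<Longrightarrow> map h vs \<in> orderings (h ` S)"
  unfolding orderings_def by (auto simp: isometry_vertices distinct_map intro: inj_on_subset[OF isometry_inj])

end

lemma isometry_inverse:
  fixes h :: "'a::euclidean_space \<Rightarrow> 'a"
  assumes "\<forall>x y. dist (h x) (h y) = dist x y"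
  shows "\<forall>x y. dist (inv_into UNIV h x) (inv_into UNIV h y) = dist x y"
  using assms surj_f_inv_f[OF bij_is_surj[OF isometry_bij[OF assms]]] by metis

lemma simplicial_isometryD:
  assumes "simplicial_isometry K h"
  shows "\<forall>x y. dist (h x) (h y) = dist x y" "bij_betw (\<lambda>S. h ` S) K K" "S \<in> K \<Longrightarrow> h ` S \<in> K"
  using assms unfolding simplicial_isometry_def bij_betw_def by auto

lemma simplicial_isometry_inverse:
  assumes h: "simplicial_isometry K h"
  shows "simplicial_isometry K (inv_into UNIV h)"
proof -
  note iso = simplicial_isometryD(1)[OF h]
  note bij = isometry_bij[OF iso]
  have 1: "inv_into UNIV h ` (h ` S) = S" for S using bij by (simp add: bij_is_inj image_inv_f_f)
  have 2: "h ` (inv_into UNIV h ` S) = S" for S using bij by (simp add: bij_is_surj image_f_inv_f)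
  have "inv_into UNIV h ` S \<in> K" if "S \<in> K" for S
  proof -
    obtain S' where "S' \<in> K" "S = h ` S'"
      using simplicial_isometryD(2)[OF h] \<open>S \<in> K\<close> unfolding bij_betw_def by blast
    then show ?thesis using 1 by simp
  qed
  then have "bij_betw (\<lambda>S. inv_into UNIV h ` S) K K"
    using simplicial_isometryD(3)[OF h] 1 2 by (intro bij_betwI[where g = "\<lambda>S. h ` S"]) auto
  then show ?thesis using isometry_inverse[OF iso] unfolding simplicial_isometry_def by blast
qed

lemma simplex_vertices:
  assumes "k simplex S"
  shows "\<not> affine_dependent (vertices_of S)" "finite (vertices_of S)"
    "int (card (vertices_of S)) = k + 1" "S = convex hull (vertices_of S)"
proof -
  obtain C where C: "\<not> affine_dependent C" "int (card C) = k + 1" "S = convex hull C"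
    using assms unfolding simplex_def by blast
  have "vertices_of S = C"
    unfolding vertices_of_def C(3) by (simp add: extreme_point_of_convex_hull_affine_independent[OF C(1)])
  then show "\<not> affine_dependent (vertices_of S)" "finite (vertices_of S)"
    "int (card (vertices_of S)) = k + 1" "S = convex hull (vertices_of S)"
    using C aff_independent_finite by auto
qed

text \<open>
  Move a vertex \<open>v0\<close> to the origin and let \<open>B\<close> be the set of the other vertices, a basis of its span. A point
  \<open>w\<close> is equidistant from all vertices iff \<open>inner b w = inner b b / 2\<close> for all \<open>b\<close> in \<open>B\<close>. These values
  define a linear functional, which is represented by a unique vector in the span of \<open>B\<close>.
\<close>

lemma circumcenter_ex1:
  assumes S: "int k simplex S"
  shows "\<exists>!c. c \<in> affine hull S \<and> (\<exists>r. \<forall>v\<in>vertices_of S. dist c v = r)"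
proof -
  let ?C = "vertices_of S"
  note C = simplex_vertices[OF S]
  have "?C \<noteq> {}" using C(3) by auto
  then obtain v0 where v0: "v0 \<in> ?C" by blast
  let ?B = "(\<lambda>x. - v0 + x) ` (?C - {v0})"
  have ind: "independent ?B" using C(1) affine_dependent_iff_dependent2[OF v0] by blast
  have hull: "affine hull S = (\<lambda>x. v0 + x) ` span ?B"
    using affine_hull_span2[OF v0] C(4) affine_hull_convex_hull by metis
  have arith: "a - c - (c - d) = a \<longleftrightarrow> c = d / 2" for a c d :: real by auto
  have equidistant: "(\<exists>r. \<forall>v\<in>?C. dist (v0 + w) v = r) \<longleftrightarrow> (\<forall>b\<in>?B. inner b w = inner b b / 2)" for w
  proof -
    have "(\<exists>r. \<forall>v\<in>?C. dist (v0 + w) v = r) \<longleftrightarrow> (\<forall>v\<in>?C. dist (v0 + w) v = dist (v0 + w) v0)"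
      using v0 by auto
    also have "\<dots> \<longleftrightarrow> (\<forall>v\<in>?C - {v0}. dist (v0 + w) v = dist (v0 + w) v0)" by auto
    also have "\<dots> \<longleftrightarrow> (\<forall>v\<in>?C - {v0}. inner (- v0 + v) w = inner (- v0 + v) (- v0 + v) / 2)"
    proof (rule ball_cong[OF refl])
      fix v
      have "dist (v0 + w) v = dist (v0 + w) v0 \<longleftrightarrow> norm (w - (- v0 + v)) = norm w"
        by (simp add: dist_norm algebra_simps)
      also have "\<dots> \<longleftrightarrow> inner (w - (- v0 + v)) (w - (- v0 + v)) = inner w w"
        by (simp add: norm_eq_sqrt_inner)
      also have "\<dots> \<longleftrightarrow> inner (- v0 + v) w = inner (- v0 + v) (- v0 + v) / 2"
        unfolding inner_diff_left inner_diff_right inner_commute[of w "- v0 + v"] by (rule arith)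
      finally show "dist (v0 + w) v = dist (v0 + w) v0 \<longleftrightarrow>
        inner (- v0 + v) w = inner (- v0 + v) (- v0 + v) / 2" .
    qed
    also have "\<dots> \<longleftrightarrow> (\<forall>b\<in>?B. inner b w = inner b b / 2)" by blast
    finally show ?thesis .
  qed
  obtain g :: "'a \<Rightarrow> real" where g: "linear g" "\<forall>b\<in>?B. g b = inner b b / 2"
    using linear_independent_extend[OF ind, of "\<lambda>b. inner b b / 2"] by auto
  have adj: "inner x (adjoint g 1) = g x" for x using adjoint_works[OF g(1), of x 1] by simp
  \<comment> \<open>The vector \<open>adjoint g 1\<close> represents \<open>g\<close> on the whole space; \<open>w\<close> is its component in the span of \<open>B\<close>.\<close>
  obtain w z where w: "w \<in> span ?B" "\<And>x. x \<in> span ?B \<Longrightarrow> real_inner_class.orthogonal z x" "adjoint g 1 = w + z"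
    using orthogonal_subspace_decomp_exists[of ?B "adjoint g 1"] by metis
  have wB: "inner b w = inner b b / 2" if "b \<in> ?B" for b
  proof -
    have "real_inner_class.orthogonal z b" using w(2) span_base[OF that] by blast
    then have "inner b w = inner b (w + z)" by (simp add: inner_add_right real_inner_class.orthogonal_def inner_commute)
    also have "\<dots> = g b" using adj unfolding w(3) .
    also have "\<dots> = inner b b / 2" using g(2) that by (rule bspec)
    finally show ?thesis .
  qed
  show ?thesis
  proof (rule ex1I[of _ "v0 + w"])
    show "v0 + w \<in> affine hull S \<and> (\<exists>r. \<forall>v\<in>?C. dist (v0 + w) v = r)"
      unfolding hull equidistant using w(1) wB by blast
    fix c assume c: "c \<in> affine hull S \<and> (\<exists>r. \<forall>v\<in>?C. dist c v = r)"
    then obtain w' where w': "w' \<in> span ?B" "c = v0 + w'" unfolding hull by blast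
    have w'B: "\<forall>b\<in>?B. inner b w' = inner b b / 2" using c equidistant[of w'] w'(2) by blast
    have "real_inner_class.orthogonal (w' - w) b" if "b \<in> ?B" for b
      using wB[OF that] bspec[OF w'B that]
      unfolding real_inner_class.orthogonal_def inner_diff_left inner_commute[of w' b] inner_commute[of w b] by simp
    moreover have "w' - w \<in> span ?B" using w'(1) w(1) by (rule span_diff)
    ultimately have "real_inner_class.orthogonal (w' - w) (w' - w)" using orthogonal_to_span by blast
    then show "c = v0 + w" using w'(2) by (simp add: real_inner_class.orthogonal_def)
  qed
qed

text \<open>The image of the circumcenter has the defining property, which determines it uniquely.\<close>

lemma circumcenter_isometry:
  fixes h :: "'a::euclidean_space \<Rightarrow> 'a"
  assumes h: "\<forall>x y. dist (h x) (h y) = dist x y" and S: "int k simplex S"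
  shows "circumcenter (h ` S) = h (circumcenter S)"
proof -
  have "circumcenter S \<in> affine hull S \<and> (\<exists>r. \<forall>v\<in>vertices_of S. dist (circumcenter S) v = r)"
    unfolding circumcenter_def by (rule theI'[OF circumcenter_ex1[OF S]])
  then have "h (circumcenter S) \<in> affine hull (h ` S) \<and>
    (\<exists>r. \<forall>v\<in>vertices_of (h ` S). dist (h (circumcenter S)) v = r)"
    using h by (auto simp: isometry_hulls[OF h] isometry_vertices[OF h])
  then show ?thesis
    unfolding circumcenter_def
    by (intro the1_equality circumcenter_ex1[OF isometry_simplex[OF h S]])
qed

lemma side_sign_isometry:
  fixes h :: "'a::euclidean_space \<Rightarrow> 'a"
  assumes h: "\<forall>x y. dist (h x) (h y) = dist x y" and T: "int k simplex T"
  shows "side_sign (h ` S) (h ` T) = side_sign S T"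
proof -
  note inj = isometry_inj[OF h]
  have "(\<exists>v\<in>h ` vertices_of T - h ` vertices_of S. closed_segment (h c) v \<inter> h ` A = {}) \<longleftrightarrow>
    (\<exists>v\<in>vertices_of T - vertices_of S. closed_segment c v \<inter> A = {})" for c A
    by (simp add: image_set_diff[OF inj, symmetric] isometry_hulls(3)[OF h] image_Int[OF inj, symmetric])
  then show ?thesis
    unfolding side_sign_def circumcenter_isometry[OF h T] isometry_hulls(1)[OF h] isometry_vertices[OF h]
    by (simp add: inj_image_mem_iff[OF inj])
qed

text \<open>
  An isometry carries an orthonormal frame for \<open>X\<close> to one for \<open>h ` X\<close> with the same coordinate
  vectors. Hence the same numbers are admissible in the two definite descriptions.
\<close>

lemma volume_isometry:
  fixes h :: "'a::euclidean_space \<Rightarrow> 'a"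
  assumes h: "\<forall>x y. dist (h x) (h y) = dist x y"
  shows "volume k (h ` X) = volume k X"
proof -
  define V where "V X v \<longleftrightarrow> (\<exists>x0 b.
    (\<forall>i<k. \<forall>j<k. inner (b i) (b j) = (if i = j then 1 else 0)) \<and>
    (\<forall>x\<in>X. \<exists>y. x = x0 + (\<Sum>i<k. y i *\<^sub>R b i)) \<and>
    v = measure (Pi\<^sub>M {..<k} (\<lambda>_. lborel))
          ((\<lambda>x. restrict (\<lambda>i. inner (x - x0) (b i)) {..<k}) ` X))" for X :: "'a set" and v
  have V_image: "V (f ` Y) v" if f: "\<forall>x y. dist (f x) (f y) = dist x y" and Y: "V Y v"
    for f :: "'a \<Rightarrow> 'a" and Y v
  proof -
    obtain c L where fL: "f = (\<lambda>x. c + L x)" and L: "orthogonal_transformation L"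
      by (rule isometry_affine[OF f])
    have lin: "linear L" and inner: "inner (L x) (L y) = inner x y" for x y
      using L unfolding orthogonal_transformation_def by auto
    obtain x0 b where b: "\<forall>i<k. \<forall>j<k. inner (b i) (b j) = (if i = j then 1 else 0)"
      and span: "\<forall>x\<in>Y. \<exists>y. x = x0 + (\<Sum>i<k. y i *\<^sub>R b i)"
      and v: "v = measure (Pi\<^sub>M {..<k} (\<lambda>_. lborel))
          ((\<lambda>x. restrict (\<lambda>i. inner (x - x0) (b i)) {..<k}) ` Y)"
      using Y unfolding V_def by blast
    have "\<exists>y. f x = f x0 + (\<Sum>i<k. y i *\<^sub>R L (b i))" if x: "x \<in> Y" for x
    proof -
      obtain y where "x = x0 + (\<Sum>i<k. y i *\<^sub>R b i)" using span x by blast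
      then have "f x = f x0 + (\<Sum>i<k. y i *\<^sub>R L (b i))"
        by (simp add: fL linear_add[OF lin] linear_sum[OF lin] linear_scale[OF lin])
      then show ?thesis by (intro exI[of _ y])
    qed
    moreover have "inner (f x - f x0) (L y) = inner (x - x0) y" for x y
      unfolding fL by (simp add: linear_diff[OF lin, symmetric] inner)
    then have "(\<lambda>x. restrict (\<lambda>i. inner (x - f x0) (L (b i))) {..<k}) ` (f ` Y) =
      (\<lambda>x. restrict (\<lambda>i. inner (x - x0) (b i)) {..<k}) ` Y"
      unfolding image_image by simp
    ultimately show ?thesis
      unfolding V_def using b v inner by (intro exI[of _ "f x0"] exI[of _ "\<lambda>i. L (b i)"]) auto
  qed
  have "inv_into UNIV h ` (h ` X) = X" using isometry_inj[OF h] by (simp add: image_inv_f_f)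
  then have "V (h ` X) v \<longleftrightarrow> V X v" for v
    using V_image[OF h, of X v] V_image[OF isometry_inverse[OF h], of "h ` X" v] by metis
  then have "V (h ` X) = V X" by (intro ext)
  moreover have "volume k Y = (THE v. V Y v)" for Y :: "'a set" unfolding volume_def V_def ..
  ultimately show ?thesis by simp
qed

lemma flags_isometry:
  assumes h: "simplicial_isometry K h"
  shows "map ((`) h) ` flags K n k S \<subseteq> flags K n k (h ` S)"
proof clarify
  fix Ss assume "Ss \<in> flags K n k S"
  then show "map ((`) h) Ss \<in> flags K n k (h ` S)"
    unfolding flags_def
    using simplicial_isometryD(3)[OF h] isometry_simplex[OF simplicial_isometryD(1)[OF h]]
    by (auto intro!: image_mono)
qed

text \<open>
  Flags are carried to flags bijectively, with the same sign and the same volume of the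
  elementary simplex.
\<close>

lemma dual_volume_isometry:
  assumes h: "simplicial_isometry K h"
  shows "dual_volume K n k (h ` S) = dual_volume K n k S"
proof -
  note iso = simplicial_isometryD(1)[OF h]
  note bij = isometry_bij[OF iso]
  have 1: "inv_into UNIV h ` (h ` S) = S" for S using bij by (simp add: bij_is_inj image_inv_f_f)
  have 2: "h ` (inv_into UNIV h ` S) = S" for S using bij by (simp add: bij_is_surj image_f_inv_f)
  have "bij_betw (map ((`) h)) (flags K n k S) (flags K n k (h ` S))"
  proof (rule bij_betwI[where g = "map ((`) (inv_into UNIV h))"])
    show "map ((`) h) \<in> flags K n k S \<rightarrow> flags K n k (h ` S)" using flags_isometry[OF h] by blast
    show "map ((`) (inv_into UNIV h)) \<in> flags K n k (h ` S) \<rightarrow> flags K n k S"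
      using flags_isometry[OF simplicial_isometry_inverse[OF h], of n k "h ` S"] 1 by auto
  qed (auto simp: 1 2 map_idI)
  then have "dual_volume K n k (h ` S) = (\<Sum>Ss\<in>flags K n k S.
    (\<Prod>i<n - k. side_sign (map ((`) h) Ss ! i) (map ((`) h) Ss ! Suc i)) *
    volume (n - k) (convex hull (circumcenter ` set (map ((`) h) Ss))))"
    unfolding dual_volume_def by (rule sum.reindex_bij_betw[symmetric])
  also have "\<dots> = dual_volume K n k S"
    unfolding dual_volume_def
  proof (rule sum.cong[OF refl])
    fix Ss assume Ss: "Ss \<in> flags K n k S"
    have len: "length Ss = Suc (n - k)" and simp: "\<And>i. i \<le> n - k \<Longrightarrow> int (k + i) simplex (Ss ! i)"
      using Ss unfolding flags_def by auto
    have "side_sign (map ((`) h) Ss ! i) (map ((`) h) Ss ! Suc i) = side_sign (Ss ! i) (Ss ! Suc i)"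
      if "i < n - k" for i
      using that len side_sign_isometry[OF iso simp[of "Suc i"]] by simp
    moreover have "circumcenter ` set (map ((`) h) Ss) = h ` (circumcenter ` set Ss)"
    proof -
      have "circumcenter (h ` T) = h (circumcenter T)" if "T \<in> set Ss" for T
      proof -
        obtain i where "i \<le> n - k" "T = Ss ! i" using \<open>T \<in> set Ss\<close> len by (metis in_set_conv_nth less_Suc_eq_le)
        then show ?thesis using circumcenter_isometry[OF iso simp[of i]] by simp
      qed
      then show ?thesis by (simp add: image_image)
    qed
    ultimately show "(\<Prod>i<n - k. side_sign (map ((`) h) Ss ! i) (map ((`) h) Ss ! Suc i)) *
      volume (n - k) (convex hull (circumcenter ` set (map ((`) h) Ss))) =
      (\<Prod>i<n - k. side_sign (Ss ! i) (Ss ! Suc i)) *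
      volume (n - k) (convex hull (circumcenter ` set Ss))"
      by (simp add: isometry_hulls(2)[OF iso] volume_isometry[OF iso])
  qed
  finally show ?thesis .
qed

section \<open>Elementary chains and the boundary\<close>

definition face :: "nat \<Rightarrow> 'a list \<Rightarrow> 'a list"
  where "face i vs = take i vs @ drop (Suc i) vs"

lemma sign_compose_permutes:
  assumes "p permutes A" "q permutes A" "finite A"
  shows "sign (p \<circ> q) = sign p * sign q"
  by (rule sign_compose) (use assms permutation_permutes in blast)+

lemma permutes_witness:
  assumes "distinct vs" "distinct ws" "set vs = set ws"
  obtains p where "p permutes {..<length vs}" "permute_list p vs = ws"
proof -
  have "mset ws = mset vs" using assms set_eq_iff_mset_eq_distinct by metis
  then show thesis by (rule mset_eq_permutation) (rule that)
qed

lemma permute_list_inj: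
  assumes vs: "distinct vs" and p: "p permutes {..<length vs}" and q: "q permutes {..<length vs}"
    and eq: "permute_list p vs = permute_list q vs"
  shows "p = q"
proof
  fix i
  show "p i = q i"
  proof (cases "i < length vs")
    case True
    then have "vs ! p i = vs ! q i" using permute_list_nth[OF p] permute_list_nth[OF q] eq by metis
    moreover have "p i < length vs" "q i < length vs"
      using permutes_in_image[OF p] permutes_in_image[OF q] True by auto
    ultimately show ?thesis using vs nth_eq_iff_index_eq by blast
  next
    case False
    then show ?thesis using permutes_not_in[OF p, of i] permutes_not_in[OF q, of i] by simp
  qed
qed

lemma elem_chain_permute:
  assumes p: "p permutes {..<length vs}"
  shows "elem_chain C (permute_list p vs) = pscale (of_int (sign p)) (elem_chain C vs)"
proof
  fix c
  have "elem_chain C (permute_list p vs) c =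
    (\<Sum>q | q permutes {..<length vs} \<and> c = C (permute_list (p \<circ> q) vs). of_int (sign q))"
    unfolding elem_chain_def length_permute_list
    by (rule sum.cong) (auto simp: permute_list_compose)
  also have "\<dots> = (\<Sum>q | q permutes {..<length vs} \<and> c = C (permute_list q vs). of_int (sign p) * of_int (sign q))"
  proof (rule sum.reindex_bij_witness[of _ "\<lambda>q. inv_into UNIV p \<circ> q" "\<lambda>q. p \<circ> q"])
    fix q assume q: "q \<in> {q. q permutes {..<length vs} \<and> c = C (permute_list (p \<circ> q) vs)}"
    then show "inv_into UNIV p \<circ> (p \<circ> q) = q" using permutes_inv_o(2)[OF p] by (simp add: o_assoc)
    show "p \<circ> q \<in> {q. q permutes {..<length vs} \<and> c = C (permute_list q vs)}"
      using q permutes_compose[OF _ p] by auto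
    have "sign p * sign (p \<circ> q) = sign q"
      using q sign_compose_permutes[OF p, of q] by simp
    then show "real_of_int (sign p) * of_int (sign (p \<circ> q)) = of_int (sign q)"
      unfolding of_int_mult[symmetric] by simp
  next
    fix q assume q: "q \<in> {q. q permutes {..<length vs} \<and> c = C (permute_list q vs)}"
    show "p \<circ> (inv_into UNIV p \<circ> q) = q" using permutes_inv_o(1)[OF p] by (simp add: o_assoc)
    then show "inv_into UNIV p \<circ> q \<in> {q. q permutes {..<length vs} \<and> c = C (permute_list (p \<circ> q) vs)}"
      using q permutes_compose[OF _ permutes_inv[OF p]] by simp
  qed
  also have "\<dots> = pscale (of_int (sign p)) (elem_chain C vs) c"
    by (simp add: pscale_def elem_chain_def sum_distrib_left)
  finally show "elem_chain C (permute_list p vs) c = pscale (of_int (sign p)) (elem_chain C vs) c" .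
qed

text \<open>A permutation \<open>q\<close> leads from \<open>vs\<close> to the permuted \<open>ws\<close> iff \<open>q \<circ> p\<^sup>-\<^sup>1\<close> leads from \<open>vs\<close> to \<open>ws\<close>.\<close>

lemma elem_chain_argument_permute:
  assumes C: "inj C" and p: "p permutes {..<length ws}"
  shows "elem_chain C vs (C (permute_list p ws)) = of_int (sign p) * elem_chain C vs (C ws)"
proof (cases "length vs = length ws")
  case False
  have no: "{q. q permutes {..<length vs} \<and> C xs = C (permute_list q vs)} = {}" if "length xs = length ws" for xs
  proof -
    have "C xs \<noteq> C (permute_list q vs)" for q
    proof
      assume "C xs = C (permute_list q vs)"
      then have "length xs = length (permute_list q vs)" using C injD by metis
      then show False using False that by simp
    qed
    then show ?thesis by blast
  qed
  show ?thesis unfolding elem_chain_def no[OF refl] no[OF length_permute_list] by simp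
next
  case True
  let ?i = "inv_into UNIV p"
  have i: "?i permutes {..<length ws}" by (rule permutes_inv[OF p])
  have i': "?i permutes {..<length vs}" and p'': "p permutes {..<length vs}" using i p True by simp_all
  have swap: "permute_list p ws = permute_list q vs \<longleftrightarrow> ws = permute_list (q \<circ> ?i) vs"
    if q: "q permutes {..<length vs}" for q
  proof -
    have 1: "permute_list ?i (permute_list p ws) = ws"
      using permute_list_compose[OF i, of p] permutes_inv_o(1)[OF p] by simp
    have 2: "permute_list ?i (permute_list q vs) = permute_list (q \<circ> ?i) vs"
      using permute_list_compose[of ?i vs q] i True by simp
    have 3: "permute_list p (permute_list (q \<circ> ?i) vs) = permute_list q vs"
      using permute_list_compose[of p vs "q \<circ> ?i"] p True permutes_inv_o(2)[OF p] by (simp add: o_assoc[symmetric])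
    show ?thesis using 1 2 3 by metis
  qed
  have "elem_chain C vs (C (permute_list p ws)) =
    (\<Sum>q | q permutes {..<length vs} \<and> ws = permute_list (q \<circ> ?i) vs. of_int (sign q))"
    unfolding elem_chain_def using swap by (intro sum.cong) (auto simp: inj_eq[OF C])
  also have "\<dots> = (\<Sum>q | q permutes {..<length vs} \<and> ws = permute_list q vs. of_int (sign p) * of_int (sign q))"
  proof (rule sum.reindex_bij_witness[of _ "\<lambda>q. q \<circ> p" "\<lambda>q. q \<circ> ?i"])
    fix q assume q: "q \<in> {q. q permutes {..<length vs} \<and> ws = permute_list (q \<circ> ?i) vs}"
    show "q \<circ> ?i \<circ> p = q" using permutes_inv_o(2)[OF p] by (simp add: o_assoc[symmetric])
    show "q \<circ> ?i \<in> {q. q permutes {..<length vs} \<and> ws = permute_list q vs}"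
      using q permutes_compose[OF i', of q] by (simp only: mem_Collect_eq)
    have "sign (q \<circ> ?i) = sign q * sign ?i"
      using q by (intro sign_compose_permutes[OF _ i']) auto
    also have "sign ?i = sign p" by (rule sign_inverse) (use p permutation_permutes in blast)
    finally have "sign (q \<circ> ?i) = sign q * sign p" .
    then have "sign p * sign (q \<circ> ?i) = sign q" by (simp add: mult.commute)
    then show "real_of_int (sign p) * of_int (sign (q \<circ> ?i)) = of_int (sign q)"
      unfolding of_int_mult[symmetric] by simp
  next
    fix q assume q: "q \<in> {q. q permutes {..<length vs} \<and> ws = permute_list q vs}"
    show 1: "q \<circ> p \<circ> ?i = q" using permutes_inv_o(1)[OF p] by (simp add: o_assoc[symmetric])
    show "q \<circ> p \<in> {q. q permutes {..<length vs} \<and> ws = permute_list (q \<circ> ?i) vs}"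
      using q permutes_compose[OF p'', of q] by (simp only: mem_Collect_eq 1)
  qed
  also have "\<dots> = of_int (sign p) * elem_chain C vs (C ws)"
    by (simp add: elem_chain_def sum_distrib_left inj_eq[OF C])
  finally show ?thesis .
qed

lemma elem_chain_self:
  assumes C: "inj C" and vs: "distinct vs"
  shows "elem_chain C vs (C vs) = 1"
proof -
  have "{q. q permutes {..<length vs} \<and> C vs = C (permute_list q vs)} = {id}"
    using permute_list_inj[OF vs _ permutes_id] by (auto simp: inj_eq[OF C] permutes_id)
  then show ?thesis unfolding elem_chain_def by simp
qed

lemma elem_chain_support:
  assumes "elem_chain C vs c \<noteq> 0"
  obtains p where "p permutes {..<length vs}" "c = C (permute_list p vs)"
  using assms unfolding elem_chain_def by (metis (mono_tags, lifting) mem_Collect_eq sum.neutral)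

lemma elem_chain_support_set:
  assumes C: "inj C" and "elem_chain C vs (C ws) \<noteq> 0"
  shows "set ws = set vs"
proof -
  obtain p where p: "p permutes {..<length vs}" "C ws = C (permute_list p vs)"
    using elem_chain_support assms(2) by blast
  then have "ws = permute_list p vs" using C by (simp add: inj_eq)
  then show ?thesis using p(1) by simp
qed

lemma elem_chain_map:
  assumes C: "inj C" and C': "inj C'" and h: "inj h"
  shows "elem_chain C (map h vs) (C (map h ws)) = elem_chain C' vs (C' ws)"
  unfolding elem_chain_def
  by (rule sum.cong) (auto simp: permute_list_map inj_eq[OF C] inj_eq[OF C'] inj_map_eq_map[OF h])

lemma elem_chain_swap: "elem_chain C (xs @ b # a # ys) = pscale (- 1) (elem_chain C (xs @ a # b # ys))"
proof -
  let ?t = "Transposition.transpose (length xs) (Suc (length xs))"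
  let ?l = "xs @ a # b # ys"
  have t: "?t permutes {..<length ?l}" by (rule permutes_swap_id) auto
  have "permute_list ?t ?l = xs @ b # a # ys"
  proof (rule nth_equalityI)
    fix i assume i: "i < length (permute_list ?t ?l)"
    then have "permute_list ?t ?l ! i = ?l ! ?t i" by (intro permute_list_nth[OF t]) simp
    then show "permute_list ?t ?l ! i = (xs @ b # a # ys) ! i"
      by (auto simp: Transposition.transpose_def nth_append nth_Cons split: nat.splits)
  qed simp
  moreover have "sign ?t = - 1" by (simp add: sign_swap_id)
  ultimately show ?thesis using elem_chain_permute[OF t, of C] by simp
qed

lemma elem_chain_move_front:
  "elem_chain C (v # xs @ ys) = pscale ((- 1) ^ length xs) (elem_chain C (xs @ v # ys))"
proof (induction xs arbitrary: ys rule: rev_induct)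
  case Nil
  then show ?case by (simp add: pscale_def)
next
  case (snoc a xs)
  have "elem_chain C (v # (xs @ [a]) @ ys) = pscale ((- 1) ^ length xs) (elem_chain C (xs @ v # a # ys))"
    using snoc.IH[of "a # ys"] by simp
  also have "\<dots> = pscale ((- 1) ^ length (xs @ [a])) (elem_chain C ((xs @ [a]) @ v # ys))"
    unfolding elem_chain_swap[of C xs v a ys] by simp
  finally show ?case .
qed

lemma elem_chain_Cons_permute:
  assumes p: "p permutes {..<length us}"
  shows "elem_chain C (v # permute_list p us) = pscale (of_int (sign p)) (elem_chain C (v # us))"
proof -
  let ?p = "map_permutation {..<length us} Suc p"
  have bij: "bij_betw Suc {..<length us} (Suc ` {..<length us})" by (simp add: bij_betw_def)
  have perm: "?p permutes Suc ` {..<length us}" by (rule map_permutation_permutes[OF bij p])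
  then have p': "?p permutes {..<length (v # us)}" by (rule permutes_subset) auto
  have "permute_list ?p (v # us) = v # permute_list p us"
  proof (rule nth_equalityI)
    fix i assume "i < length (permute_list ?p (v # us))"
    then have i: "i < Suc (length us)" by simp
    show "permute_list ?p (v # us) ! i = (v # permute_list p us) ! i"
    proof (cases i)
      case 0
      then show ?thesis using permute_list_nth[OF p', of 0] permutes_not_in[OF perm, of 0] by simp
    next
      case (Suc j)
      then have "?p i = Suc (p j)" using i by (simp add: map_permutation_apply)
      then show ?thesis using permute_list_nth[OF p', of i] permute_list_nth[OF p, of j] Suc i by simp
    qed
  qed simp
  then show ?thesis using elem_chain_permute[OF p', of C] sign_map_permutation[OF _ p, of Suc] by simp
qed

text \<open>A permutation of \<open>v # us\<close> that keeps \<open>v\<close> in front is a permutation of \<open>us\<close> with the same sign.\<close>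

lemma elem_chain_Cons:
  assumes C: "inj C" and d: "distinct (v # us)"
  shows "elem_chain C (v # us) (C (v # ws)) = elem_chain C us (C ws)"
proof (cases "\<exists>p. p permutes {..<length us} \<and> ws = permute_list p us")
  case True
  then obtain p where p: "p permutes {..<length us}" and ws: "ws = permute_list p us" by blast
  have "distinct (v # ws)" using d p unfolding ws by simp
  then have "1 = elem_chain C (v # ws) (C (v # ws))" by (rule elem_chain_self[OF C, symmetric])
  also have "\<dots> = of_int (sign p) * elem_chain C (v # us) (C (v # ws))"
    unfolding ws elem_chain_Cons_permute[OF p] by (simp add: pscale_def)
  finally have 1: "of_int (sign p) * elem_chain C (v # us) (C (v # ws)) = 1" by simp
  have 2: "elem_chain C us (C ws) = of_int (sign p)"
    unfolding ws elem_chain_argument_permute[OF C p] using elem_chain_self[OF C, of us] d by simp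
  show ?thesis using 1 unfolding 2 by (cases p rule: sign_cases) simp_all
next
  case False
  then have "elem_chain C us (C ws) = 0" using elem_chain_support C by (metis injD)
  moreover have "elem_chain C (v # us) (C (v # ws)) = 0"
  proof (rule ccontr)
    assume "elem_chain C (v # us) (C (v # ws)) \<noteq> 0"
    then obtain p where p: "p permutes {..<length (v # us)}" "C (v # ws) = C (permute_list p (v # us))"
      by (rule elem_chain_support)
    then have "v # ws = permute_list p (v # us)" using C by (simp add: inj_eq)
    then have "mset (v # ws) = mset (v # us)" using mset_permute_list[OF p(1)] by metis
    then have "mset ws = mset us" by simp
    then show False using False by (metis mset_eq_permutation)
  qed
  ultimately show ?thesis by simp
qed

lemma inj_Simp: "inj Simp" and inj_Star: "inj Star" and inj_cell_of: "inj (cell_of sd)"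
  by (auto simp: inj_def) (cases sd; simp)+

lemma bdry_face: "bdry vs = (\<Sum>i<length vs. pscale ((- 1) ^ i) (elem_chain Simp (face i vs)))"
  unfolding bdry_def face_def ..

lemma sum_fun_apply: "(\<Sum>i\<in>I. f i) x = (\<Sum>i\<in>I. f i x)"
  by (induction I rule: infinite_finite_induct) auto

text \<open>
  The coefficient of a face \<open>ws\<close> in the boundary is found by putting the missing vertex in front:
  moving the \<open>i\<close>-th vertex to the front costs the sign \<open>(- 1) ^ i\<close> of the boundary formula. The sum
  on the right does not refer to positions in \<open>vs\<close>, so it shows that the boundary is alternating.
\<close>

lemma bdry_eq_cone:
  assumes d: "distinct vs"
  shows "bdry vs (Simp ws) = (\<Sum>v\<in>set vs. elem_chain Simp vs (Simp (v # ws)))"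
proof -
  have "pscale ((- 1) ^ i) (elem_chain Simp (face i vs)) (Simp ws) = elem_chain Simp vs (Simp (vs ! i # ws))"
    if i: "i < length vs" for i
  proof -
    have vs: "vs = take i vs @ vs ! i # drop (Suc i) vs" using id_take_nth_drop[OF i] .
    have "distinct (take i vs @ vs ! i # drop (Suc i) vs)" using d vs by metis
    then have "distinct (vs ! i # face i vs)" unfolding face_def by auto
    then have "elem_chain Simp (face i vs) (Simp ws) = elem_chain Simp (vs ! i # face i vs) (Simp (vs ! i # ws))"
      using elem_chain_Cons[OF inj_Simp] by metis
    also have "\<dots> = (- 1) ^ i * elem_chain Simp vs (Simp (vs ! i # ws))"
      using elem_chain_move_front[of Simp "vs ! i" "take i vs" "drop (Suc i) vs"] i
      unfolding vs[symmetric] face_def by (simp add: pscale_def)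
    finally show ?thesis unfolding pscale_def by (simp add: power_mult_distrib[symmetric] mult.assoc[symmetric])
  qed
  then have "bdry vs (Simp ws) = (\<Sum>i<length vs. elem_chain Simp vs (Simp (vs ! i # ws)))"
    unfolding bdry_face sum_fun_apply by (intro sum.cong) auto
  also have "\<dots> = (\<Sum>v\<in>set vs. elem_chain Simp vs (Simp (v # ws)))"
    by (rule sum.reindex_bij_betw[OF bij_betw_nth[OF d refl refl]])
  finally show ?thesis .
qed

lemma bdry_Star [simp]: "bdry vs (Star ws) = 0"
proof -
  have "elem_chain Simp us (Star ws) = 0" for us unfolding elem_chain_def by simp
  then show ?thesis unfolding bdry_face sum_fun_apply by (simp add: pscale_def)
qed

lemma bdry_permute:
  assumes d: "distinct vs" and p: "p permutes {..<length vs}"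
  shows "bdry (permute_list p vs) = pscale (of_int (sign p)) (bdry vs)"
proof
  fix c
  show "bdry (permute_list p vs) c = pscale (of_int (sign p)) (bdry vs) c"
  proof (cases c)
    case (Simp ws)
    have d': "distinct (permute_list p vs)" using d p by simp
    show ?thesis unfolding Simp pscale_def bdry_eq_cone[OF d] bdry_eq_cone[OF d'] elem_chain_permute[OF p]
        set_permute_list[OF p] by (simp add: sum_distrib_left)
  qed (simp add: pscale_def)
qed

lemma incidence_permute:
  assumes "distinct vs" "p permutes {..<length vs}"
  shows "incidence (permute_list p vs) ws = of_int (sign p) * incidence vs ws"
  unfolding incidence_def bdry_permute[OF assms] by (simp add: pscale_def)

lemma incidence_argument_permute:
  assumes p: "p permutes {..<length ws}"
  shows "incidence vs (permute_list p ws) = of_int (sign p) * incidence vs ws"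
  unfolding incidence_def bdry_face sum_fun_apply pscale_def elem_chain_argument_permute[OF inj_Simp p]
  by (simp add: sum_distrib_left mult.left_commute)

lemma face_map: "face i (map h vs) = map h (face i vs)"
  by (simp add: face_def take_map drop_map)

lemma incidence_map:
  assumes h: "inj h"
  shows "incidence (map h vs) (map h ws) = incidence vs ws"
  unfolding incidence_def bdry_face sum_fun_apply pscale_def length_map face_map
  by (simp add: elem_chain_map[OF inj_Simp inj_Simp h])

section \<open>Cochains and the equivariance of the operators\<close>

lemma orderings_permute:
  "vs \<in> orderings S \<Longrightarrow> p permutes {..<length vs} \<Longrightarrow> permute_list p vs \<in> orderings S"
  by (simp add: orderings_def)

lemma orderings_related:
  assumes "vs \<in> orderings S" "ws \<in> orderings S"
  obtains p where "p permutes {..<length vs}" "permute_list p vs = ws"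
  by (rule permutes_witness[of vs ws]) (use assms that in \<open>auto simp: orderings_def\<close>)

lemma orderings_distinct: "vs \<in> orderings S \<Longrightarrow> distinct vs"
  by (simp add: orderings_def)

lemma orderings_hull: "k simplex S \<Longrightarrow> vs \<in> orderings S \<Longrightarrow> convex hull (set vs) = S"
  using simplex_vertices(4) unfolding orderings_def by auto

lemma orderings_length:
  assumes "int k simplex S" "vs \<in> orderings S"
  shows "length vs = Suc k"
  using simplex_vertices(3)[OF assms(1)] assms(2) distinct_card[of vs] unfolding orderings_def by simp

type_synonym ('a, 'f) cochain = "('a cell \<Rightarrow> real) \<Rightarrow> 'f"

text \<open>
  The condition under which \<^const>\<open>cochain_of\<close> has the values \<open>f vs\<close> for all orderings \<open>vs\<close>, and not only
  for the chosen ones (\<open>cochain_of_elem_chain\<close> below).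
\<close>

definition alternating ::
    "'a::euclidean_space set set \<Rightarrow> nat \<Rightarrow> side_degree \<Rightarrow> ('a list \<Rightarrow> 'f::real_field) \<Rightarrow> bool"
  where "alternating K n sd f \<longleftrightarrow> (\<forall>S\<in>base_simplices K n sd. \<forall>vs\<in>orderings S. \<forall>p.
    p permutes {..<length vs} \<longrightarrow> f (permute_list p vs) = of_int (sign p) *\<^sub>R f vs)"

text \<open>Precomposition with \<open>h\<close> on oriented cells, in the form in which \<^const>\<open>cochain_rep\<close> acts.\<close>

definition cochain_pullback ::
    "'a::euclidean_space set set \<Rightarrow> nat \<Rightarrow> ('a set \<Rightarrow> 'a list) \<Rightarrow> side_degree \<Rightarrow> ('a \<Rightarrow> 'a) \<Rightarrow>
     ('a, 'f::real_field) cochain \<Rightarrow> ('a, 'f) cochain"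
  where "cochain_pullback K n ori sd h \<alpha> =
    cochain_of K n ori sd (\<lambda>vs. \<alpha> (elem_chain (cell_of sd) (map h vs)))"

lemma cochain_of_linear:
  "linear_on W (\<lambda>\<alpha>. cochain_of K n ori sd (\<lambda>vs. c vs *\<^sub>R \<alpha> (y vs)))"
  unfolding linear_on_def cochain_of_def pscale_def fun_eq_iff
  by (auto simp: sum.distrib sum_distrib_left scaleR_right_distrib mult_scaleR_right)

lemma cochain_of_linear_values:
  "linear_on W (\<lambda>\<alpha>. cochain_of K n ori sd (\<lambda>vs. \<alpha> (y vs)))"
  using cochain_of_linear[of W K n ori sd "\<lambda>_. 1" y] by simp

lemma linear_on_inv_into:
  assumes W: "fs.subspace W" and f: "linear_on W f" and bij: "bij_betw f W V"
  shows "linear_on V (inv_into W f)"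
proof -
  have g: "inv_into W f x \<in> W" "f (inv_into W f x) = x" if "x \<in> V" for x
    using that bij bij_betw_inv_into_right inv_into_into[of x f W] by (auto simp: bij_betw_def f_inv_into_f)
  have eq: "inv_into W f (f w) = w" if "w \<in> W" for w
    using that bij by (simp add: bij_betw_inv_into_left)
  show ?thesis unfolding linear_on_def
  proof (intro conjI ballI allI)
    fix x y assume xy: "x \<in> V" "y \<in> V"
    have "f (inv_into W f x + inv_into W f y) = x + y"
      using f g xy unfolding linear_on_def by simp
    then show "inv_into W f (x + y) = inv_into W f x + inv_into W f y"
      using eq[OF fs.subspace_add[OF W g(1)[OF xy(1)] g(1)[OF xy(2)]]] by simp
  next
    fix z x assume x: "x \<in> V"
    have "f (pscale z (inv_into W f x)) = pscale z x"
      using f g x unfolding linear_on_def by simp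
    then show "inv_into W f (pscale z x) = pscale z (inv_into W f x)"
      using eq[OF fs.subspace_scale[OF W g(1)[OF x]], of z] by simp
  qed
qed

locale oriented_simplicial_complex =
  fixes K :: "'a::euclidean_space set set" and n :: nat and ori :: "'a set \<Rightarrow> 'a list"
  assumes oriented: "oriented_complex K n ori"
begin

abbreviation "simplices \<equiv> base_simplices K n"

abbreviation "pullback \<equiv> cochain_pullback K n ori"

lemma complex: "simplicial_complex K" and ori: "S \<in> K \<Longrightarrow> ori S \<in> orderings S"
  using oriented unfolding oriented_complex_def by auto

lemma finite_K: "finite K"
  using complex unfolding simplicial_complex_def by blast

lemma base_K: "S \<in> simplices sd \<Longrightarrow> S \<in> K"
  by (cases sd) auto

lemma base_ori: "S \<in> simplices sd \<Longrightarrow> ori S \<in> orderings S"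
  using base_K ori by blast

lemma finite_base: "finite (simplices sd)"
  using base_K finite_subset[OF _ finite_K] by blast

lemma base_simplex: "S \<in> simplices sd \<Longrightarrow> \<exists>k. int k simplex S"
  by (cases sd) auto

lemma base_hull: "S \<in> simplices sd \<Longrightarrow> vs \<in> orderings S \<Longrightarrow> convex hull (set vs) = S"
  using base_simplex orderings_hull by blast

lemma chains_subspace: "fs.subspace (chains K n sd)"
proof (rule fs.subspaceI)
  show "0 \<in> chains K n sd" by (simp add: chains_def)
  show "x + y \<in> chains K n sd" if "x \<in> chains K n sd" "y \<in> chains K n sd" for x y
  proof -
    have "\<exists>S\<in>simplices sd. \<exists>vs\<in>orderings S. c = cell_of sd vs" if "(x + y) c \<noteq> 0" for c
    proof -
      have "x c \<noteq> 0 \<or> y c \<noteq> 0" using \<open>(x + y) c \<noteq> 0\<close> by auto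
      then show ?thesis using \<open>x \<in> chains K n sd\<close> \<open>y \<in> chains K n sd\<close> unfolding chains_def by blast
    qed
    then show ?thesis
      using that unfolding chains_def by (simp add: distrib_left)
  qed
  show "pscale a x \<in> chains K n sd" if "x \<in> chains K n sd" for a x
    using that unfolding chains_def pscale_def by (simp add: mult.left_commute)
qed

lemma elem_chain_in_chains:
  assumes S: "S \<in> simplices sd" and vs: "vs \<in> orderings S"
  shows "elem_chain (cell_of sd) vs \<in> chains K n sd"
proof -
  have "\<exists>S\<in>simplices sd. \<exists>ws\<in>orderings S. c = cell_of sd ws"
    if nz: "elem_chain (cell_of sd) vs c \<noteq> 0" for c
  proof -
    obtain p where "p permutes {..<length vs}" "c = cell_of sd (permute_list p vs)"
      using nz by (rule elem_chain_support)
    then show ?thesis using S orderings_permute[OF vs] by blast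
  qed
  then show ?thesis
    unfolding chains_def by (simp add: elem_chain_argument_permute[OF inj_cell_of])
qed

lemma chainD:
  assumes "x \<in> chains K n sd"
  shows "x c \<noteq> 0 \<Longrightarrow> \<exists>S\<in>simplices sd. \<exists>vs\<in>orderings S. c = cell_of sd vs"
    "S \<in> simplices sd \<Longrightarrow> vs \<in> orderings S \<Longrightarrow> p permutes {..<length vs} \<Longrightarrow>
      x (cell_of sd (permute_list p vs)) = of_int (sign p) * x (cell_of sd vs)"
  using assms unfolding chains_def by auto

lemma elem_chain_other:
  assumes S: "S \<in> simplices sd" "vs \<in> orderings S"
    and T: "T \<in> simplices sd" "ws \<in> orderings T" and ne: "S \<noteq> T"
  shows "elem_chain (cell_of sd) vs (cell_of sd ws) = 0"
  using elem_chain_support_set[OF inj_cell_of, of sd vs ws] base_hull[OF S] base_hull[OF T] ne by metis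

text \<open>
  The cells of the chosen orderings are a basis of the chains. Different simplices have disjoint sets
  of orderings, because a simplex is the convex hull of its vertices.
\<close>

lemma chain_expansion:
  assumes x: "x \<in> chains K n sd"
  shows "x = (\<Sum>S\<in>simplices sd. pscale (x (cell_of sd (ori S))) (elem_chain (cell_of sd) (ori S)))"
    (is "x = ?y")
proof
  fix c
  show "x c = ?y c"
  proof (cases "\<exists>S\<in>simplices sd. \<exists>vs\<in>orderings S. c = cell_of sd vs")
    case True
    then obtain T ws where T: "T \<in> simplices sd" "ws \<in> orderings T" and c: "c = cell_of sd ws" by blast
    obtain p where p: "p permutes {..<length (ori T)}" "permute_list p (ori T) = ws"
      using base_ori[OF T(1)] T(2) by (rule orderings_related)
    have "?y c = (\<Sum>S\<in>simplices sd. if S = T then x (cell_of sd (ori T)) * of_int (sign p) else 0)"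
      unfolding sum_fun_apply pscale_def
    proof (rule sum.cong[OF refl])
      fix S assume S: "S \<in> simplices sd"
      show "x (cell_of sd (ori S)) * elem_chain (cell_of sd) (ori S) c =
        (if S = T then x (cell_of sd (ori T)) * of_int (sign p) else 0)"
      proof (cases "S = T")
        case True
        have "elem_chain (cell_of sd) (ori T) c = of_int (sign p)"
          unfolding c p(2)[symmetric] elem_chain_argument_permute[OF inj_cell_of p(1)]
          using elem_chain_self[OF inj_cell_of orderings_distinct[OF base_ori[OF T(1)]]] by simp
        then show ?thesis using True by simp
      next
        case False
        then show ?thesis using elem_chain_other[OF S base_ori[OF S] T] c by simp
      qed
    qed
    also have "\<dots> = x (cell_of sd (ori T)) * of_int (sign p)" using T(1) finite_base by simp
    also have "\<dots> = x c"
      unfolding c p(2)[symmetric] chainD(2)[OF x T(1) base_ori[OF T(1)] p(1)] by simp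
    finally show ?thesis by simp
  next
    case False
    then have "x c = 0" using chainD(1)[OF x] by blast
    moreover have "elem_chain (cell_of sd) (ori S) c = 0" if "S \<in> simplices sd" for S
      using False chainD(1)[OF elem_chain_in_chains[OF that base_ori[OF that]]] by blast
    ultimately show ?thesis unfolding sum_fun_apply pscale_def by simp
  qed
qed

lemma cochainD:
  assumes "\<alpha> \<in> cochains K n sd"
  shows "x \<in> chains K n sd \<Longrightarrow> y \<in> chains K n sd \<Longrightarrow> \<alpha> (x + y) = \<alpha> x + \<alpha> y"
    "x \<in> chains K n sd \<Longrightarrow> \<alpha> (pscale a x) = a *\<^sub>R \<alpha> x"
    "x \<notin> chains K n sd \<Longrightarrow> \<alpha> x = 0"
  using assms unfolding cochains_def by auto

lemma cochain_sum_scale: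
  assumes \<alpha>: "\<alpha> \<in> cochains K n sd" and y: "\<And>i. i \<in> I \<Longrightarrow> y i \<in> chains K n sd"
  shows "\<alpha> (\<Sum>i\<in>I. pscale (c i) (y i)) = (\<Sum>i\<in>I. c i *\<^sub>R \<alpha> (y i))"
proof -
  note 0 = fs.subspace_0[OF chains_subspace]
  have zero: "\<alpha> 0 = 0" using cochainD(2)[OF \<alpha> 0, of 0] by simp
  show ?thesis
  proof (cases "finite I")
    case True
    then show ?thesis using y
    proof (induction I)
      case (insert i I)
      have "pscale (c i) (y i) \<in> chains K n sd" "(\<Sum>i\<in>I. pscale (c i) (y i)) \<in> chains K n sd"
        using insert.prems
        by (auto intro!: fs.subspace_sum[OF chains_subspace] fs.subspace_scale[OF chains_subspace])
      from cochainD(1)[OF \<alpha> this] have "\<alpha> (\<Sum>i\<in>insert i I. pscale (c i) (y i)) =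
          \<alpha> (pscale (c i) (y i)) + \<alpha> (\<Sum>i\<in>I. pscale (c i) (y i))"
        unfolding sum.insert[OF insert.hyps] .
      also have "\<alpha> (pscale (c i) (y i)) = c i *\<^sub>R \<alpha> (y i)"
        by (rule cochainD(2)[OF \<alpha>]) (rule insert.prems, simp)
      also have "\<alpha> (\<Sum>i\<in>I. pscale (c i) (y i)) = (\<Sum>i\<in>I. c i *\<^sub>R \<alpha> (y i))"
        by (rule insert.IH) (rule insert.prems, simp)
      finally show ?case unfolding sum.insert[OF insert.hyps] .
    qed (simp only: sum.empty zero)
  qed (simp add: zero)
qed

lemma cochains_subspace: "fs.subspace (cochains K n sd)"
proof (rule fs.subspaceI)
  show "0 \<in> cochains K n sd" by (simp add: cochains_def)
  show "\<alpha> + \<beta> \<in> cochains K n sd" if "\<alpha> \<in> cochains K n sd" "\<beta> \<in> cochains K n sd" for \<alpha> \<beta>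
    using that unfolding cochains_def by (simp add: algebra_simps)
  show "pscale z \<alpha> \<in> cochains K n sd" if "\<alpha> \<in> cochains K n sd" for z \<alpha>
    using that unfolding cochains_def pscale_def by (simp add: algebra_simps)
qed

lemmas cochains_add = fs.subspace_add[OF cochains_subspace]
  and cochains_scale = fs.subspace_scale[OF cochains_subspace]

lemma cochain_of_in_cochains: "cochain_of K n ori sd f \<in> cochains K n sd"
proof -
  have "x + y \<in> chains K n sd" if "x \<in> chains K n sd" "y \<in> chains K n sd" for x y
    using fs.subspace_add[OF chains_subspace that] .
  moreover have "pscale a x \<in> chains K n sd" if "x \<in> chains K n sd" for a x
    using fs.subspace_scale[OF chains_subspace that] .
  ultimately show ?thesis
    unfolding cochains_def cochain_of_def
    by (simp add: sum.distrib scaleR_left_distrib scaleR_sum_right pscale_def)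
qed

lemma cochain_of_cong:
  "(\<And>S. S \<in> simplices sd \<Longrightarrow> f (ori S) = f' (ori S)) \<Longrightarrow>
    cochain_of K n ori sd f = cochain_of K n ori sd f'"
  unfolding cochain_of_def by (intro ext if_cong sum.cong refl) simp

lemma cochain_of_values:
  assumes \<alpha>: "\<alpha> \<in> cochains K n sd"
  shows "cochain_of K n ori sd (\<lambda>vs. \<alpha> (elem_chain (cell_of sd) vs)) = \<alpha>"
proof
  fix x
  show "cochain_of K n ori sd (\<lambda>vs. \<alpha> (elem_chain (cell_of sd) vs)) x = \<alpha> x"
  proof (cases "x \<in> chains K n sd")
    case True
    have "\<alpha> x = \<alpha> (\<Sum>S\<in>simplices sd. pscale (x (cell_of sd (ori S))) (elem_chain (cell_of sd) (ori S)))"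
      using chain_expansion[OF True] by simp
    also have "\<dots> = (\<Sum>S\<in>simplices sd. x (cell_of sd (ori S)) *\<^sub>R \<alpha> (elem_chain (cell_of sd) (ori S)))"
      by (rule cochain_sum_scale[OF \<alpha>]) (rule elem_chain_in_chains[OF _ base_ori])
    finally show ?thesis using True by (simp add: cochain_of_def)
  qed (simp add: cochain_of_def cochainD(3)[OF \<alpha>])
qed

lemma alternatingD:
  "alternating K n sd f \<Longrightarrow> S \<in> simplices sd \<Longrightarrow> vs \<in> orderings S \<Longrightarrow>
    p permutes {..<length vs} \<Longrightarrow> f (permute_list p vs) = of_int (sign p) *\<^sub>R f vs"
  unfolding alternating_def by blast

lemma cochain_of_elem_chain:
  assumes f: "alternating K n sd f" and S: "S \<in> simplices sd" and vs: "vs \<in> orderings S"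
  shows "cochain_of K n ori sd f (elem_chain (cell_of sd) vs) = f vs"
proof -
  let ?e = "elem_chain (cell_of sd) vs"
  obtain p where p: "p permutes {..<length (ori S)}" "permute_list p (ori S) = vs"
    using base_ori[OF S] vs by (rule orderings_related)
  have self: "?e (cell_of sd (ori S)) = of_int (sign p)"
    unfolding p(2)[symmetric] elem_chain_permute[OF p(1)] pscale_def
    using elem_chain_self[OF inj_cell_of orderings_distinct[OF base_ori[OF S]]] by simp
  have "cochain_of K n ori sd f ?e = (\<Sum>T\<in>simplices sd. ?e (cell_of sd (ori T)) *\<^sub>R f (ori T))"
    using elem_chain_in_chains[OF S vs] by (simp add: cochain_of_def)
  also have "\<dots> = (\<Sum>T\<in>simplices sd. if T = S then of_int (sign p) *\<^sub>R f (ori S) else 0)"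
    using elem_chain_other[OF S vs _ base_ori] self by (intro sum.cong refl) auto
  also have "\<dots> = f vs"
    using S finite_base alternatingD[OF f S base_ori[OF S] p(1)] p(2) by simp
  finally show ?thesis .
qed

lemma alternating_values:
  assumes \<alpha>: "\<alpha> \<in> cochains K n sd"
    and h: "\<And>S vs. S \<in> simplices sd \<Longrightarrow> vs \<in> orderings S \<Longrightarrow>
      \<exists>T\<in>simplices sd. map h vs \<in> orderings T"
  shows "alternating K n sd (\<lambda>vs. \<alpha> (elem_chain (cell_of sd) (map h vs)))"
  unfolding alternating_def
proof (intro ballI allI impI)
  fix S vs p assume S: "S \<in> simplices sd" and vs: "vs \<in> orderings S" and p: "p permutes {..<length vs}"
  obtain T where T: "T \<in> simplices sd" "map h vs \<in> orderings T" using h[OF S vs] by blast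
  have "elem_chain (cell_of sd) (map h (permute_list p vs)) =
    pscale (of_int (sign p)) (elem_chain (cell_of sd) (map h vs))"
    using elem_chain_permute[of p "map h vs" "cell_of sd"] p by (simp add: permute_list_map)
  then show "\<alpha> (elem_chain (cell_of sd) (map h (permute_list p vs))) =
    of_int (sign p) *\<^sub>R \<alpha> (elem_chain (cell_of sd) (map h vs))"
    using cochainD(2)[OF \<alpha> elem_chain_in_chains[OF T]] by simp
qed

text \<open>
  Omitting a vertex gives an ordering of a facet, which belongs to the complex because
  simplicial complexes are closed under faces.
\<close>

lemma face_in_complex:
  assumes S: "S \<in> simplices (Primal (Suc k))" and vs: "vs \<in> orderings S" and i: "i < length vs"
  shows "\<exists>F\<in>simplices (Primal k). face i vs \<in> orderings F"
proof -
  have SK: "S \<in> K" and simp: "int (Suc k) simplex S" using S by auto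
  note V = simplex_vertices[OF simp]
  have d: "distinct vs" and set: "set vs = vertices_of S" using vs unfolding orderings_def by auto
  have len: "length vs = Suc (Suc k)" by (rule orderings_length[OF simp vs])
  let ?F = "convex hull (set (face i vs))"
  have "distinct (take i vs @ vs ! i # drop (Suc i) vs)" using d id_take_nth_drop[OF i] by metis
  then have df: "distinct (face i vs)" unfolding face_def by auto
  have sub: "set (face i vs) \<subseteq> vertices_of S"
    unfolding face_def set[symmetric] using set_take_subset set_drop_subset by fastforce
  then have ind: "\<not> affine_dependent (set (face i vs))" using V(1) affine_dependent_subset by blast
  have "?F face_of convex hull (vertices_of S)"
    using face_of_convex_hull_affine_independent[OF V(1)] sub by blast
  then have "?F \<in> K" using SK complex V(4) unfolding simplicial_complex_def by metis
  moreover have "length (face i vs) = Suc k" using i len by (simp add: face_def)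
  then have "int (card (set (face i vs))) = int k + 1" using distinct_card[OF df] by simp
  then have "int k simplex ?F" using ind simplex_convex_hull by blast
  moreover have "face i vs \<in> orderings ?F"
    unfolding orderings_def vertices_of_def
    using df extreme_point_of_convex_hull_affine_independent[OF ind] by auto
  ultimately show ?thesis by auto
qed

lemma face_chain:
  assumes "S \<in> simplices (Primal (Suc k))" "vs \<in> orderings S" "i < length vs"
  shows "elem_chain Simp (face i vs) \<in> chains K n (Primal k)"
  using face_in_complex[OF assms] elem_chain_in_chains[of _ "Primal k"] by auto

lemma cochain_bdry:
  assumes "\<alpha> \<in> cochains K n (Primal k)" "S \<in> simplices (Primal (Suc k))" "vs \<in> orderings S"
  shows "\<alpha> (bdry vs) = (\<Sum>i<length vs. (- 1) ^ i *\<^sub>R \<alpha> (elem_chain Simp (face i vs)))"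
  unfolding bdry_face by (rule cochain_sum_scale[OF assms(1) face_chain[OF assms(2,3)]]) simp

lemma bdry_in_chains:
  assumes "S \<in> simplices (Primal (Suc k))" "vs \<in> orderings S"
  shows "bdry vs \<in> chains K n (Primal k)"
  unfolding bdry_face
  by (intro fs.subspace_sum[OF chains_subspace] fs.subspace_scale[OF chains_subspace] face_chain[OF assms]) simp

lemma alternating_bdry:
  assumes \<alpha>: "\<alpha> \<in> cochains K n (Primal k)"
  shows "alternating K n (Primal (Suc k)) (\<lambda>vs. \<alpha> (bdry vs))"
  unfolding alternating_def
  using bdry_permute[OF orderings_distinct] cochainD(2)[OF \<alpha> bdry_in_chains] by metis

definition cofaces :: "'a list \<Rightarrow> 'a set set"
  where "cofaces ws = {T \<in> K. int (length ws) simplex T \<and> convex hull (set ws) \<subseteq> T}"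

lemma cofaces_base:
  assumes S: "S \<in> simplices (Dual (Suc m))" and ws: "ws \<in> orderings S" and T: "T \<in> cofaces ws"
  shows "T \<in> simplices (Dual m)"
proof -
  obtain k where k: "k + Suc m = n" "int k simplex S" using S by auto
  have "length ws = Suc k" by (rule orderings_length[OF k(2) ws])
  then have "Suc k + m = n" "int (Suc k) simplex T" "T \<in> K" using k T unfolding cofaces_def by auto
  then show ?thesis by (simp only: base_simplices.simps mem_Collect_eq) blast
qed

lemma dual_bdry_cofaces:
  "dual_bdry K ori eps ws = pscale (eps (length ws))
    (\<Sum>T\<in>cofaces ws. pscale (incidence (ori T) ws) (elem_chain Star (ori T)))"
  unfolding dual_bdry_def cofaces_def ..

lemma dual_bdry_in_chains:
  assumes S: "S \<in> simplices (Dual (Suc m))" and ws: "ws \<in> orderings S"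
  shows "(\<Sum>T\<in>cofaces ws. pscale (incidence (ori T) ws) (elem_chain Star (ori T))) \<in> chains K n (Dual m)"
    "dual_bdry K ori eps ws \<in> chains K n (Dual m)"
proof -
  have "elem_chain Star (ori T) \<in> chains K n (Dual m)" if "T \<in> cofaces ws" for T
    using elem_chain_in_chains[OF cofaces_base[OF S ws that] base_ori[OF cofaces_base[OF S ws that]]] by simp
  then show 1: "(\<Sum>T\<in>cofaces ws. pscale (incidence (ori T) ws) (elem_chain Star (ori T))) \<in> chains K n (Dual m)"
    by (intro fs.subspace_sum[OF chains_subspace] fs.subspace_scale[OF chains_subspace])
  show "dual_bdry K ori eps ws \<in> chains K n (Dual m)"
    unfolding dual_bdry_cofaces by (rule fs.subspace_scale[OF chains_subspace 1])
qed

lemma cochain_dual_bdry: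
  assumes \<beta>: "\<beta> \<in> cochains K n (Dual m)" and S: "S \<in> simplices (Dual (Suc m))"
    and ws: "ws \<in> orderings S"
  shows "\<beta> (dual_bdry K ori eps ws) = eps (length ws) *\<^sub>R
    (\<Sum>T\<in>cofaces ws. incidence (ori T) ws *\<^sub>R \<beta> (elem_chain Star (ori T)))"
proof -
  have "elem_chain Star (ori T) \<in> chains K n (Dual m)" if "T \<in> cofaces ws" for T
    using elem_chain_in_chains[OF cofaces_base[OF S ws that] base_ori[OF cofaces_base[OF S ws that]]] by simp
  then show ?thesis
    unfolding dual_bdry_cofaces cochainD(2)[OF \<beta> dual_bdry_in_chains(1)[OF S ws]]
    by (simp add: cochain_sum_scale[OF \<beta>])
qed

lemma alternating_dual_bdry:
  assumes \<beta>: "\<beta> \<in> cochains K n (Dual m)"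
  shows "alternating K n (Dual (Suc m)) (\<lambda>ws. \<beta> (dual_bdry K ori eps ws))"
  unfolding alternating_def
proof (intro ballI allI impI)
  fix S ws p assume S: "S \<in> simplices (Dual (Suc m))" and ws: "ws \<in> orderings S"
    and p: "p permutes {..<length ws}"
  have "cofaces (permute_list p ws) = cofaces ws" unfolding cofaces_def using p by simp
  then show "\<beta> (dual_bdry K ori eps (permute_list p ws)) = of_int (sign p) *\<^sub>R \<beta> (dual_bdry K ori eps ws)"
    unfolding cochain_dual_bdry[OF \<beta> S orderings_permute[OF ws p]] cochain_dual_bdry[OF \<beta> S ws]
    by (simp add: incidence_argument_permute[OF p] scaleR_sum_right mult.left_commute)
qed


lemma base_Dual_complement:
  assumes k: "k \<le> n"
  shows "simplices (Dual (n - k)) = simplices (Primal k)"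
proof -
  have "ka + (n - k) = n \<longleftrightarrow> ka = k" for ka using k by auto
  then show ?thesis by simp
qed

lemma alternating_hodge:
  assumes \<alpha>: "\<alpha> \<in> cochains K n (Primal k)" and k: "k \<le> n"
  shows "alternating K n (Dual (n - k)) (\<lambda>vs. c (convex hull (set vs)) *\<^sub>R \<alpha> (elem_chain Simp vs))"
  unfolding alternating_def
proof (intro ballI allI impI)
  fix S vs p assume S: "S \<in> simplices (Dual (n - k))" and vs: "vs \<in> orderings S"
    and p: "p permutes {..<length vs}"
  have "S \<in> simplices (Primal k)" using S unfolding base_Dual_complement[OF k] .
  from elem_chain_in_chains[OF this vs] have "elem_chain Simp vs \<in> chains K n (Primal k)" by simp
  then show "c (convex hull (set (permute_list p vs))) *\<^sub>R \<alpha> (elem_chain Simp (permute_list p vs)) =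
    of_int (sign p) *\<^sub>R c (convex hull (set vs)) *\<^sub>R \<alpha> (elem_chain Simp vs)"
    unfolding elem_chain_permute[OF p] set_permute_list[OF p]
    using cochainD(2)[OF \<alpha>] by (simp add: mult.commute)
qed

end

locale complex_with_isometry = oriented_simplicial_complex K n ori
  for K :: "'a::euclidean_space set set" and n ori +
  fixes h :: "'a \<Rightarrow> 'a"
  assumes isometry: "simplicial_isometry K h"
begin

lemmas h_dist = simplicial_isometryD(1)[OF isometry]

abbreviation "R \<equiv> \<lambda>sd. pullback sd h"

lemma base_image: "S \<in> simplices sd \<Longrightarrow> h ` S \<in> simplices sd"
  using simplicial_isometryD(3)[OF isometry] isometry_simplex[OF h_dist]
  by (cases sd) auto

lemma base_image_ordering: "vs \<in> orderings S \<Longrightarrow> map h vs \<in> orderings (h ` S)"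
  by (rule isometry_orderings[OF h_dist])

lemma alternating_pullback:
  "\<alpha> \<in> cochains K n sd \<Longrightarrow> alternating K n sd (\<lambda>vs. \<alpha> (elem_chain (cell_of sd) (map h vs)))"
  using base_image base_image_ordering by (intro alternating_values) blast+

lemma pullback_in_cochains: "R sd \<alpha> \<in> cochains K n sd"
  unfolding cochain_pullback_def by (rule cochain_of_in_cochains)

lemma pullback_elem_chain:
  assumes "\<alpha> \<in> cochains K n sd" "S \<in> simplices sd" "vs \<in> orderings S"
  shows "R sd \<alpha> (elem_chain (cell_of sd) vs) = \<alpha> (elem_chain (cell_of sd) (map h vs))"
  unfolding cochain_pullback_def
  by (rule cochain_of_elem_chain[OF alternating_pullback[OF assms(1)] assms(2,3)])

text \<open>
  Both sides take the value of \<open>\<alpha>\<close> on the boundary of \<open>map h (ori S)\<close>. This need not be the chosen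
  ordering of \<open>h ` S\<close>, which is why the boundary has to be alternating.
\<close>

lemma ext_deriv_equivariant:
  assumes \<alpha>: "\<alpha> \<in> cochains K n (Primal k)"
  shows "ext_deriv K n ori k (R (Primal k) \<alpha>) = R (Primal (Suc k)) (ext_deriv K n ori k \<alpha>)"
  unfolding cochain_pullback_def[of K n ori "Primal (Suc k)"] ext_deriv_def[of K n ori k "R (Primal k) \<alpha>"]
proof (rule cochain_of_cong)
  fix S assume S: "S \<in> simplices (Primal (Suc k))"
  let ?vs = "ori S"
  have vs: "?vs \<in> orderings S" by (rule base_ori[OF S])
  have "R (Primal k) \<alpha> (bdry ?vs) =
    (\<Sum>i<length ?vs. (- 1) ^ i *\<^sub>R R (Primal k) \<alpha> (elem_chain Simp (face i ?vs)))"
    by (rule cochain_bdry[OF pullback_in_cochains S vs])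
  also have "\<dots> = (\<Sum>i<length ?vs. (- 1) ^ i *\<^sub>R \<alpha> (elem_chain Simp (map h (face i ?vs))))"
  proof (rule sum.cong[OF refl])
    fix i assume "i \<in> {..<length ?vs}"
    then obtain F where "F \<in> simplices (Primal k)" "face i ?vs \<in> orderings F"
      using face_in_complex[OF S vs] by auto
    from pullback_elem_chain[OF \<alpha> this]
    show "(- 1) ^ i *\<^sub>R R (Primal k) \<alpha> (elem_chain Simp (face i ?vs)) =
      (- 1) ^ i *\<^sub>R \<alpha> (elem_chain Simp (map h (face i ?vs)))" by simp
  qed
  also have "\<dots> = \<alpha> (bdry (map h ?vs))"
    using cochain_bdry[OF \<alpha> base_image[OF S] base_image_ordering[OF vs]] by (simp add: face_map)
  also have "\<dots> = ext_deriv K n ori k \<alpha> (elem_chain (cell_of (Primal (Suc k))) (map h ?vs))"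
    unfolding ext_deriv_def
    by (rule cochain_of_elem_chain[OF alternating_bdry[OF \<alpha>] base_image[OF S] base_image_ordering[OF vs], symmetric])
  finally show "R (Primal k) \<alpha> (bdry ?vs) =
    ext_deriv K n ori k \<alpha> (elem_chain (cell_of (Primal (Suc k))) (map h ?vs))" .
qed

lemma cofaces_image:
  "bij_betw ((`) h) (cofaces ws) (cofaces (map h ws))"
proof -
  have hull: "convex hull (set (map h ws)) = h ` (convex hull (set ws))"
    using isometry_hulls(2)[OF h_dist] by simp
  have inj: "inj h" by (rule isometry_inj[OF h_dist])
  have fwd: "h ` T \<in> cofaces (map h ws)" if "T \<in> cofaces ws" for T
    using that simplicial_isometryD(3)[OF isometry] isometry_simplex[OF h_dist]
    unfolding cofaces_def hull by auto
  have "T' \<in> (`) h ` cofaces ws" if T': "T' \<in> cofaces (map h ws)" for T'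
  proof -
    have "T' \<in> K" using T' unfolding cofaces_def by blast
    then obtain T where T: "T \<in> K" "T' = h ` T"
      using simplicial_isometryD(2)[OF isometry] unfolding bij_betw_def by blast
    have inv: "inv_into UNIV h ` (h ` T) = T" using inj by (simp add: image_inv_f_f)
    have "int (length ws) simplex T"
      using isometry_simplex[OF isometry_inverse[OF h_dist], of "int (length ws)" "h ` T"] T' T(2) inv
      unfolding cofaces_def by simp
    moreover have "convex hull (set ws) \<subseteq> T"
      using T' T(2) inj unfolding cofaces_def hull by (simp add: inj_image_subset_iff)
    ultimately have "T \<in> cofaces ws" using T(1) unfolding cofaces_def by blast
    then show ?thesis using T(2) by blast
  qed
  then have "(`) h ` cofaces ws = cofaces (map h ws)" using fwd by blast
  moreover have "inj_on ((`) h) (cofaces ws)" using inj by (simp add: inj_on_def inj_image_eq_iff)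
  ultimately show ?thesis unfolding bij_betw_def by blast
qed

text \<open>
  Reindex the cofaces by \<open>h\<close>. The chosen ordering of \<open>h ` T\<close> and the transported one differ by a
  permutation, whose sign enters through the incidence number and through the dual cell of \<open>T\<close>,
  and cancels.
\<close>

lemma dual_deriv_equivariant:
  assumes \<beta>: "\<beta> \<in> cochains K n (Dual m)"
  shows "dual_deriv K n ori eps m (R (Dual m) \<beta>) = R (Dual (Suc m)) (dual_deriv K n ori eps m \<beta>)"
  unfolding cochain_pullback_def[of K n ori "Dual (Suc m)"] dual_deriv_def[of K n ori eps m "R (Dual m) \<beta>"]
proof (rule cochain_of_cong)
  fix S assume S: "S \<in> simplices (Dual (Suc m))"
  let ?ws = "ori S"
  have ws: "?ws \<in> orderings S" by (rule base_ori[OF S])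
  note hS = base_image[OF S] base_image_ordering[OF ws]
  have cofB: "T \<in> simplices (Dual m)" if "T \<in> cofaces ?ws" for T
    by (rule cofaces_base[OF S ws that])
  have "R (Dual m) \<beta> (dual_bdry K ori eps ?ws) = eps (length ?ws) *\<^sub>R
    (\<Sum>T\<in>cofaces ?ws. incidence (ori T) ?ws *\<^sub>R R (Dual m) \<beta> (elem_chain Star (ori T)))"
    by (rule cochain_dual_bdry[OF pullback_in_cochains S ws])
  also have "(\<Sum>T\<in>cofaces ?ws. incidence (ori T) ?ws *\<^sub>R R (Dual m) \<beta> (elem_chain Star (ori T))) =
    (\<Sum>T\<in>cofaces ?ws. incidence (ori (h ` T)) (map h ?ws) *\<^sub>R \<beta> (elem_chain Star (ori (h ` T))))"
  proof (rule sum.cong[OF refl])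
    fix T assume T: "T \<in> cofaces ?ws"
    note TB = cofB[OF T]
    have "R (Dual m) \<beta> (elem_chain Star (ori T)) = \<beta> (elem_chain Star (map h (ori T)))"
      using pullback_elem_chain[OF \<beta> TB base_ori[OF TB]] by simp
    moreover obtain p where p: "p permutes {..<length (map h (ori T))}"
      "permute_list p (map h (ori T)) = ori (h ` T)"
      using base_image_ordering[OF base_ori[OF TB]] base_ori[OF base_image[OF TB]] by (rule orderings_related)
    have d: "distinct (map h (ori T))"
      by (rule orderings_distinct[OF base_image_ordering[OF base_ori[OF TB]]])
    have "incidence (ori (h ` T)) (map h ?ws) = of_int (sign p) * incidence (ori T) ?ws"
      unfolding p(2)[symmetric] incidence_permute[OF d p(1)] incidence_map[OF isometry_inj[OF h_dist]] ..
    moreover have "\<beta> (elem_chain Star (ori (h ` T))) = of_int (sign p) *\<^sub>R \<beta> (elem_chain Star (map h (ori T)))"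
      unfolding p(2)[symmetric] elem_chain_permute[OF p(1)]
      using cochainD(2)[OF \<beta> elem_chain_in_chains[OF base_image[OF TB] base_image_ordering[OF base_ori[OF TB]]]]
      by simp
    ultimately show "incidence (ori T) ?ws *\<^sub>R R (Dual m) \<beta> (elem_chain Star (ori T)) =
      incidence (ori (h ` T)) (map h ?ws) *\<^sub>R \<beta> (elem_chain Star (ori (h ` T)))"
      by (cases p rule: sign_cases) simp_all
  qed
  also have "\<dots> = (\<Sum>T\<in>cofaces (map h ?ws). incidence (ori T) (map h ?ws) *\<^sub>R \<beta> (elem_chain Star (ori T)))"
    by (rule sum.reindex_bij_betw[OF cofaces_image])
  also have "eps (length ?ws) *\<^sub>R \<dots> = \<beta> (dual_bdry K ori eps (map h ?ws))"
    using cochain_dual_bdry[OF \<beta> hS, of eps] by simp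
  also have "\<dots> = dual_deriv K n ori eps m \<beta> (elem_chain (cell_of (Dual (Suc m))) (map h ?ws))"
    unfolding dual_deriv_def
    by (rule cochain_of_elem_chain[OF alternating_dual_bdry[OF \<beta>] hS, symmetric])
  finally show "R (Dual m) \<beta> (dual_bdry K ori eps ?ws) =
    dual_deriv K n ori eps m \<beta> (elem_chain (cell_of (Dual (Suc m))) (map h ?ws))" .
qed

text \<open>The ratio of dual and primal volume is the same at \<open>S\<close> and \<open>h ` S\<close>.\<close>

lemma hodge_equivariant:
  assumes \<alpha>: "\<alpha> \<in> cochains K n (Primal k)" and k: "k \<le> n"
  shows "hodge K n ori k (R (Primal k) \<alpha>) = R (Dual (n - k)) (hodge K n ori k \<alpha>)"
  unfolding cochain_pullback_def[of K n ori "Dual (n - k)"] hodge_def[of K n ori k "R (Primal k) \<alpha>"]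
proof (rule cochain_of_cong)
  fix S assume S: "S \<in> simplices (Dual (n - k))"
  let ?vs = "ori S" and ?c = "\<lambda>S. dual_volume K n k S / volume k S"
  have vs: "?vs \<in> orderings S" by (rule base_ori[OF S])
  have SP: "S \<in> simplices (Primal k)" using S unfolding base_Dual_complement[OF k] .
  have hull: "convex hull (set (map h ?vs)) = h ` (convex hull (set ?vs))"
    using isometry_hulls(2)[OF h_dist] by simp
  have "?c (convex hull (set (map h ?vs))) = ?c (convex hull (set ?vs))"
    unfolding hull by (simp only: dual_volume_isometry[OF isometry] volume_isometry[OF h_dist])
  moreover have "R (Primal k) \<alpha> (elem_chain Simp ?vs) = \<alpha> (elem_chain Simp (map h ?vs))"
    using pullback_elem_chain[OF \<alpha> SP vs] by simp
  moreover have "hodge K n ori k \<alpha> (elem_chain (cell_of (Dual (n - k))) (map h ?vs)) =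
    ?c (convex hull (set (map h ?vs))) *\<^sub>R \<alpha> (elem_chain Simp (map h ?vs))"
    unfolding hodge_def
    by (rule cochain_of_elem_chain[OF alternating_hodge[OF \<alpha> k] base_image[OF S] base_image_ordering[OF vs]])
  ultimately show "?c (convex hull (set ?vs)) *\<^sub>R R (Primal k) \<alpha> (elem_chain Simp ?vs) =
    hodge K n ori k \<alpha> (elem_chain (cell_of (Dual (n - k))) (map h ?vs))" by simp
qed

end

context oriented_simplicial_complex
begin

text \<open>
  What passes from the generators to all expressions in them. The inclusion of the image serves
  compositions; linearity lets the operators commute with sums over the group.
\<close>

definition equivariant_operator ::
  "side_degree \<Rightarrow> side_degree \<Rightarrow> (('a, 'f::real_field) cochain \<Rightarrow> ('a cell \<Rightarrow> real) \<Rightarrow> 'f) \<Rightarrow> bool"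
  where "equivariant_operator s t P \<longleftrightarrow>
    P ` cochains K n s \<subseteq> cochains K n t \<and> linear_on (cochains K n s) P \<and>
    (\<forall>h. simplicial_isometry K h \<longrightarrow> (\<forall>\<alpha>\<in>cochains K n s.
      P (pullback s h \<alpha>) = pullback t h (P \<alpha>)))"

lemma equivariant_operatorI:
  assumes "\<And>\<alpha>. \<alpha> \<in> cochains K n s \<Longrightarrow> P \<alpha> \<in> cochains K n t" "linear_on (cochains K n s) P"
    "\<And>h \<alpha>. simplicial_isometry K h \<Longrightarrow> \<alpha> \<in> cochains K n s \<Longrightarrow>
      P (pullback s h \<alpha>) = pullback t h (P \<alpha>)"
  shows "equivariant_operator s t P"
  using assms unfolding equivariant_operator_def by blast

lemma equivariant_operatorD:
  assumes "equivariant_operator s t P"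
  shows "\<alpha> \<in> cochains K n s \<Longrightarrow> P \<alpha> \<in> cochains K n t" "linear_on (cochains K n s) P"
    "simplicial_isometry K h \<Longrightarrow> \<alpha> \<in> cochains K n s \<Longrightarrow>
      P (pullback s h \<alpha>) = pullback t h (P \<alpha>)"
  using assms unfolding equivariant_operator_def by blast+

lemma cochain_pullback_linear: "linear_on W (pullback s h)"
  unfolding cochain_pullback_def[abs_def] by (rule cochain_of_linear_values)

lemma cochain_pullback_closed: "pullback s h \<alpha> \<in> cochains K n s"
  unfolding cochain_pullback_def by (rule cochain_of_in_cochains)

lemma with_isometry: "simplicial_isometry K h \<Longrightarrow> complex_with_isometry K n ori h"
  by unfold_locales

lemma operators_linear:
  "linear_on W (ext_deriv K n ori k)" "linear_on W (dual_deriv K n ori eps m)"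
  "linear_on W (hodge K n ori j)"
  unfolding ext_deriv_def[abs_def] dual_deriv_def[abs_def] hodge_def[abs_def]
  by (rule cochain_of_linear_values cochain_of_linear)+

lemma operators_closed:
  "ext_deriv K n ori k \<alpha> \<in> cochains K n (Primal (Suc k))"
  "dual_deriv K n ori eps m \<alpha> \<in> cochains K n (Dual (Suc m))"
  "hodge K n ori j \<alpha> \<in> cochains K n (Dual (n - j))"
  by (simp_all add: ext_deriv_def dual_deriv_def hodge_def cochain_of_in_cochains)

lemma dec_operator_equivariant:
  fixes P :: "('a, 'f::real_field) cochain \<Rightarrow> ('a, 'f) cochain"
  assumes P: "dec_operator K n ori eps J s t P"
    and star: "\<forall>j\<in>J. j \<le> n \<and> bij_betw (hodge K n ori j)
      (cochains K n (Primal j) :: ('a, 'f) cochain set) (cochains K n (Dual (n - j)))"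
  shows "equivariant_operator s t P"
  using P
proof (induction rule: dec_operator.induct)
  case (primal_d k)
  then show ?case
    unfolding equivariant_operator_def
    using complex_with_isometry.ext_deriv_equivariant[OF with_isometry] operators_linear
    by (auto simp: operators_closed)
next
  case (dual_d m)
  then show ?case
    unfolding equivariant_operator_def
    using complex_with_isometry.dual_deriv_equivariant[OF with_isometry] operators_linear
    by (auto simp: operators_closed)
next
  case (star j)
  then show ?case
    unfolding equivariant_operator_def
    using complex_with_isometry.hodge_equivariant[OF with_isometry] operators_linear
    by (auto simp: operators_closed)
next
  case (star_inverse j)
  let ?H = "hodge K n ori j :: ('a, 'f) cochain \<Rightarrow> _" and ?W = "cochains K n (Primal j) :: ('a, 'f) cochain set"
  let ?V = "cochains K n (Dual (n - j)) :: ('a, 'f) cochain set"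
  have bij: "bij_betw ?H ?W ?V" using star star_inverse.hyps by blast
  have into: "inv_into ?W ?H \<beta> \<in> ?W" and right: "?H (inv_into ?W ?H \<beta>) = \<beta>" if "\<beta> \<in> ?V" for \<beta>
    using that bij by (auto simp: bij_betw_def inv_into_into f_inv_into_f)
  have "inv_into ?W ?H (pullback (Dual (n - j)) h \<beta>) =
      pullback (Primal j) h (inv_into ?W ?H \<beta>)"
    if h: "simplicial_isometry K h" and \<beta>: "\<beta> \<in> ?V" for h \<beta>
  proof -
    let ?a = "inv_into ?W ?H \<beta>"
    \<comment> \<open>The star is injective and its image of the right-hand side is the pullback of \<open>\<beta>\<close>.\<close>
    have "pullback (Dual (n - j)) h \<beta> = ?H (pullback (Primal j) h ?a)"
      using complex_with_isometry.hodge_equivariant[OF with_isometry[OF h] into[OF \<beta>] star_inverse.hyps(2)] right[OF \<beta>]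
      by simp
    then show ?thesis
      using bij_betw_inv_into_left[OF bij cochain_pullback_closed] by simp
  qed
  then show ?case
    unfolding equivariant_operator_def
    using into linear_on_inv_into[OF cochains_subspace operators_linear(3) bij] by blast
next
  case (comp s t P u Q)
  note P = equivariant_operatorD[OF comp.IH(1)] and Q = equivariant_operatorD[OF comp.IH(2)]
  show ?case
  proof (rule equivariant_operatorI)
    show "linear_on (cochains K n s) (Q \<circ> P)"
      unfolding o_def using P(1) by (intro linear_on_compose[OF P(2) Q(2)] image_subsetI)
  qed (simp_all add: P Q)
next
  case (add s t P Q)
  note P = equivariant_operatorD[OF add.IH(1)] and Q = equivariant_operatorD[OF add.IH(2)]
  show ?case
  proof (rule equivariant_operatorI)
    show "P \<alpha> + Q \<alpha> \<in> cochains K n t" if "\<alpha> \<in> cochains K n s" for \<alpha>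
      using P(1)[OF that] Q(1)[OF that] by (rule fs.subspace_add[OF cochains_subspace])
    show "linear_on (cochains K n s) (\<lambda>\<alpha>. P \<alpha> + Q \<alpha>)"
      using P(2) Q(2) unfolding linear_on_def by (simp add: fs.scale_right_distrib add_ac)
    show "P (pullback s h \<alpha>) + Q (pullback s h \<alpha>) =
        pullback t h (P \<alpha> + Q \<alpha>)"
      if "simplicial_isometry K h" "\<alpha> \<in> cochains K n s" for h \<alpha>
    proof -
      have "pullback t h (P \<alpha> + Q \<alpha>) =
          pullback t h (P \<alpha>) + pullback t h (Q \<alpha>)"
        using cochain_pullback_linear[of UNIV t h] unfolding linear_on_def by (metis UNIV_I)
      then show ?thesis using P(3)[OF that] Q(3)[OF that] by simp
    qed
  qed
next
  case (scale s t P z)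
  note P = equivariant_operatorD[OF scale.IH]
  show ?case
  proof (rule equivariant_operatorI)
    show "pscale z (P \<alpha>) \<in> cochains K n t" if "\<alpha> \<in> cochains K n s" for \<alpha>
      using P(1)[OF that] by (rule fs.subspace_scale[OF cochains_subspace])
    show "linear_on (cochains K n s) (\<lambda>\<alpha>. pscale z (P \<alpha>))"
      using P(2) unfolding linear_on_def by (simp add: fs.scale_right_distrib mult.commute)
    show "pscale z (P (pullback s h \<alpha>)) = pullback t h (pscale z (P \<alpha>))"
      if "simplicial_isometry K h" "\<alpha> \<in> cochains K n s" for h \<alpha>
    proof -
      have "pullback t h (pscale z (P \<alpha>)) = pscale z (pullback t h (P \<alpha>))"
        using cochain_pullback_linear[of UNIV t h] unfolding linear_on_def by (metis UNIV_I)
      then show ?thesis using P(3)[OF that] by simp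
    qed
  qed
next
  case (same_values s t P Q)
  note P = equivariant_operatorD[OF same_values.IH]
  have Q: "Q \<alpha> = P \<alpha>" if "\<alpha> \<in> cochains K n s" for \<alpha> using same_values.hyps(2) that by blast
  show ?case
  proof (rule equivariant_operatorI)
    show "linear_on (cochains K n s) Q"
      using P(2) unfolding linear_on_def by (simp add: Q cochains_add cochains_scale)
  qed (simp_all add: Q P cochain_pullback_closed)
qed

end

section \<open>Complex coefficients and the group action\<close>

context oriented_simplicial_complex
begin

text \<open>The star multiplies values by real numbers.\<close>

lemma hodge_component:
  fixes \<alpha> :: "('a, complex) cochain"
  shows "(\<lambda>x. Re (hodge K n ori j \<alpha> x)) = hodge K n ori j (\<lambda>x. Re (\<alpha> x))"
    "(\<lambda>x. Im (hodge K n ori j \<alpha> x)) = hodge K n ori j (\<lambda>x. Im (\<alpha> x))"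
  unfolding hodge_def cochain_of_def fun_eq_iff by (simp_all add: mult.assoc)

lemma cochain_components:
  fixes \<alpha> :: "('a, complex) cochain"
  assumes "\<alpha> \<in> cochains K n s"
  shows "(\<lambda>x. Re (\<alpha> x)) \<in> cochains K n s" "(\<lambda>x. Im (\<alpha> x)) \<in> cochains K n s"
  using assms unfolding cochains_def by auto

text \<open>Split a complex cochain into its real and imaginary part.\<close>

lemma hodge_bij_complex:
  assumes bij: "bij_betw (hodge K n ori j)
    (cochains K n (Primal j) :: ('a, real) cochain set) (cochains K n (Dual (n - j)))"
  shows "bij_betw (hodge K n ori j)
    (cochains K n (Primal j) :: ('a, complex) cochain set) (cochains K n (Dual (n - j)))"
    (is "bij_betw ?H ?W ?V")
  unfolding bij_betw_def
proof (intro conjI inj_onI subset_antisym image_subsetI subsetI)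
  fix \<alpha> \<beta> assume W: "\<alpha> \<in> ?W" "\<beta> \<in> ?W" and eq: "?H \<alpha> = ?H \<beta>"
  have inj: "inj_on (hodge K n ori j) (cochains K n (Primal j) :: ('a, real) cochain set)"
    using bij by (rule bij_betw_imp_inj_on)
  have "(\<lambda>x. Re (\<alpha> x)) = (\<lambda>x. Re (\<beta> x))"
    by (rule inj_onD[OF inj _ cochain_components(1)[OF W(1)] cochain_components(1)[OF W(2)]])
      (simp only: hodge_component[symmetric] eq)
  moreover have "(\<lambda>x. Im (\<alpha> x)) = (\<lambda>x. Im (\<beta> x))"
    by (rule inj_onD[OF inj _ cochain_components(2)[OF W(1)] cochain_components(2)[OF W(2)]])
      (simp only: hodge_component[symmetric] eq)
  ultimately show "\<alpha> = \<beta>" by (metis complex_eqI ext)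
next
  show "?H \<alpha> \<in> ?V" for \<alpha> by (rule operators_closed(3))
next
  fix \<beta> assume \<beta>: "\<beta> \<in> ?V"
  have img: "hodge K n ori j ` (cochains K n (Primal j) :: ('a, real) cochain set) = cochains K n (Dual (n - j))"
    using bij by (rule bij_betw_imp_surj_on)
  obtain a where a: "(\<lambda>x. Re (\<beta> x)) = hodge K n ori j a" "a \<in> cochains K n (Primal j)"
    using cochain_components(1)[OF \<beta>] unfolding img[symmetric] by (rule imageE)
  obtain b where b: "(\<lambda>x. Im (\<beta> x)) = hodge K n ori j b" "b \<in> cochains K n (Primal j)"
    using cochain_components(2)[OF \<beta>] unfolding img[symmetric] by (rule imageE)
  let ?c = "\<lambda>x. Complex (a x) (b x)"
  have c: "?c \<in> ?W"
    using a(2) b(2) unfolding cochains_def by (auto simp: complex_eq_iff)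
  have "(\<lambda>x. Re (?H ?c x)) = (\<lambda>x. Re (\<beta> x))" "(\<lambda>x. Im (?H ?c x)) = (\<lambda>x. Im (\<beta> x))"
    unfolding hodge_component a(1) b(1) by simp_all
  then have "?H ?c = \<beta>" by (metis complex_eqI ext)
  then show "\<beta> \<in> ?H ` ?W" using c by (metis imageI)
qed

lemma cochain_rep_pullback:
  "cochain_rep G K n ori act s g = cochain_pullback K n ori s (act (inv\<^bsub>G\<^esub> g))"
  unfolding cochain_rep_def cochain_pullback_def by (rule ext) simp

lemma action_isometry:
  "simplicial_isometry_action G K act \<Longrightarrow> g \<in> carrier G \<Longrightarrow> simplicial_isometry K (act g)"
  unfolding simplicial_isometry_action_def simplicial_isometry_def by blast

text \<open>
  A cochain is precomposed with \<open>g\<^sup>-\<^sup>1\<close>. Precomposition and inversion both reverse the order of a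
  product, so \<open>g h\<close> acts as \<open>h\<close> followed by \<open>g\<close>.
\<close>

lemma cochain_rep_finite_group_rep:
  assumes G: "group G" "finite (carrier G)" and act: "simplicial_isometry_action G K act"
  shows "finite_group_rep G (cochains K n s :: ('a, complex) cochain set) (cochain_rep G K n ori act s)"
proof -
  interpret group G by (rule G(1))
  interpret A: group_action G UNIV act using act unfolding simplicial_isometry_action_def by blast
  note iso = action_isometry[OF act] and rep = cochain_rep_pullback
  have act1: "act \<one>\<^bsub>G\<^esub> = (\<lambda>x. x)" using A.id_eq_one by (simp add: restrict_UNIV)
  show ?thesis
  proof (intro finite_group_rep.intro finite_group_rep_axioms.intro G)
    show "fs.subspace (cochains K n s :: ('a, complex) cochain set)" by (rule cochains_subspace)
    show "cochain_rep G K n ori act s g v \<in> cochains K n s" for g and v :: "('a, complex) cochain"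
      unfolding rep by (rule cochain_pullback_closed)
    show "linear_on (cochains K n s) (cochain_rep G K n ori act s g)" for g
      unfolding rep by (rule cochain_pullback_linear)
    fix v :: "('a, complex) cochain" assume v: "v \<in> cochains K n s"
    show "cochain_rep G K n ori act s \<one>\<^bsub>G\<^esub> v = v"
      using cochain_of_values[OF v] unfolding rep cochain_pullback_def by (simp add: act1)
    show "cochain_rep G K n ori act s (g \<otimes>\<^bsub>G\<^esub> h) v =
        cochain_rep G K n ori act s g (cochain_rep G K n ori act s h v)"
      if g: "g \<in> carrier G" and h: "h \<in> carrier G" for g h
      unfolding rep cochain_pullback_def[of K n ori s "act (inv\<^bsub>G\<^esub> g)"]
        cochain_pullback_def[of K n ori s "act (inv\<^bsub>G\<^esub> (g \<otimes>\<^bsub>G\<^esub> h))"]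
    proof (rule cochain_of_cong)
      fix S assume S: "S \<in> simplices s"
      let ?a = "act (inv\<^bsub>G\<^esub> g)" and ?b = "act (inv\<^bsub>G\<^esub> h)"
      interpret a: complex_with_isometry K n ori ?a by (rule with_isometry[OF iso[OF inv_closed[OF g]]])
      interpret b: complex_with_isometry K n ori ?b by (rule with_isometry[OF iso[OF inv_closed[OF h]]])
      have "act (inv\<^bsub>G\<^esub> (g \<otimes>\<^bsub>G\<^esub> h)) = ?b \<circ> ?a"
        using g h A.composition_rule[OF UNIV_I, of "inv\<^bsub>G\<^esub> h" "inv\<^bsub>G\<^esub> g"] by (auto simp: inv_mult_group)
      then show "v (elem_chain (cell_of s) (map (act (inv\<^bsub>G\<^esub> (g \<otimes>\<^bsub>G\<^esub> h))) (ori S))) =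
        cochain_pullback K n ori s ?b v (elem_chain (cell_of s) (map ?a (ori S)))"
        using b.pullback_elem_chain[OF v a.base_image[OF S] a.base_image_ordering[OF base_ori[OF S]]]
        by simp
    qed
  qed
qed

end

theorem theorem5p1:
  fixes K :: "'a::euclidean_space set set" and n :: nat and ori :: "'a set \<Rightarrow> 'a list"
    and eps :: "nat \<Rightarrow> real"
    and G :: "('g, 'm) monoid_scheme" and act :: "'g \<Rightarrow> 'a \<Rightarrow> 'a"
    and r :: nat and deg :: "nat \<Rightarrow> nat" and \<phi> :: "nat \<Rightarrow> 'g \<Rightarrow> complex mat"
    and J :: "nat set"
  assumes "oriented_complex K n ori"
    and "\<forall>k. eps k = 1 \<or> eps k = - 1"
    and "group G" and "finite (carrier G)"
    and "simplicial_isometry_action G K act"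
    and "distinct_irreducibles G r deg \<phi>"
    and "\<forall>j\<in>J. j \<le> n \<and>
           bij_betw (hodge K n ori j)
             (cochains K n (Primal j) :: (('a cell \<Rightarrow> real) \<Rightarrow> real) set)
             (cochains K n (Dual (n - j)))"
  shows
    "(\<forall>k l (P :: (('a cell \<Rightarrow> real) \<Rightarrow> real) \<Rightarrow> ('a cell \<Rightarrow> real) \<Rightarrow> real).
        dec_operator K n ori eps J (Primal k) (Primal l) P \<longrightarrow>
        (\<forall>g\<in>carrier G. \<forall>\<alpha>\<in>cochains K n (Primal k).
           P (cochain_rep G K n ori act (Primal k) g \<alpha>) =
           cochain_rep G K n ori act (Primal l) g (P \<alpha>)))
     \<and>
     (\<forall>k l (P :: (('a cell \<Rightarrow> real) \<Rightarrow> complex) \<Rightarrow> ('a cell \<Rightarrow> real) \<Rightarrow> complex).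
        dec_operator K n ori eps J (Primal k) (Primal l) P \<longrightarrow>
        (\<forall>g\<in>carrier G. \<forall>\<alpha>\<in>cochains K n (Primal k).
           P (cochain_rep G K n ori act (Primal k) g \<alpha>) =
           cochain_rep G K n ori act (Primal l) g (P \<alpha>)))
     \<and>
     (\<forall>k.
        let \<Omega> = (cochains K n (Primal k) :: (('a cell \<Rightarrow> real) \<Rightarrow> complex) set);
            \<rho> = cochain_rep G K n ori act (Primal k);
            V = (\<lambda>i. isotypic_projection G (deg i) (\<phi> i) \<rho> ` \<Omega>)
        in direct_sum \<Omega> r V \<and>
           (\<forall>i<r. V i = isotypic_component G \<rho> \<Omega> (deg i) (\<phi> i)) \<and>
           (\<forall>U. direct_sum \<Omega> r U \<and>
                (\<forall>i<r. U i = isotypic_component G \<rho> (U i) (deg i) (\<phi> i)) \<longrightarrow>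
                (\<forall>i<r. U i = V i)))
     \<and>
     (\<forall>k l (P :: (('a cell \<Rightarrow> real) \<Rightarrow> complex) \<Rightarrow> ('a cell \<Rightarrow> real) \<Rightarrow> complex) v1 w1.
        let \<Omega>k = cochains K n (Primal k); \<rho>k = cochain_rep G K n ori act (Primal k);
            \<Omega>l = cochains K n (Primal l); \<rho>l = cochain_rep G K n ori act (Primal l);
            Vk = (\<lambda>i. isotypic_projection G (deg i) (\<phi> i) \<rho>k ` \<Omega>k);
            Vl = (\<lambda>i. isotypic_projection G (deg i) (\<phi> i) \<rho>l ` \<Omega>l);
            \<beta>k = (\<lambda>i. adapted_part G \<rho>k (deg i) (\<phi> i) (v1 i));
            \<beta>l = (\<lambda>i. adapted_part G \<rho>l (deg i) (\<phi> i) (w1 i));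
            Bk = concat (map \<beta>k [0..<r]); Bl = concat (map \<beta>l [0..<r])
        in dec_operator K n ori eps J (Primal k) (Primal l) P \<and>
           (\<forall>i<r. ordered_basis (transfer_operator G (deg i) (\<phi> i) 0 0 \<rho>k ` \<Omega>k) (v1 i)) \<and>
           (\<forall>i<r. ordered_basis (transfer_operator G (deg i) (\<phi> i) 0 0 \<rho>l ` \<Omega>l) (w1 i)) \<longrightarrow>
           ordered_basis \<Omega>k Bk \<and> ordered_basis \<Omega>l Bl \<and>
           (\<forall>i<r. ordered_basis (Vk i) (\<beta>k i) \<and> ordered_basis (Vl i) (\<beta>l i) \<and>
                  P ` Vk i \<subseteq> Vl i) \<and>
           matrix_of Bk Bl P = diag_block_mat (map (\<lambda>i. matrix_of (\<beta>k i) (\<beta>l i) P) [0..<r]))"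
proof -
  interpret oriented_simplicial_complex K n ori by unfold_locales (rule assms(1))
  interpret group G by (rule assms(3))
  note iso = action_isometry[OF assms(5)] and rep = cochain_rep_pullback
  have rep_irr: "rep_with_irreducibles G (cochains K n s :: ('a, complex) cochain set)
      (cochain_rep G K n ori act s) r deg \<phi>" for s
    by (intro rep_with_irreducibles.intro rep_with_irreducibles_axioms.intro
        cochain_rep_finite_group_rep assms)
  have real: "equivariant_operator s t P" if "dec_operator K n ori eps J s t P"
    for s t and P :: "('a, real) cochain \<Rightarrow> ('a, real) cochain"
    by (rule dec_operator_equivariant[OF that assms(7)])
  have "\<forall>j\<in>J. j \<le> n \<and> bij_betw (hodge K n ori j)
      (cochains K n (Primal j) :: ('a, complex) cochain set) (cochains K n (Dual (n - j)))"
    using assms(7) hodge_bij_complex by blast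
  then have complex: "equivariant_operator s t P" if "dec_operator K n ori eps J s t P"
    for s t and P :: "('a, complex) cochain \<Rightarrow> ('a, complex) cochain"
    by (rule dec_operator_equivariant[OF that])
  show ?thesis
  proof (intro conjI allI impI ballI; (unfold Let_def, (rule impI)?)?)
    fix k l g and \<alpha> :: "('a, real) cochain"
      and P :: "('a, real) cochain \<Rightarrow> ('a, real) cochain"
    assume "dec_operator K n ori eps J (Primal k) (Primal l) P" "g \<in> carrier G"
      "\<alpha> \<in> cochains K n (Primal k)"
    then show "P (cochain_rep G K n ori act (Primal k) g \<alpha>) = cochain_rep G K n ori act (Primal l) g (P \<alpha>)"
      unfolding rep by (intro equivariant_operatorD(3)[OF real] iso inv_closed)
  next
    fix k l g and \<alpha> :: "('a, complex) cochain"
      and P :: "('a, complex) cochain \<Rightarrow> ('a, complex) cochain"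
    assume "dec_operator K n ori eps J (Primal k) (Primal l) P" "g \<in> carrier G"
      "\<alpha> \<in> cochains K n (Primal k)"
    then show "P (cochain_rep G K n ori act (Primal k) g \<alpha>) = cochain_rep G K n ori act (Primal l) g (P \<alpha>)"
      unfolding rep by (intro equivariant_operatorD(3)[OF complex] iso inv_closed)
  next
    fix k
    interpret rep_with_irreducibles G "cochains K n (Primal k) :: ('a, complex) cochain set"
      "cochain_rep G K n ori act (Primal k)" r deg \<phi> by (rule rep_irr)
    let ?W = "cochains K n (Primal k) :: ('a, complex) cochain set"
    show "direct_sum ?W r (\<lambda>i. E i ` ?W) \<and>
       (\<forall>i<r. E i ` ?W = isotypic_component G (cochain_rep G K n ori act (Primal k)) ?W (deg i) (\<phi> i)) \<and>
       (\<forall>U. direct_sum ?W r U \<and>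
          (\<forall>i<r. U i = isotypic_component G (cochain_rep G K n ori act (Primal k)) (U i) (deg i) (\<phi> i)) \<longrightarrow>
          (\<forall>i<r. U i = E i ` ?W))"
    proof (intro conjI allI impI)
      show "direct_sum ?W r (\<lambda>i. E i ` ?W)" by (rule direct_sum_E)
      show "E i ` ?W = isotypic_component G (cochain_rep G K n ori act (Primal k)) ?W (deg i) (\<phi> i)" if "i < r" for i
        by (rule isotypic_component_eq[OF that, symmetric])
      show "U i = E i ` ?W" if "direct_sum ?W r U \<and>
        (\<forall>i<r. U i = isotypic_component G (cochain_rep G K n ori act (Primal k)) (U i) (deg i) (\<phi> i))" "i < r" for U i
        using conjunct1[OF that(1)] conjunct2[OF that(1), rule_format] that(2) by (rule direct_sum_unique)
    qed
  next
    fix k l and P :: "('a, complex) cochain \<Rightarrow> ('a, complex) cochain" and v1 w1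
    let ?\<Omega>k = "cochains K n (Primal k) :: ('a, complex) cochain set"
    let ?\<Omega>l = "cochains K n (Primal l) :: ('a, complex) cochain set"
    let ?\<rho>k = "cochain_rep G K n ori act (Primal k) :: 'g \<Rightarrow> ('a, complex) cochain \<Rightarrow> _"
    let ?\<rho>l = "cochain_rep G K n ori act (Primal l) :: 'g \<Rightarrow> ('a, complex) cochain \<Rightarrow> _"
    let ?\<beta>k = "\<lambda>i. adapted_part G ?\<rho>k (deg i) (\<phi> i) (v1 i)"
    let ?\<beta>l = "\<lambda>i. adapted_part G ?\<rho>l (deg i) (\<phi> i) (w1 i)"
    assume asm: "dec_operator K n ori eps J (Primal k) (Primal l) P \<and>
      (\<forall>i<r. ordered_basis (transfer_operator G (deg i) (\<phi> i) 0 0 ?\<rho>k ` ?\<Omega>k) (v1 i)) \<and>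
      (\<forall>i<r. ordered_basis (transfer_operator G (deg i) (\<phi> i) 0 0 ?\<rho>l ` ?\<Omega>l) (w1 i))"
    interpret k: rep_with_irreducibles G ?\<Omega>k ?\<rho>k r deg \<phi> by (rule rep_irr)
    interpret l: rep_with_irreducibles G ?\<Omega>l ?\<rho>l r deg \<phi> by (rule rep_irr)
    note P = equivariant_operatorD[OF complex[OF conjunct1[OF asm]]]
    have bk: "ordered_basis (k.E i ` ?\<Omega>k) (?\<beta>k i)" if "i < r" for i
      using asm that by (intro k.adapted_part_basis) auto
    have bl: "ordered_basis (l.E i ` ?\<Omega>l) (?\<beta>l i)" if "i < r" for i
      using asm that by (intro l.adapted_part_basis) auto
    have Bk: "ordered_basis ?\<Omega>k (concat (map ?\<beta>k [0..<r]))"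
      using asm by (intro k.adapted_basis) auto
    have Bl: "ordered_basis ?\<Omega>l (concat (map ?\<beta>l [0..<r]))"
      using asm by (intro l.adapted_basis) auto
    have PV: "P ` (k.E i ` ?\<Omega>k) \<subseteq> l.E i ` ?\<Omega>l" for i
    proof clarify
      fix v assume v: "v \<in> ?\<Omega>k"
      have "P (k.E i v) = l.E i (P v)"
        unfolding isotypic_projection_def
        by (rule equivariant_weighted_sum[OF k.finite_group_rep_axioms P(2) _ v])
          (unfold rep, intro P(3) iso inv_closed)
      then show "P (k.E i v) \<in> l.E i ` ?\<Omega>l" using P(1)[OF v] by simp
    qed
    have "matrix_of (concat (map ?\<beta>k [0..<r])) (concat (map ?\<beta>l [0..<r])) P =
      diag_block_mat (map (\<lambda>i. matrix_of (?\<beta>k i) (?\<beta>l i) P) [0..<r])"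
    proof (rule matrix_of_block_diagonal[OF Bl])
      fix i x assume i: "i < r" and x: "x \<in> set (?\<beta>k i)"
      have "x \<in> k.E i ` ?\<Omega>k" using ordered_basis_subset[OF bk[OF i]] x by blast
      then have "P x \<in> l.E i ` ?\<Omega>l" using PV by blast
      then show "P x \<in> fs.span (set (?\<beta>l i))" using bl[OF i] unfolding ordered_basis_def by simp
    qed
    then show "ordered_basis ?\<Omega>k (concat (map ?\<beta>k [0..<r])) \<and> ordered_basis ?\<Omega>l (concat (map ?\<beta>l [0..<r])) \<and>
      (\<forall>i<r. ordered_basis (k.E i ` ?\<Omega>k) (?\<beta>k i) \<and> ordered_basis (l.E i ` ?\<Omega>l) (?\<beta>l i) \<and>
         P ` (k.E i ` ?\<Omega>k) \<subseteq> l.E i ` ?\<Omega>l) \<and>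
      matrix_of (concat (map ?\<beta>k [0..<r])) (concat (map ?\<beta>l [0..<r])) P =
        diag_block_mat (map (\<lambda>i. matrix_of (?\<beta>k i) (?\<beta>l i) P) [0..<r])"
      using bk bl Bk Bl PV by blast
  qed
qed

end
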